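(* Let $\mathbb{K}$ be a field of characteristic $0$ and let $\mathfrak{L}$ be a Lie-Yamaguti algebra over $\mathbb{K}$ of dimension $n$, with basis $\{e_1,\dots,e_n\}$, universal algebra $\mathcal{A}(\mathfrak{L})$ with generators $x_{si}$ ($s,i=1,\dots,n$), and the Lie-Yamaguti algebra morphism $\Phi_{\mathfrak{L}}:\mathfrak{L}\to\mathfrak{L}\otimes\mathcal{A}(\mathfrak{L})$, $\Phi_{\mathfrak{L}}(e_i)=\sum_{s=1}^n e_s\otimes x_{si}$. Then there exists a unique bialgebra structure on the algebra $\mathcal{A}(\mathfrak{L})$ such that $\Phi_{\mathfrak{L}}$ gives a right $\mathcal{A}(\mathfrak{L})$-comodule structure on $\mathfrak{L}$. The comultiplication $\Delta$ and the counit $\varepsilon$ of this structure are given by $$\Delta(x_{ij})=\sum_{s=1}^n x_{is}\otimes x_{sj}\quad\text{and}\quad \varepsilon(x_{ij})=\delta_{ij},\qquad \forall\, i,j=1,\dots,n.$$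
   Context: All vector spaces and (multi)linear maps are over a fixed field $\mathbb{K}$ of characteristic $0$; algebras are unital and associative, coalgebras are counital and coassociative. A Lie-Yamaguti algebra is a triple $(\mathfrak{L},[\cdot,\cdot],\{\cdot,\cdot,\cdot\})$ with $\mathfrak{L}$ a $\mathbb{K}$-vector space, $[\cdot,\cdot]$ bilinear and $\{\cdot,\cdot,\cdot\}$ trilinear (both with values in $\mathfrak{L}$) such that for all $a,b,c,d,e\in\mathfrak{L}$: (LY1) $[a,b]=-[b,a]$; (LY2) $\{a,b,c\}=-\{b,a,c\}$; (LY3) $[[a,b],c]+\{a,b,c\}+[[b,c],a]+\{b,c,a\}+[[c,a],b]+\{c,a,b\}=0$; (LY4) $\{[a,b],c,d\}+\{[b,c],a,d\}+\{[c,a],b,d\}=0$; (LY5) $\{a,b,[c,d]\}=[\{a,b,c\},d]+[c,\{a,b,d\}]$; (LY6) $\{a,b,\{c,d,e\}\}=\{\{a,b,c\},d,e\}+\{c,\{a,b,d\},e\}+\{c,d,\{a,b,e\}\}$. A Lie-Yamaguti algebra morphism is a linear map preserving both brackets. For a commutative algebra $A$, $\mathfrak{L}\otimes A$ is a Lie-Yamaguti algebra with $[x\otimes a,y\otimes b]=[x,y]\otimes ab$ and $\{x\otimes a,y\otimes b,z\otimes c\}=\{x,y,z\}\otimes abc$. Universal algebra of $\mathfrak{L}$: let $\tau_{ij}^s,\omega_{ijk}^s\in\mathbb{K}$ be the structure constants, $[e_i,e_j]=\sum_{s=1}^n\tau_{ij}^s e_s$ and $\{e_i,e_j,e_k\}=\sum_{s=1}^n\omega_{ijk}^s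 e_s$. Then $\mathcal{A}(\mathfrak{L}):=\mathbb{K}[X_{si}:s,i=1,\dots,n]/J$, where $J$ is the ideal generated by all polynomials $\sum_{u=1}^n\tau_{ij}^u X_{au}-\sum_{s,t=1}^n\tau_{st}^a X_{si}X_{tj}$ and $\sum_{u=1}^n\omega_{ijk}^u X_{au}-\sum_{r,s,t=1}^n\omega_{rst}^a X_{ri}X_{sj}X_{tk}$, for $a,i,j,k=1,\dots,n$; $x_{si}$ denotes the class of $X_{si}$. The map $\Phi_{\mathfrak{L}}$ in the claim is a Lie-Yamaguti algebra morphism. A right comodule over a coalgebra $(C,\Delta,\varepsilon)$ is a vector space $M$ with a linear map $f:M\to M\otimes C$ such that $(id\otimes\Delta)\circ f=(f\otimes id)\circ f$ and $(id\otimes\varepsilon)\circ f=id$ (identifying $M\otimes\mathbb{K}$ with $M$). A bialgebra structure on an algebra is a coalgebra structure whose comultiplication and counit are algebra morphisms. *)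

theory Defs
  imports "HOL-Library.Poly_Mapping" "HOL-Algebra.Module" "HOL-Algebra.QuotRing"
begin

section \<open>Vector spaces and algebras over a field\<close>

text \<open>
  The ground field is a type \<open>'k\<close>. A vector space is a \<open>module\<close> record \<open>V\<close> with
  \<open>module ground V\<close>; its fields \<open>mult\<close> and \<open>one\<close> are then irrelevant.
\<close>

definition ground :: "('k::field, 'k) module" where
  "ground = \<lparr>carrier = UNIV, monoid.mult = (*), one = 1, ring.zero = 0, add = (+), smult = (*)\<rparr>"

definition lin_map ::
  "('k, 'v, 'p) module_scheme \<Rightarrow> ('k, 'w, 'q) module_scheme \<Rightarrow> ('v \<Rightarrow> 'w) \<Rightarrow> bool" where
  "lin_map V W f \<longleftrightarrow>
     f \<in> carrier V \<rightarrow> carrier W \<and>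
     (\<forall>x\<in>carrier V. \<forall>y\<in>carrier V. f (x \<oplus>\<^bsub>V\<^esub> y) = f x \<oplus>\<^bsub>W\<^esub> f y) \<and>
     (\<forall>c. \<forall>x\<in>carrier V. f (c \<odot>\<^bsub>V\<^esub> x) = c \<odot>\<^bsub>W\<^esub> f x)"

definition is_basis ::
  "('k::field, 'v, 'p) module_scheme \<Rightarrow> 'i set \<Rightarrow> ('i \<Rightarrow> 'v) \<Rightarrow> bool" where
  "is_basis V I e \<longleftrightarrow>
     finite I \<and> e \<in> I \<rightarrow> carrier V \<and>
     (\<forall>c. (\<Oplus>\<^bsub>V\<^esub>i\<in>I. c i \<odot>\<^bsub>V\<^esub> e i) = \<zero>\<^bsub>V\<^esub> \<longrightarrow> (\<forall>i\<in>I. c i = 0)) \<and>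
     (\<forall>v\<in>carrier V. \<exists>c. v = (\<Oplus>\<^bsub>V\<^esub>i\<in>I. c i \<odot>\<^bsub>V\<^esub> e i))"

text \<open>Unital associative algebras; the locale \<open>algebra\<close> of HOL-Algebra is the commutative case.\<close>

locale assoc_algebra = module ground A + ring A for A :: "('k::field, 'a) module" (structure) +
  assumes smult_mult_left:
      "x \<in> carrier A \<Longrightarrow> y \<in> carrier A \<Longrightarrow> (c \<odot> x) \<otimes> y = c \<odot> (x \<otimes> y)"
    and smult_mult_right:
      "x \<in> carrier A \<Longrightarrow> y \<in> carrier A \<Longrightarrow> x \<otimes> (c \<odot> y) = c \<odot> (x \<otimes> y)"

definition algebra_hom ::
  "('k, 'a, 'p) module_scheme \<Rightarrow> ('k, 'b, 'q) module_scheme \<Rightarrow> ('a \<Rightarrow> 'b) \<Rightarrow> bool" where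
  "algebra_hom A B f \<longleftrightarrow> lin_map A B f \<and> f \<in> ring_hom A B"

text \<open>
  The quotient ring (or just quotient group) of HOL-Algebra with the induced scalar
  multiplication: for a representative \<open>x\<close> of \<open>X\<close>, the union below is the coset of
  \<open>c \<odot> x\<close>. (The image of \<open>X\<close> under \<open>c \<odot> _\<close> would be wrong for \<open>c = 0\<close>.)
\<close>

definition quot_algebra ::
  "('k, 'a, 'p) module_scheme \<Rightarrow> 'a set \<Rightarrow> ('k, 'a set) module" where
  "quot_algebra M N = ring.extend (M Quot N)
     (module.fields (\<lambda>c X. \<Union>x\<in>X. N +>\<^bsub>M\<^esub> (c \<odot>\<^bsub>M\<^esub> x)))"


section \<open>Tensor products\<close>

text \<open>
  The free vector space on \<open>V \<times> W\<close>. If \<open>V\<close> and \<open>W\<close> are algebras, it is the monoid algebra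
  of the multiplicative monoid \<open>V \<times> W\<close>; the bilinearity relations span an ideal in it, and
  the quotient multiplication is \<open>(v \<otimes> w) (v' \<otimes> w') = v v' \<otimes> w w'\<close>.
\<close>

definition free_pairs ::
  "('k::field, 'v, 'p) module_scheme \<Rightarrow> ('k, 'w, 'q) module_scheme \<Rightarrow>
     ('k, ('v \<times> 'w) \<Rightarrow>\<^sub>0 'k) module" where
  "free_pairs V W =
     \<lparr>carrier = {p. Poly_Mapping.keys p \<subseteq> carrier V \<times> carrier W},
      monoid.mult = (\<lambda>p q. \<Sum>(v, w)\<in>Poly_Mapping.keys p. \<Sum>(v', w')\<in>Poly_Mapping.keys q.
                Poly_Mapping.single (v \<otimes>\<^bsub>V\<^esub> v', w \<otimes>\<^bsub>W\<^esub> w')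
                  (Poly_Mapping.lookup p (v, w) * Poly_Mapping.lookup q (v', w'))),
      one = Poly_Mapping.single (\<one>\<^bsub>V\<^esub>, \<one>\<^bsub>W\<^esub>) 1,
      ring.zero = 0,
      add = (+),
      smult = (\<lambda>c. Poly_Mapping.map ((*) c))\<rparr>"

inductive_set bilinear_relations ::
  "('k::field, 'v, 'p) module_scheme \<Rightarrow> ('k, 'w, 'q) module_scheme \<Rightarrow>
     (('v \<times> 'w) \<Rightarrow>\<^sub>0 'k) set"
  for V :: "('k::field, 'v, 'p) module_scheme" and W :: "('k, 'w, 'q) module_scheme" where
  zero: "0 \<in> bilinear_relations V W"
| add: "p \<in> bilinear_relations V W \<Longrightarrow> q \<in> bilinear_relations V W \<Longrightarrow>
    p + q \<in> bilinear_relations V W"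
| smult: "p \<in> bilinear_relations V W \<Longrightarrow> Poly_Mapping.map ((*) c) p \<in> bilinear_relations V W"
| add_left: "v \<in> carrier V \<Longrightarrow> v' \<in> carrier V \<Longrightarrow> w \<in> carrier W \<Longrightarrow>
    Poly_Mapping.single (v \<oplus>\<^bsub>V\<^esub> v', w) 1
      - Poly_Mapping.single (v, w) 1 - Poly_Mapping.single (v', w) 1 \<in> bilinear_relations V W"
| add_right: "v \<in> carrier V \<Longrightarrow> w \<in> carrier W \<Longrightarrow> w' \<in> carrier W \<Longrightarrow>
    Poly_Mapping.single (v, w \<oplus>\<^bsub>W\<^esub> w') 1
      - Poly_Mapping.single (v, w) 1 - Poly_Mapping.single (v, w') 1 \<in> bilinear_relations V W"
| smult_left: "v \<in> carrier V \<Longrightarrow> w \<in> carrier W \<Longrightarrow>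
    Poly_Mapping.single (c \<odot>\<^bsub>V\<^esub> v, w) 1 - Poly_Mapping.single (v, w) c \<in> bilinear_relations V W"
| smult_right: "v \<in> carrier V \<Longrightarrow> w \<in> carrier W \<Longrightarrow>
    Poly_Mapping.single (v, c \<odot>\<^bsub>W\<^esub> w) 1 - Poly_Mapping.single (v, w) c \<in> bilinear_relations V W"

type_synonym ('k, 'v, 'w) tens = "(('v \<times> 'w) \<Rightarrow>\<^sub>0 'k) set"

definition tensor ::
  "('k::field, 'v, 'p) module_scheme \<Rightarrow> ('k, 'w, 'q) module_scheme \<Rightarrow>
     ('k, ('k, 'v, 'w) tens) module" where
  "tensor V W = quot_algebra (free_pairs V W) (bilinear_relations V W)"

definition pure_tensor ::
  "('k::field, 'v, 'p) module_scheme \<Rightarrow> ('k, 'w, 'q) module_scheme \<Rightarrow>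
     'v \<Rightarrow> 'w \<Rightarrow> ('k, 'v, 'w) tens" where
  "pure_tensor V W v w =
     bilinear_relations V W +>\<^bsub>free_pairs V W\<^esub> Poly_Mapping.single (v, w) 1"

text \<open>
  For bilinear \<open>\<beta>\<close> with values in \<open>U\<close>, the linear map with \<open>v \<otimes> w \<mapsto> \<beta> v w\<close>; the value does
  not depend on the chosen representative.
\<close>

definition tensor_lift ::
  "('k::field, 'u, 'p) module_scheme \<Rightarrow> ('v \<Rightarrow> 'w \<Rightarrow> 'u) \<Rightarrow> ('k, 'v, 'w) tens \<Rightarrow> 'u" where
  "tensor_lift U \<beta> T = (let p = (SOME p. p \<in> T) in
     \<Oplus>\<^bsub>U\<^esub>z\<in>Poly_Mapping.keys p. Poly_Mapping.lookup p z \<odot>\<^bsub>U\<^esub> \<beta> (fst z) (snd z))"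

text \<open>\<open>f \<otimes> g\<close>, where \<open>V\<close> and \<open>W\<close> are the codomains of \<open>f\<close> and \<open>g\<close>.\<close>

definition tensor_map ::
  "('k::field, 'v, 'p) module_scheme \<Rightarrow> ('k, 'w, 'q) module_scheme \<Rightarrow>
     ('v' \<Rightarrow> 'v) \<Rightarrow> ('w' \<Rightarrow> 'w) \<Rightarrow> ('k, 'v', 'w') tens \<Rightarrow> ('k, 'v, 'w) tens" where
  "tensor_map V W f g = tensor_lift (tensor V W) (\<lambda>x y. pure_tensor V W (f x) (g y))"

text \<open>\<open>(U \<otimes> V) \<otimes> W \<rightarrow> U \<otimes> (V \<otimes> W)\<close>, \<open>V \<otimes> \<KK> \<rightarrow> V\<close> and \<open>\<KK> \<otimes> V \<rightarrow> V\<close>:\<close>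

definition tensor_assoc ::
  "('k::field, 'u, 'p) module_scheme \<Rightarrow> ('k, 'v, 'q) module_scheme \<Rightarrow>
     ('k, 'w, 'r) module_scheme \<Rightarrow>
     ('k, ('k, 'u, 'v) tens, 'w) tens \<Rightarrow> ('k, 'u, ('k, 'v, 'w) tens) tens" where
  "tensor_assoc U V W =
     tensor_lift (tensor U (tensor V W))
       (\<lambda>t w. tensor_lift (tensor U (tensor V W))
          (\<lambda>u v. pure_tensor U (tensor V W) u (pure_tensor V W v w)) t)"

definition tensor_unit_right ::
  "('k::field, 'v, 'p) module_scheme \<Rightarrow> ('k, 'v, 'k) tens \<Rightarrow> 'v" where
  "tensor_unit_right V = tensor_lift V (\<lambda>v c. c \<odot>\<^bsub>V\<^esub> v)"

definition tensor_unit_left ::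
  "('k::field, 'v, 'p) module_scheme \<Rightarrow> ('k, 'k, 'v) tens \<Rightarrow> 'v" where
  "tensor_unit_left V = tensor_lift V (\<lambda>c v. c \<odot>\<^bsub>V\<^esub> v)"


section \<open>Coalgebras, bialgebras, comodules\<close>

locale coalgebra = module ground C
  for C :: "('k::field, 'c) module" (structure) +
  fixes \<Delta> :: "'c \<Rightarrow> ('k, 'c, 'c) tens"
    and \<epsilon> :: "'c \<Rightarrow> 'k"
  assumes comult_linear: "lin_map C (tensor C C) \<Delta>"
    and counit_linear: "lin_map C ground \<epsilon>"
    and coassoc: "c \<in> carrier C \<Longrightarrow>
      tensor_map C (tensor C C) id \<Delta> (\<Delta> c) =
      tensor_assoc C C C (tensor_map (tensor C C) C \<Delta> id (\<Delta> c))"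
    and counit_left: "c \<in> carrier C \<Longrightarrow>
      tensor_unit_left C (tensor_map ground C \<epsilon> id (\<Delta> c)) = c"
    and counit_right: "c \<in> carrier C \<Longrightarrow>
      tensor_unit_right C (tensor_map C ground id \<epsilon> (\<Delta> c)) = c"

locale bialgebra = assoc_algebra A + coalgebra A \<Delta> \<epsilon>
  for A :: "('k::field, 'a) module" (structure)
    and \<Delta> :: "'a \<Rightarrow> ('k, 'a, 'a) tens"
    and \<epsilon> :: "'a \<Rightarrow> 'k" +
  assumes comult_hom: "algebra_hom A (tensor A A) \<Delta>"
    and counit_hom: "algebra_hom A ground \<epsilon>"

locale right_comodule = coalgebra C \<Delta> \<epsilon> + comod: module ground M
  for M :: "('k::field, 'm) module"
    and C :: "('k, 'c) module" (structure)
    and \<Delta> :: "'c \<Rightarrow> ('k, 'c, 'c) tens"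
    and \<epsilon> :: "'c \<Rightarrow> 'k"
    and f :: "'m \<Rightarrow> ('k, 'm, 'c) tens" +
  assumes coaction_linear: "lin_map M (tensor M C) f"
    and coaction_coassoc: "m \<in> carrier M \<Longrightarrow>
      tensor_map M (tensor C C) id \<Delta> (f m) =
      tensor_assoc M C C (tensor_map (tensor M C) C f id (f m))"
    and coaction_counit: "m \<in> carrier M \<Longrightarrow>
      tensor_unit_right M (tensor_map M ground id \<epsilon> (f m)) = m"


section \<open>Lie-Yamaguti algebras\<close>

locale lie_yamaguti = module ground L
  for L :: "('k::field, 'l) module" (structure) +
  fixes br :: "'l \<Rightarrow> 'l \<Rightarrow> 'l"
    and tri :: "'l \<Rightarrow> 'l \<Rightarrow> 'l \<Rightarrow> 'l"
  assumes br_linear_1: "b \<in> carrier L \<Longrightarrow> lin_map L L (\<lambda>a. br a b)"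
    and br_linear_2: "a \<in> carrier L \<Longrightarrow> lin_map L L (\<lambda>b. br a b)"
    and tri_linear_1: "b \<in> carrier L \<Longrightarrow> c \<in> carrier L \<Longrightarrow> lin_map L L (\<lambda>a. tri a b c)"
    and tri_linear_2: "a \<in> carrier L \<Longrightarrow> c \<in> carrier L \<Longrightarrow> lin_map L L (\<lambda>b. tri a b c)"
    and tri_linear_3: "a \<in> carrier L \<Longrightarrow> b \<in> carrier L \<Longrightarrow> lin_map L L (\<lambda>c. tri a b c)"
    and LY1: "a \<in> carrier L \<Longrightarrow> b \<in> carrier L \<Longrightarrow> br a b = \<ominus> br b a"
    and LY2: "a \<in> carrier L \<Longrightarrow> b \<in> carrier L \<Longrightarrow> c \<in> carrier L \<Longrightarrow>
      tri a b c = \<ominus> tri b a c"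
    and LY3: "a \<in> carrier L \<Longrightarrow> b \<in> carrier L \<Longrightarrow> c \<in> carrier L \<Longrightarrow>
      br (br a b) c \<oplus> tri a b c \<oplus> br (br b c) a \<oplus> tri b c a \<oplus> br (br c a) b \<oplus> tri c a b = \<zero>"
    and LY4: "a \<in> carrier L \<Longrightarrow> b \<in> carrier L \<Longrightarrow> c \<in> carrier L \<Longrightarrow> d \<in> carrier L \<Longrightarrow>
      tri (br a b) c d \<oplus> tri (br b c) a d \<oplus> tri (br c a) b d = \<zero>"
    and LY5: "a \<in> carrier L \<Longrightarrow> b \<in> carrier L \<Longrightarrow> c \<in> carrier L \<Longrightarrow> d \<in> carrier L \<Longrightarrow>
      tri a b (br c d) = br (tri a b c) d \<oplus> br c (tri a b d)"
    and LY6: "a \<in> carrier L \<Longrightarrow> b \<in> carrier L \<Longrightarrow> c \<in> carrier L \<Longrightarrow> d \<in> carrier L \<Longrightarrow>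
      e \<in> carrier L \<Longrightarrow>
      tri a b (tri c d e) = tri (tri a b c) d e \<oplus> tri c (tri a b d) e \<oplus> tri c d (tri a b e)"


section \<open>The universal algebra\<close>

type_synonym 'k matrix_poly = "((nat \<times> nat) \<Rightarrow>\<^sub>0 nat) \<Rightarrow>\<^sub>0 'k"

definition poly_const :: "'k::field \<Rightarrow> 'k matrix_poly" where
  "poly_const c = Poly_Mapping.single 0 c"

definition poly_var :: "nat \<Rightarrow> nat \<Rightarrow> 'k::field matrix_poly" where
  "poly_var s i = Poly_Mapping.single (Poly_Mapping.single (s, i) 1) 1"

definition matrix_poly_algebra :: "nat \<Rightarrow> ('k::field, 'k matrix_poly) module" where
  "matrix_poly_algebra n =
     \<lparr>carrier = {p. \<forall>m\<in>Poly_Mapping.keys p. Poly_Mapping.keys m \<subseteq> {1..n} \<times> {1..n}},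
      monoid.mult = (*), one = 1, ring.zero = 0, add = (+), smult = (\<lambda>c p. poly_const c * p)\<rparr>"

text \<open>
  The structure constants are indexed in the order of the formulas
  \<open>[e\<^sub>i, e\<^sub>j] = \<Sum>\<^sub>s \<tau> s i j e\<^sub>s\<close> and \<open>{e\<^sub>i, e\<^sub>j, e\<^sub>k} = \<Sum>\<^sub>s \<omega> s i j k e\<^sub>s\<close>.
\<close>

definition br_relation ::
  "nat \<Rightarrow> (nat \<Rightarrow> nat \<Rightarrow> nat \<Rightarrow> 'k) \<Rightarrow> nat \<Rightarrow> nat \<Rightarrow> nat \<Rightarrow> 'k::field matrix_poly" where
  "br_relation n \<tau> a i j =
     (\<Sum>u\<in>{1..n}. poly_const (\<tau> u i j) * poly_var a u)
     - (\<Sum>s\<in>{1..n}. \<Sum>t\<in>{1..n}. poly_const (\<tau> a s t) * poly_var s i * poly_var t j)"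

definition tri_relation ::
  "nat \<Rightarrow> (nat \<Rightarrow> nat \<Rightarrow> nat \<Rightarrow> nat \<Rightarrow> 'k) \<Rightarrow> nat \<Rightarrow> nat \<Rightarrow> nat \<Rightarrow> nat \<Rightarrow>
     'k::field matrix_poly" where
  "tri_relation n \<omega> a i j k =
     (\<Sum>u\<in>{1..n}. poly_const (\<omega> u i j k) * poly_var a u)
     - (\<Sum>r\<in>{1..n}. \<Sum>s\<in>{1..n}. \<Sum>t\<in>{1..n}.
          poly_const (\<omega> a r s t) * poly_var r i * poly_var s j * poly_var t k)"

definition universal_ideal ::
  "nat \<Rightarrow> (nat \<Rightarrow> nat \<Rightarrow> nat \<Rightarrow> 'k) \<Rightarrow> (nat \<Rightarrow> nat \<Rightarrow> nat \<Rightarrow> nat \<Rightarrow> 'k) \<Rightarrow>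
     'k::field matrix_poly set" where
  "universal_ideal n \<tau> \<omega> = Idl\<^bsub>matrix_poly_algebra n\<^esub>
     ({br_relation n \<tau> a i j | a i j. a \<in> {1..n} \<and> i \<in> {1..n} \<and> j \<in> {1..n}} \<union>
      {tri_relation n \<omega> a i j k | a i j k.
         a \<in> {1..n} \<and> i \<in> {1..n} \<and> j \<in> {1..n} \<and> k \<in> {1..n}})"

definition universal_algebra ::
  "nat \<Rightarrow> (nat \<Rightarrow> nat \<Rightarrow> nat \<Rightarrow> 'k) \<Rightarrow> (nat \<Rightarrow> nat \<Rightarrow> nat \<Rightarrow> nat \<Rightarrow> 'k) \<Rightarrow>
     ('k::field, 'k matrix_poly set) module" where
  "universal_algebra n \<tau> \<omega> = quot_algebra (matrix_poly_algebra n) (universal_ideal n \<tau> \<omega>)"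

definition universal_gen ::
  "nat \<Rightarrow> (nat \<Rightarrow> nat \<Rightarrow> nat \<Rightarrow> 'k) \<Rightarrow> (nat \<Rightarrow> nat \<Rightarrow> nat \<Rightarrow> nat \<Rightarrow> 'k) \<Rightarrow>
     nat \<Rightarrow> nat \<Rightarrow> 'k::field matrix_poly set" where
  "universal_gen n \<tau> \<omega> s i =
     universal_ideal n \<tau> \<omega> +>\<^bsub>matrix_poly_algebra n\<^esub> poly_var s i"

end

theory Submission
  imports Defs
begin

text \<open>
  For a commutative algebra \<open>B\<close>, algebra homomorphisms from the universal algebra \<open>A\<close> to \<open>B\<close>
  correspond to matrices \<open>g\<close> over \<open>B\<close> that satisfy the defining relations of \<open>A\<close> (\<open>ex_hom\<close>,
  \<open>ly_matrix_gens\<close>, \<open>hom_eq_on_gens\<close>). These relations say that the \<open>B\<close>-linear map of \<open>L \<otimes> B\<close> with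
  matrix \<open>g\<close> preserves both brackets, so the identity matrix satisfies them (\<open>ly_matrix_id\<close>), and
  the matrices that satisfy them are closed under multiplication (\<open>ly_matrix_mult\<close>). Over a
  commutative algebra, a bracket with structure matrix \<open>\<sigma>\<close> is preserved iff \<open>g \<sigma> = \<sigma> G\<close>, where \<open>G\<close>
  is the Kronecker square or cube of \<open>g\<close>; closure under products is then associativity of matrix
  multiplication together with multiplicativity of the Kronecker product.

  The counit is the homomorphism belonging to the identity matrix over the ground field. The
  comultiplication is the one belonging to the product, over \<open>A \<otimes> A\<close>, of the matrices
  \<open>(x\<^sub>s\<^sub>i \<otimes> 1)\<close> and \<open>(1 \<otimes> x\<^sub>s\<^sub>i)\<close>, whose entry at \<open>(i, j)\<close> is \<open>\<Sum>\<^sub>s x\<^sub>i\<^sub>s \<otimes> x\<^sub>s\<^sub>j\<close>. The bialgebra axioms equate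
  algebra homomorphisms on \<open>A\<close> and need checking only on the generators; the comodule axioms
  equate linear maps on \<open>L\<close> and need checking only on the basis. Except for the
  left counit axiom, each of these checks is an instance of a rearrangement of finite sums that is
  carried out for an arbitrary linear map \<open>m\<^sub>j \<mapsto> \<Sum>\<^sub>s m\<^sub>s \<otimes> x\<^sub>s\<^sub>j\<close>
  (\<open>map_right_coaction\<close>, \<open>map_left_coaction\<close>, \<open>counit_coaction\<close>): the map \<open>\<Phi>\<close> and, on each row of
  the matrix of generators, the map \<open>\<Delta>\<close> are of this form.

  Conversely, in the comodule axioms for \<open>\<Phi>\<close> at \<open>e\<^sub>j\<close> the coefficients of the basis elements
  \<open>e\<^sub>i\<close> can be compared (\<open>tensor_basis_unique\<close>), and this is exactly the pair of formulas for
  \<open>\<Delta> (x\<^sub>i\<^sub>j)\<close> and \<open>\<epsilon> (x\<^sub>i\<^sub>j)\<close>. As \<open>\<Delta>\<close> and \<open>\<epsilon>\<close> are algebra homomorphisms, they are determined by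
  these values.

  The tensor products are quotients of free vector spaces, and the universal algebra is a quotient
  of a polynomial algebra. The first part of the development provides their universal properties.
\<close>


section \<open>Linear and bilinear maps\<close>

lemma ground_simps [simp]:
  "carrier ground = UNIV" "x \<oplus>\<^bsub>ground\<^esub> y = x + y" "x \<otimes>\<^bsub>ground\<^esub> y = x * y"
  "\<zero>\<^bsub>ground\<^esub> = 0" "\<one>\<^bsub>ground\<^esub> = 1" "c \<odot>\<^bsub>ground\<^esub> x = c * x"
  by (simp_all add: ground_def)

lemma cring_ground: "cring (ground :: ('k::field, 'k) module)"
proof (rule cringI)
  show "abelian_group (ground :: ('k::field, 'k) module)"
  proof (rule abelian_groupI)
    show "\<exists>y\<in>carrier ground. y \<oplus>\<^bsub>ground\<^esub> x = \<zero>\<^bsub>ground\<^esub>" for x :: 'k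
      by (intro bexI[of _ "- x"]) simp_all
  qed (auto simp: algebra_simps)
  show "Group.comm_monoid (ground :: ('k::field, 'k) module)"
    by (rule comm_monoidI) (auto simp: algebra_simps)
qed (auto simp: algebra_simps)

text \<open>
  A vector space. The locale restates the module axioms without the carrier of the scalar field,
  which is the whole type.
\<close>

locale vspace = module ground V for V :: "('k::field, 'v) module" (structure)

lemma vspaceI:
  fixes V (structure)
  assumes "abelian_group V"
    and "\<And>c x. x \<in> carrier V \<Longrightarrow> c \<odot> x \<in> carrier V"
    and "\<And>a b x. x \<in> carrier V \<Longrightarrow> (a + b) \<odot> x = a \<odot> x \<oplus> b \<odot> x"
    and "\<And>c x y. x \<in> carrier V \<Longrightarrow> y \<in> carrier V \<Longrightarrow> c \<odot> (x \<oplus> y) = c \<odot> x \<oplus> c \<odot> y"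
    and "\<And>a b x. x \<in> carrier V \<Longrightarrow> (a * b) \<odot> x = a \<odot> (b \<odot> x)"
    and "\<And>x. x \<in> carrier V \<Longrightarrow> 1 \<odot> x = x"
  shows "vspace V"
  unfolding vspace_def by (rule moduleI) (use assms cring_ground in auto)

context vspace
begin

lemma scale_closed [simp, intro]: "x \<in> carrier V \<Longrightarrow> c \<odot> x \<in> carrier V"
  using smult_closed[of c x] by simp

lemma scale_add_left: "x \<in> carrier V \<Longrightarrow> (a + b) \<odot> x = a \<odot> x \<oplus> b \<odot> x"
  using smult_l_distr[of a b x] by simp

lemma scale_add_right:
  "x \<in> carrier V \<Longrightarrow> y \<in> carrier V \<Longrightarrow> c \<odot> (x \<oplus> y) = c \<odot> x \<oplus> c \<odot> y"
  using smult_r_distr[of c x y] by simp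

lemma scale_scale: "x \<in> carrier V \<Longrightarrow> a \<odot> (b \<odot> x) = (a * b) \<odot> x"
  using smult_assoc1[of a b x] by simp

lemma scale_one [simp]: "x \<in> carrier V \<Longrightarrow> 1 \<odot> x = x"
  using smult_one[of x] by simp

lemma scale_0 [simp]: "x \<in> carrier V \<Longrightarrow> 0 \<odot> x = \<zero>"
  using smult_l_null[of x] by simp

lemma scale_zero [simp]: "c \<odot> \<zero> = \<zero>"
  using smult_r_null[of c] by simp

lemma scale_minus_one: "x \<in> carrier V \<Longrightarrow> (- 1) \<odot> x = \<ominus> x"
  using scale_add_left[of x "- 1" 1] by (simp add: M.minus_equality)

lemma minus_eq_zero_iff:
  assumes "x \<in> carrier V" "y \<in> carrier V"
  shows "x \<ominus> y = \<zero> \<longleftrightarrow> x = y"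
  using assms M.minus_equality[of x "\<ominus> y"] by (auto simp: a_minus_def M.r_neg)

lemma finsum_scale:
  assumes "f \<in> I \<rightarrow> carrier V"
  shows "c \<odot> (\<Oplus>i\<in>I. f i) = (\<Oplus>i\<in>I. c \<odot> f i)"
  using assms by (induction I rule: infinite_finite_induct)
    (auto simp: scale_add_right Pi_iff intro!: M.finsum_closed)

lemma finsum_swap:
  assumes "finite I" "finite J" "\<And>i j. i \<in> I \<Longrightarrow> j \<in> J \<Longrightarrow> f i j \<in> carrier V"
  shows "(\<Oplus>i\<in>I. \<Oplus>j\<in>J. f i j) = (\<Oplus>j\<in>J. \<Oplus>i\<in>I. f i j)"
  using assms(1,3)
proof (induction I)
  case (insert i I)
  have "(\<Oplus>j\<in>J. \<Oplus>i\<in>insert i I. f i j) = (\<Oplus>j\<in>J. f i j \<oplus> (\<Oplus>i\<in>I. f i j))"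
    using insert by (intro M.finsum_cong') auto
  also have "\<dots> = (\<Oplus>j\<in>J. f i j) \<oplus> (\<Oplus>j\<in>J. \<Oplus>i\<in>I. f i j)"
    using insert by (intro M.finsum_addf) auto
  finally show ?case using insert by (subst M.finsum_insert) auto
qed (use assms in auto)

lemma finsum_delta:
  assumes "finite I" "j \<in> I" "f \<in> I \<rightarrow> carrier V"
  shows "(\<Oplus>i\<in>I. (if i = j then 1 else 0) \<odot> f i) = f j"
proof -
  have "(\<Oplus>i\<in>I. (if i = j then 1 else 0) \<odot> f i) = (\<Oplus>i\<in>I. if j = i then f i else \<zero>)"
    using assms by (intro M.finsum_cong') (auto simp: Pi_iff)
  then show ?thesis using M.finsum_singleton[OF assms(2,1,3)] by simp
qed

end

lemma lin_mapI:
  assumes "\<And>x. x \<in> carrier V \<Longrightarrow> f x \<in> carrier W"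
    and "\<And>x y. x \<in> carrier V \<Longrightarrow> y \<in> carrier V \<Longrightarrow> f (x \<oplus>\<^bsub>V\<^esub> y) = f x \<oplus>\<^bsub>W\<^esub> f y"
    and "\<And>c x. x \<in> carrier V \<Longrightarrow> f (c \<odot>\<^bsub>V\<^esub> x) = c \<odot>\<^bsub>W\<^esub> f x"
  shows "lin_map V W f"
  using assms by (auto simp: lin_map_def)

lemma lin_map_closed: "lin_map V W f \<Longrightarrow> x \<in> carrier V \<Longrightarrow> f x \<in> carrier W"
  and lin_map_add: "lin_map V W f \<Longrightarrow> x \<in> carrier V \<Longrightarrow> y \<in> carrier V \<Longrightarrow>
    f (x \<oplus>\<^bsub>V\<^esub> y) = f x \<oplus>\<^bsub>W\<^esub> f y"
  and lin_map_scale: "lin_map V W f \<Longrightarrow> x \<in> carrier V \<Longrightarrow> f (c \<odot>\<^bsub>V\<^esub> x) = c \<odot>\<^bsub>W\<^esub> f x"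
  by (auto simp: lin_map_def)

lemma lin_map_zero:
  assumes "vspace V" "vspace W" "lin_map V W f"
  shows "f \<zero>\<^bsub>V\<^esub> = \<zero>\<^bsub>W\<^esub>"
proof -
  interpret V: vspace V by fact
  interpret W: vspace W by fact
  have "f (0 \<odot>\<^bsub>V\<^esub> \<zero>\<^bsub>V\<^esub>) = 0 \<odot>\<^bsub>W\<^esub> f \<zero>\<^bsub>V\<^esub>"
    by (rule lin_map_scale[OF assms(3)]) simp
  then show ?thesis using lin_map_closed[OF assms(3), of "\<zero>\<^bsub>V\<^esub>"] by simp
qed

lemma lin_map_minus:
  assumes "vspace V" "vspace W" "lin_map V W f" "x \<in> carrier V" "y \<in> carrier V"
  shows "f (x \<ominus>\<^bsub>V\<^esub> y) = f x \<ominus>\<^bsub>W\<^esub> f y"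
proof -
  interpret V: vspace V by fact
  interpret W: vspace W by fact
  have "f (x \<oplus>\<^bsub>V\<^esub> (- 1) \<odot>\<^bsub>V\<^esub> y) = f x \<oplus>\<^bsub>W\<^esub> (- 1) \<odot>\<^bsub>W\<^esub> f y"
    using assms by (simp add: lin_map_add lin_map_scale)
  then show ?thesis
    using assms by (simp add: V.scale_minus_one W.scale_minus_one lin_map_closed a_minus_def)
qed

lemma lin_map_finsum:
  assumes "vspace V" "vspace W" "lin_map V W f" "g \<in> I \<rightarrow> carrier V"
  shows "f (\<Oplus>\<^bsub>V\<^esub>i\<in>I. g i) = (\<Oplus>\<^bsub>W\<^esub>i\<in>I. f (g i))"
proof -
  interpret V: vspace V by fact
  interpret W: vspace W by fact
  show ?thesis using assms(4)
  proof (induction I rule: infinite_finite_induct)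
    case (insert i I)
    have "f (g i \<oplus>\<^bsub>V\<^esub> (\<Oplus>\<^bsub>V\<^esub>i\<in>I. g i)) = f (g i) \<oplus>\<^bsub>W\<^esub> f (\<Oplus>\<^bsub>V\<^esub>i\<in>I. g i)"
      using insert.prems by (intro lin_map_add[OF assms(3)] V.M.finsum_closed) auto
    with insert show ?case
      by (simp add: Pi_iff lin_map_closed[OF assms(3)])
  qed (use lin_map_zero[OF assms(1-3)] in auto)
qed

lemma lin_map_id: "lin_map V V id" "lin_map V V (\<lambda>x. x)"
  by (auto simp: lin_map_def)

lemma lin_map_comp:
  assumes "lin_map U V f" "lin_map V W g"
  shows "lin_map U W (\<lambda>x. g (f x))"
  using assms by (auto simp: lin_map_def Pi_iff)

lemma lin_map_cong:
  assumes "vspace V" "\<And>x. x \<in> carrier V \<Longrightarrow> f x = g x" "lin_map V W f"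
  shows "lin_map V W g"
proof -
  interpret V: vspace V by fact
  show ?thesis using assms(3) by (auto simp: lin_map_def assms(2)[symmetric] Pi_iff)
qed

text \<open>Bilinear maps \<open>V \<times> W \<rightarrow> U\<close>; only the values on the carriers matter.\<close>

definition bilin ::
  "('k::field, 'v) module \<Rightarrow> ('k, 'w) module \<Rightarrow> ('k, 'u) module \<Rightarrow> ('v \<Rightarrow> 'w \<Rightarrow> 'u) \<Rightarrow> bool" where
  "bilin V W U \<beta> \<longleftrightarrow> (\<forall>w\<in>carrier W. lin_map V U (\<lambda>v. \<beta> v w)) \<and> (\<forall>v\<in>carrier V. lin_map W U (\<beta> v))"

lemma bilinI:
  assumes "\<And>w. w \<in> carrier W \<Longrightarrow> lin_map V U (\<lambda>v. \<beta> v w)"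
    and "\<And>v. v \<in> carrier V \<Longrightarrow> lin_map W U (\<lambda>w. \<beta> v w)"
  shows "bilin V W U \<beta>"
  using assms by (auto simp: bilin_def)

lemma bilin_left: "bilin V W U \<beta> \<Longrightarrow> w \<in> carrier W \<Longrightarrow> lin_map V U (\<lambda>v. \<beta> v w)"
  and bilin_right: "bilin V W U \<beta> \<Longrightarrow> v \<in> carrier V \<Longrightarrow> lin_map W U (\<lambda>w. \<beta> v w)"
  by (auto simp: bilin_def)

lemma bilin_closed:
  "bilin V W U \<beta> \<Longrightarrow> v \<in> carrier V \<Longrightarrow> w \<in> carrier W \<Longrightarrow> \<beta> v w \<in> carrier U"
  by (rule lin_map_closed[OF bilin_right])

lemma bilin_comp:
  assumes "bilin V W U \<beta>" "lin_map V' V f" "lin_map W' W g"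
  shows "bilin V' W' U (\<lambda>x y. \<beta> (f x) (g y))"
  using assms
  by (intro bilinI lin_map_comp[OF assms(2) bilin_left[OF assms(1)]]
      lin_map_comp[OF assms(3) bilin_right[OF assms(1)]]) (auto intro: lin_map_closed)

lemma bilin_lin_comp:
  assumes "bilin V W U \<beta>" "lin_map U U' f"
  shows "bilin V W U' (\<lambda>x y. f (\<beta> x y))"
  using assms by (intro bilinI lin_map_comp[OF _ assms(2)]) (auto intro: bilin_left bilin_right)

lemma bilin_flip: "bilin V W U \<beta> \<Longrightarrow> bilin W V U (\<lambda>w v. \<beta> v w)"
  by (simp add: bilin_def)

lemma bilin_scale: assumes "vspace V" shows "bilin ground V V (\<lambda>c v. c \<odot>\<^bsub>V\<^esub> v)"
proof -
  interpret V: vspace V by fact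
  show ?thesis
    by (intro bilinI lin_mapI)
      (auto simp: V.scale_add_left V.scale_add_right V.scale_scale mult.commute)
qed


section \<open>Spanning sets\<close>

text \<open>A set \<open>G\<close> spans \<open>V\<close>, expressed as the induction principle that it yields.\<close>

definition spanning :: "('k::field, 'v) module \<Rightarrow> 'v set \<Rightarrow> bool" where
  "spanning V G \<longleftrightarrow> G \<subseteq> carrier V \<and>
     (\<forall>P. P \<zero>\<^bsub>V\<^esub> \<longrightarrow>
        (\<forall>x\<in>carrier V. \<forall>y\<in>carrier V. P x \<longrightarrow> P y \<longrightarrow> P (x \<oplus>\<^bsub>V\<^esub> y)) \<longrightarrow>
        (\<forall>c. \<forall>x\<in>carrier V. P x \<longrightarrow> P (c \<odot>\<^bsub>V\<^esub> x)) \<longrightarrow>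
        (\<forall>x\<in>G. P x) \<longrightarrow> (\<forall>x\<in>carrier V. P x))"

lemma spanning_subset: "spanning V G \<Longrightarrow> G \<subseteq> carrier V"
  by (simp add: spanning_def)

lemma spanning_carrier: "spanning V (carrier V)"
  by (auto simp: spanning_def)

lemma spanning_induct [consumes 2, case_names zero add scale base]:
  assumes "spanning V G" "x \<in> carrier V" "P \<zero>\<^bsub>V\<^esub>"
    and "\<And>x y. x \<in> carrier V \<Longrightarrow> y \<in> carrier V \<Longrightarrow> P x \<Longrightarrow> P y \<Longrightarrow> P (x \<oplus>\<^bsub>V\<^esub> y)"
    and "\<And>c x. x \<in> carrier V \<Longrightarrow> P x \<Longrightarrow> P (c \<odot>\<^bsub>V\<^esub> x)"
    and "\<And>x. x \<in> G \<Longrightarrow> P x"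
  shows "P x"
proof -
  have "\<forall>x\<in>carrier V. P x"
    using assms(1)[unfolded spanning_def, THEN conjunct2, THEN spec[of _ P]] assms(3-6) by simp
  with assms(2) show ?thesis by blast
qed

lemma lin_map_eq_on_spanning:
  assumes "vspace V" "vspace W" "spanning V G" "lin_map V W f" "lin_map V W g"
    and "\<And>x. x \<in> G \<Longrightarrow> f x = g x" and "x \<in> carrier V"
  shows "f x = g x"
  using assms(3,7)
proof (induction rule: spanning_induct)
  case zero
  show ?case by (simp only: lin_map_zero[OF assms(1,2,4)] lin_map_zero[OF assms(1,2,5)])
next
  case (add x y)
  then show ?case by (simp only: lin_map_add[OF assms(4)] lin_map_add[OF assms(5)])
next
  case (scale c x)
  then show ?case by (simp only: lin_map_scale[OF assms(4)] lin_map_scale[OF assms(5)])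
next
  case (base x)
  then show ?case by (rule assms(6))
qed

lemma bilin_eq_on_spanning:
  assumes "vspace V" "vspace W" "vspace U" "spanning V G" "spanning W H"
    and "bilin V W U \<beta>" "bilin V W U \<gamma>"
    and eq: "\<And>v w. v \<in> G \<Longrightarrow> w \<in> H \<Longrightarrow> \<beta> v w = \<gamma> v w"
    and "v \<in> carrier V" "w \<in> carrier W"
  shows "\<beta> v w = \<gamma> v w"
proof -
  have "\<beta> g w = \<gamma> g w" if "g \<in> G" for g
  proof -
    have "g \<in> carrier V" using that spanning_subset[OF assms(4)] by blast
    then show ?thesis
      using lin_map_eq_on_spanning[OF assms(2,3,5) bilin_right[OF assms(6)] bilin_right[OF assms(7)]
          eq[OF that] assms(10)] by blast
  qed
  then show ?thesis
    using lin_map_eq_on_spanning[OF assms(1,3,4) bilin_left[OF assms(6,10)] bilin_left[OF assms(7,10)]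
        _ assms(9)] by blast
qed

lemma spanning_image:
  assumes "vspace V" "vspace W" "lin_map V W f" "f ` carrier V = carrier W" "spanning V G"
  shows "spanning W (f ` G)"
  unfolding spanning_def
proof (intro conjI allI impI ballI)
  show "f ` G \<subseteq> carrier W" using assms(4) spanning_subset[OF assms(5)] by blast
next
  fix P y
  assume P: "P \<zero>\<^bsub>W\<^esub>" "\<forall>x\<in>carrier W. \<forall>y\<in>carrier W. P x \<longrightarrow> P y \<longrightarrow> P (x \<oplus>\<^bsub>W\<^esub> y)"
    "\<forall>c. \<forall>x\<in>carrier W. P x \<longrightarrow> P (c \<odot>\<^bsub>W\<^esub> x)" "\<forall>x\<in>f ` G. P x" and "y \<in> carrier W"
  then obtain x where x: "x \<in> carrier V" "y = f x" using assms(4) by blast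
  from assms(5) x(1) have "P (f x)"
    by (induction rule: spanning_induct)
      (use P lin_map_zero[OF assms(1-3)] assms(3)
        in \<open>auto simp: lin_map_add lin_map_scale lin_map_closed\<close>)
  then show "P y" using x by simp
qed

text \<open>Structure is transported along a surjection that respects the operations.\<close>

lemma vspace_image:
  fixes V (structure)
  assumes "vspace V" "f ` carrier V = carrier W"
    and add: "\<And>x y. x \<in> carrier V \<Longrightarrow> y \<in> carrier V \<Longrightarrow> f x \<oplus>\<^bsub>W\<^esub> f y = f (x \<oplus> y)"
    and zero: "\<zero>\<^bsub>W\<^esub> = f \<zero>"
    and scale: "\<And>c x. x \<in> carrier V \<Longrightarrow> c \<odot>\<^bsub>W\<^esub> f x = f (c \<odot> x)"
  shows "vspace W"
proof -
  interpret vspace V by fact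
  have ex: "\<exists>x\<in>carrier V. y = f x" if "y \<in> carrier W" for y using that assms(2) by blast
  have cl: "f x \<in> carrier W" if "x \<in> carrier V" for x using that assms(2) by blast
  show ?thesis
  proof (rule vspaceI)
    show "abelian_group W"
    proof (rule abelian_groupI)
      show "\<exists>y\<in>carrier W. y \<oplus>\<^bsub>W\<^esub> x = \<zero>\<^bsub>W\<^esub>" if x: "x \<in> carrier W" for x
      proof -
        obtain v where "v \<in> carrier V" "x = f v" using ex[OF x] by blast
        then have "f (\<ominus> v) \<in> carrier W" "f (\<ominus> v) \<oplus>\<^bsub>W\<^esub> x = \<zero>\<^bsub>W\<^esub>"
          by (auto simp: cl add zero M.l_neg)
        then show ?thesis by blast
      qed
    qed (auto simp: assms(2)[symmetric] add zero M.a_ac)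
  qed (auto simp: assms(2)[symmetric] add scale scale_add_left scale_add_right scale_scale)
qed


section \<open>Algebras and their homomorphisms\<close>

text \<open>Commutative algebras.\<close>

locale comm_alg = assoc_algebra A for A :: "('k::field, 'a) module" (structure) +
  assumes comm: "x \<in> carrier A \<Longrightarrow> y \<in> carrier A \<Longrightarrow> x \<otimes> y = y \<otimes> x"

sublocale assoc_algebra \<subseteq> vspace A ..

sublocale comm_alg \<subseteq> cring A
  by unfold_locales (rule comm)

lemma (in assoc_algebra) bilin_mult: "bilin A A A (\<otimes>)"
  by (intro bilinI lin_mapI) (auto simp: smult_mult_left smult_mult_right l_distr r_distr)

lemma bilin_iff:
  "bilin V W U \<beta> \<longleftrightarrow>
     (\<forall>v\<in>carrier V. \<forall>w\<in>carrier W. \<beta> v w \<in> carrier U) \<and>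
     (\<forall>v\<in>carrier V. \<forall>v'\<in>carrier V. \<forall>w\<in>carrier W. \<beta> (v \<oplus>\<^bsub>V\<^esub> v') w = \<beta> v w \<oplus>\<^bsub>U\<^esub> \<beta> v' w) \<and>
     (\<forall>v\<in>carrier V. \<forall>w\<in>carrier W. \<forall>w'\<in>carrier W. \<beta> v (w \<oplus>\<^bsub>W\<^esub> w') = \<beta> v w \<oplus>\<^bsub>U\<^esub> \<beta> v w') \<and>
     (\<forall>c. \<forall>v\<in>carrier V. \<forall>w\<in>carrier W. \<beta> (c \<odot>\<^bsub>V\<^esub> v) w = c \<odot>\<^bsub>U\<^esub> \<beta> v w) \<and>
     (\<forall>c. \<forall>v\<in>carrier V. \<forall>w\<in>carrier W. \<beta> v (c \<odot>\<^bsub>W\<^esub> w) = c \<odot>\<^bsub>U\<^esub> \<beta> v w)"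
  unfolding bilin_def lin_map_def Pi_iff by blast

text \<open>
  For a bilinear multiplication, the axioms of a commutative algebra need only be checked on a
  spanning set.
\<close>

lemma comm_algI:
  fixes A (structure)
  assumes "vspace A" and mult: "bilin A A A (\<otimes>)" and "\<one> \<in> carrier A" and G: "spanning A G"
    and assoc: "\<And>x y z. x \<in> G \<Longrightarrow> y \<in> G \<Longrightarrow> z \<in> G \<Longrightarrow> (x \<otimes> y) \<otimes> z = x \<otimes> (y \<otimes> z)"
    and comm: "\<And>x y. x \<in> G \<Longrightarrow> y \<in> G \<Longrightarrow> x \<otimes> y = y \<otimes> x"
    and one: "\<And>x. x \<in> G \<Longrightarrow> \<one> \<otimes> x = x"
  shows "comm_alg A"
proof -
  interpret vspace A by fact
  note lin = bilin_left[OF mult] bilin_right[OF mult] and closed = bilin_closed[OF mult]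
  have GA: "x \<in> carrier A" if "x \<in> G" for x using that spanning_subset[OF G] by blast
  have comm: "x \<otimes> y = y \<otimes> x" if "x \<in> carrier A" "y \<in> carrier A" for x y
    by (rule bilin_eq_on_spanning[OF assms(1,1,1) G G mult bilin_flip[OF mult] comm that])
  have one: "\<one> \<otimes> x = x" if "x \<in> carrier A" for x
    by (rule lin_map_eq_on_spanning[OF assms(1,1) G _ lin_map_id(2) one that])
      (use \<open>\<one> \<in> carrier A\<close> in \<open>auto intro!: lin\<close>)
  have assoc_G: "(x \<otimes> y) \<otimes> z = x \<otimes> (y \<otimes> z)" if "x \<in> G" "y \<in> carrier A" "z \<in> carrier A" for x y z
  proof (rule bilin_eq_on_spanning[OF assms(1,1,1) G G _ _ assoc[OF that(1)] that(2,3)])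
    show "bilin A A A (\<lambda>y z. (x \<otimes> y) \<otimes> z)"
      using bilin_comp[OF mult lin(2) lin_map_id(2)] GA[OF that(1)] by simp
    show "bilin A A A (\<lambda>y z. x \<otimes> (y \<otimes> z))"
      using bilin_lin_comp[OF mult lin(2)] GA[OF that(1)] by simp
  qed
  have assoc: "(x \<otimes> y) \<otimes> z = x \<otimes> (y \<otimes> z)"
    if "x \<in> carrier A" "y \<in> carrier A" "z \<in> carrier A" for x y z
    by (rule lin_map_eq_on_spanning[OF assms(1,1) G _ _ _ that(1),
          of "\<lambda>x. (x \<otimes> y) \<otimes> z" "\<lambda>x. x \<otimes> (y \<otimes> z)"])
      (use that assoc_G in \<open>auto intro!: lin closed lin_map_comp[OF lin(1) lin(1)]\<close>)
  have "cring A"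
    by (rule cringI[OF M.abelian_group_axioms comm_monoidI])
      (use comm one assoc closed lin_map_add[OF lin(1)] \<open>\<one> \<in> carrier A\<close> in auto)
  then interpret cring A .
  show ?thesis
    by unfold_locales
      (use comm lin_map_scale[OF lin(1)] lin_map_scale[OF lin(2)] in auto)
qed

lemma algebra_homI:
  assumes "lin_map A B f"
    and "\<And>x y. x \<in> carrier A \<Longrightarrow> y \<in> carrier A \<Longrightarrow> f (x \<otimes>\<^bsub>A\<^esub> y) = f x \<otimes>\<^bsub>B\<^esub> f y"
    and "f \<one>\<^bsub>A\<^esub> = \<one>\<^bsub>B\<^esub>"
  shows "algebra_hom A B f"
  using assms by (auto simp: algebra_hom_def ring_hom_def lin_map_def)

lemma algebra_hom_lin: "algebra_hom A B f \<Longrightarrow> lin_map A B f"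
  and algebra_hom_mult: "algebra_hom A B f \<Longrightarrow> x \<in> carrier A \<Longrightarrow> y \<in> carrier A \<Longrightarrow>
    f (x \<otimes>\<^bsub>A\<^esub> y) = f x \<otimes>\<^bsub>B\<^esub> f y"
  and algebra_hom_one: "algebra_hom A B f \<Longrightarrow> f \<one>\<^bsub>A\<^esub> = \<one>\<^bsub>B\<^esub>"
  by (auto simp: algebra_hom_def ring_hom_def)

lemma algebra_hom_id: "algebra_hom A A id" "algebra_hom A A (\<lambda>x. x)"
  by (auto intro!: algebra_homI lin_map_id)

lemma algebra_hom_comp:
  assumes "algebra_hom A B f" "algebra_hom B C g"
  shows "algebra_hom A C (\<lambda>x. g (f x))"
proof (rule algebra_homI)
  note f = algebra_hom_lin[OF assms(1)] and g = algebra_hom_lin[OF assms(2)]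
  show "lin_map A C (\<lambda>x. g (f x))" by (rule lin_map_comp[OF f g])
  show "g (f (x \<otimes>\<^bsub>A\<^esub> y)) = g (f x) \<otimes>\<^bsub>C\<^esub> g (f y)" if "x \<in> carrier A" "y \<in> carrier A" for x y
    using that by (simp add: algebra_hom_mult[OF assms(1)] algebra_hom_mult[OF assms(2)]
        lin_map_closed[OF f])
  show "g (f \<one>\<^bsub>A\<^esub>) = \<one>\<^bsub>C\<^esub>"
    by (simp add: algebra_hom_one[OF assms(1)] algebra_hom_one[OF assms(2)])
qed

lemma algebra_hom_cong:
  assumes "assoc_algebra A" "\<And>x. x \<in> carrier A \<Longrightarrow> f x = g x" "algebra_hom A B f"
  shows "algebra_hom A B g"
proof -
  interpret assoc_algebra A by fact
  show ?thesis
    using lin_map_cong[OF vspace_axioms assms(2) algebra_hom_lin[OF assms(3)]] assms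
    by (auto simp: algebra_hom_def ring_hom_def Pi_iff assms(2)[symmetric])
qed

text \<open>A linear map that is multiplicative on a spanning set is multiplicative.\<close>

lemma algebra_hom_on_spanning:
  assumes "assoc_algebra A" "assoc_algebra B" "spanning A G" "lin_map A B f"
    and "\<And>x y. x \<in> G \<Longrightarrow> y \<in> G \<Longrightarrow> f (x \<otimes>\<^bsub>A\<^esub> y) = f x \<otimes>\<^bsub>B\<^esub> f y"
    and "f \<one>\<^bsub>A\<^esub> = \<one>\<^bsub>B\<^esub>"
  shows "algebra_hom A B f"
proof -
  interpret A: assoc_algebra A by fact
  interpret B: assoc_algebra B by fact
  have "f (x \<otimes>\<^bsub>A\<^esub> y) = f x \<otimes>\<^bsub>B\<^esub> f y" if "x \<in> carrier A" "y \<in> carrier A" for x y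
    by (rule bilin_eq_on_spanning[OF A.vspace_axioms A.vspace_axioms B.vspace_axioms assms(3,3)
          bilin_lin_comp[OF A.bilin_mult assms(4)] bilin_comp[OF B.bilin_mult assms(4,4)]
          assms(5) that])
  with assms show ?thesis by (intro algebra_homI)
qed

lemma vspace_ground: "vspace (ground :: ('k::field, 'k) module)"
  by (rule vspaceI)
    (simp_all add: algebra_simps abelian_group.intro ring.is_abelian_group[OF cring.axioms(1)[OF cring_ground]])

lemma comm_alg_ground: "comm_alg (ground :: ('k::field, 'k) module)"
  by (rule comm_algI[OF vspace_ground _ _ spanning_carrier]) (simp_all add: bilin_iff algebra_simps)


section \<open>Quotients\<close>

text \<open>
  A linear subspace \<open>N\<close> of \<open>M\<close>. Nothing is assumed about the multiplication of \<open>M\<close>.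
\<close>

locale linear_subspace = vspace M for M :: "('k::field, 'm) module" (structure) +
  fixes N :: "'m set"
  assumes subset: "N \<subseteq> carrier M"
    and zero_mem: "\<zero> \<in> N"
    and add_mem: "x \<in> N \<Longrightarrow> y \<in> N \<Longrightarrow> x \<oplus> y \<in> N"
    and scale_mem: "x \<in> N \<Longrightarrow> c \<odot> x \<in> N"
begin

abbreviation Q where "Q \<equiv> quot_algebra M N"

lemma carr: "x \<in> N \<Longrightarrow> x \<in> carrier M"
  using subset by blast

lemma minus_mem: "x \<in> N \<Longrightarrow> \<ominus> x \<in> N"
  using scale_mem[of x "- 1"] carr[of x] by (simp add: scale_minus_one)

lemma mem_coset_iff:
  assumes "x \<in> carrier M"
  shows "y \<in> N +> x \<longleftrightarrow> y \<in> carrier M \<and> y \<ominus> x \<in> N"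
proof
  assume "y \<in> N +> x"
  then obtain h where h: "h \<in> N" "y = h \<oplus> x" by (auto simp: a_r_coset_def')
  moreover have "y \<ominus> x = h" using h assms carr[of h] by (simp add: a_minus_def M.a_assoc M.r_neg)
  ultimately show "y \<in> carrier M \<and> y \<ominus> x \<in> N" using assms carr[of h] by auto
next
  assume y: "y \<in> carrier M \<and> y \<ominus> x \<in> N"
  then have "y = (y \<ominus> x) \<oplus> x" using assms by (simp add: a_minus_def M.a_assoc M.l_neg)
  with y show "y \<in> N +> x" by (auto simp: a_r_coset_def')
qed

lemma coset_self: "x \<in> carrier M \<Longrightarrow> x \<in> N +> x"
  by (simp add: mem_coset_iff a_minus_def M.r_neg zero_mem)

lemma coset_eq_iff:
  assumes "x \<in> carrier M" "y \<in> carrier M"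
  shows "N +> x = N +> y \<longleftrightarrow> x \<ominus> y \<in> N"
proof
  assume "N +> x = N +> y"
  then show "x \<ominus> y \<in> N" using coset_self[OF assms(1)] mem_coset_iff[OF assms(2)] by simp
next
  assume xy: "x \<ominus> y \<in> N"
  then have yx: "y \<ominus> x \<in> N"
    using minus_mem[OF xy] assms by (simp add: a_minus_def M.minus_add M.a_comm)
  have "z \<ominus> x \<in> N \<longleftrightarrow> z \<ominus> y \<in> N" if z: "z \<in> carrier M" for z
  proof -
    have "z \<ominus> x = (z \<ominus> y) \<oplus> (y \<ominus> x)" "z \<ominus> y = (z \<ominus> x) \<oplus> (x \<ominus> y)"
      using z assms by (simp_all add: a_minus_def M.a_assoc M.l_neg M.r_neg1 M.r_neg2)
    then show ?thesis using add_mem xy yx by metis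
  qed
  then show "N +> x = N +> y" by (auto simp: mem_coset_iff assms)
qed

lemma carrier_quot: "carrier Q = (\<lambda>x. N +> x) ` carrier M"
  by (auto simp: quot_algebra_def ring.defs module.defs FactRing_def A_RCOSETS_def')

lemma add_quot:
  assumes "x \<in> carrier M" "y \<in> carrier M"
  shows "(N +> x) \<oplus>\<^bsub>Q\<^esub> (N +> y) = N +> (x \<oplus> y)"
proof -
  have "set_add M (N +> x) (N +> y) = N +> (x \<oplus> y)"
  proof (intro equalityI subsetI)
    fix z assume "z \<in> set_add M (N +> x) (N +> y)"
    then obtain h k where "h \<in> N" "k \<in> N" "z = (h \<oplus> x) \<oplus> (k \<oplus> y)"
      by (auto simp: set_add_def' a_r_coset_def')
    then have "z = (h \<oplus> k) \<oplus> (x \<oplus> y)" "h \<oplus> k \<in> N"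
      using assms carr by (auto simp: M.a_ac add_mem)
    then show "z \<in> N +> (x \<oplus> y)" by (auto simp: a_r_coset_def')
  next
    fix z assume "z \<in> N +> (x \<oplus> y)"
    then obtain h where h: "h \<in> N" "z = h \<oplus> (x \<oplus> y)" by (auto simp: a_r_coset_def')
    then have "z = (h \<oplus> x) \<oplus> (\<zero> \<oplus> y)" using assms carr by (simp add: M.a_assoc)
    with h(1) zero_mem show "z \<in> set_add M (N +> x) (N +> y)"
      by (auto simp: set_add_def' a_r_coset_def')
  qed
  then show ?thesis by (simp add: quot_algebra_def ring.defs module.defs FactRing_def)
qed

lemma zero_quot: "\<zero>\<^bsub>Q\<^esub> = N +> \<zero>"
  using subset by (auto simp: quot_algebra_def ring.defs module.defs FactRing_def a_r_coset_def'
      subset_iff)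

lemma one_quot: "\<one>\<^bsub>Q\<^esub> = N +> \<one>"
  by (simp add: quot_algebra_def ring.defs module.defs FactRing_def)

lemma scale_quot:
  assumes "x \<in> carrier M"
  shows "c \<odot>\<^bsub>Q\<^esub> (N +> x) = N +> (c \<odot> x)"
proof -
  have "N +> (c \<odot> y) = N +> (c \<odot> x)" if y: "y \<in> N +> x" for y
  proof -
    have y: "y \<in> carrier M" "y \<ominus> x \<in> N" using y assms by (simp_all add: mem_coset_iff)
    have "lin_map M M (\<lambda>x. c \<odot> x)" by (rule bilin_right[OF bilin_scale[OF vspace_axioms]]) simp
    then have "c \<odot> (y \<ominus> x) = c \<odot> y \<ominus> c \<odot> x"
      by (rule lin_map_minus[OF vspace_axioms vspace_axioms _ y(1) assms])
    then show ?thesis using y assms scale_mem[OF y(2), of c] by (simp add: coset_eq_iff)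
  qed
  then have "(\<Union>y\<in>N +> x. N +> (c \<odot> y)) = N +> (c \<odot> x)"
    using coset_self[OF assms] by (intro SUP_eq_const) blast+
  then show ?thesis by (simp add: quot_algebra_def ring.defs module.defs)
qed

lemma vspace_quot: "vspace Q"
  by (rule vspace_image[OF vspace_axioms carrier_quot[symmetric]])
    (simp_all add: add_quot zero_quot scale_quot)

lemma lin_map_coset: "lin_map M Q (\<lambda>x. N +> x)"
  by (rule lin_mapI) (auto simp: carrier_quot add_quot scale_quot)

text \<open>
  A linear map \<open>F\<close> that vanishes on \<open>N\<close> factors through the quotient. The induced map is given by
  the values of \<open>F\<close> on chosen representatives.
\<close>

lemma lin_map_quot_ext:
  assumes "vspace U" "lin_map M U F" and ker: "\<And>x. x \<in> N \<Longrightarrow> F x = \<zero>\<^bsub>U\<^esub>"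
  shows "x \<in> carrier M \<Longrightarrow> F (SOME y. y \<in> N +> x) = F x"
    and "lin_map Q U (\<lambda>X. F (SOME y. y \<in> X))"
proof -
  interpret U: vspace U by fact
  show *: "F (SOME y. y \<in> N +> x) = F x" if x: "x \<in> carrier M" for x
  proof -
    define y where "y = (SOME y. y \<in> N +> x)"
    have "y \<in> N +> x" unfolding y_def using coset_self[OF x] by (rule someI)
    then have y: "y \<in> carrier M" "y \<ominus> x \<in> N" using x by (auto simp: mem_coset_iff)
    then have "F y \<ominus>\<^bsub>U\<^esub> F x = \<zero>\<^bsub>U\<^esub>"
      using lin_map_minus[OF vspace_axioms assms(1,2) y(1) x] ker by simp
    then have "F y = F x"
      using U.minus_eq_zero_iff lin_map_closed[OF assms(2)] y(1) x by blast
    then show ?thesis by (simp add: y_def)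
  qed
  show "lin_map Q U (\<lambda>X. F (SOME y. y \<in> X))"
    by (rule lin_mapI)
      (auto simp: carrier_quot add_quot scale_quot * lin_map_closed[OF assms(2)]
        lin_map_add[OF assms(2)] lin_map_scale[OF assms(2)])
qed

end

text \<open>An ideal of a commutative algebra.\<close>

locale algebra_ideal = comm_alg A + linear_subspace A N
  for A :: "('k::field, 'a) module" (structure) and N +
  assumes mult_mem: "x \<in> N \<Longrightarrow> y \<in> carrier A \<Longrightarrow> x \<otimes> y \<in> N"
begin

lemma mult_quot:
  assumes "x \<in> carrier A" "y \<in> carrier A"
  shows "(N +> x) \<otimes>\<^bsub>Q\<^esub> (N +> y) = N +> (x \<otimes> y)"
proof -
  have "N +> (a \<otimes> b) = N +> (x \<otimes> y)" if a: "a \<in> N +> x" and b: "b \<in> N +> y" for a b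
  proof -
    have ab: "a \<in> carrier A" "a \<ominus> x \<in> N" "b \<in> carrier A" "b \<ominus> y \<in> N"
      using a b assms by (auto simp: mem_coset_iff)
    have "a \<otimes> b \<ominus> x \<otimes> y = (a \<ominus> x) \<otimes> b \<oplus> (b \<ominus> y) \<otimes> x"
      using ab(1,3) assms by algebra
    also have "\<dots> \<in> N" using ab assms by (intro add_mem mult_mem)
    finally show ?thesis using ab assms by (simp add: coset_eq_iff)
  qed
  then have "(\<Union>a\<in>N +> x. \<Union>b\<in>N +> y. N +> (a \<otimes> b)) = N +> (x \<otimes> y)"
    using coset_self[OF assms(1)] coset_self[OF assms(2)] by (intro SUP_eq_const) blast+
  then show ?thesis
    by (simp add: quot_algebra_def ring.defs module.defs FactRing_def rcoset_mult_def)
qed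

lemma comm_alg_quot: "comm_alg Q"
  by (rule comm_algI[OF vspace_quot _ _ spanning_carrier])
    (auto simp: bilin_iff carrier_quot mult_quot add_quot scale_quot one_quot l_distr r_distr
      smult_mult_left smult_mult_right m_ac)

lemma algebra_hom_coset: "algebra_hom A Q (\<lambda>x. N +> x)"
  by (rule algebra_homI) (simp_all add: lin_map_coset mult_quot one_quot)

lemma algebra_hom_quot_ext:
  assumes "assoc_algebra B" "algebra_hom A B F" and ker: "\<And>x. x \<in> N \<Longrightarrow> F x = \<zero>\<^bsub>B\<^esub>"
  shows "algebra_hom Q B (\<lambda>X. F (SOME y. y \<in> X))"
proof -
  interpret B: assoc_algebra B by fact
  note ext = lin_map_quot_ext[OF B.vspace_axioms algebra_hom_lin[OF assms(2)] ker]
  show ?thesis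
    by (rule algebra_homI[OF ext(2)])
      (auto simp: carrier_quot mult_quot one_quot ext(1) algebra_hom_mult[OF assms(2)]
        algebra_hom_one[OF assms(2)])
qed

end


section \<open>Free vector spaces\<close>

text \<open>The space of formal linear combinations of elements of a set \<open>S\<close>.\<close>

locale free_vspace =
  fixes F :: "('k::field, 'z \<Rightarrow>\<^sub>0 'k) module" (structure) and S :: "'z set"
  assumes carrier_F [simp]: "carrier F = {p. Poly_Mapping.keys p \<subseteq> S}"
    and add_F [simp]: "p \<oplus> q = p + q"
    and zero_F [simp]: "\<zero> = 0"
    and scale_F [simp]: "c \<odot> p = Poly_Mapping.map ((*) c) p"

lemma lookup_map_times [simp]:
  "Poly_Mapping.lookup (Poly_Mapping.map ((*) c) p) z = c * Poly_Mapping.lookup p z" for c :: "'k::field"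
  by (simp add: Poly_Mapping.map.rep_eq when_def)

lemma keys_map_times: "Poly_Mapping.keys (Poly_Mapping.map ((*) c) p) \<subseteq> Poly_Mapping.keys p"
    for c :: "'k::field"
  by (auto simp: in_keys_iff)

lemma keys_uminus_eq: "Poly_Mapping.keys (- p) = Poly_Mapping.keys p"
  by (auto simp: in_keys_iff)

text \<open>The linear extension of a map that is given on the basis elements.\<close>

definition lin_ext :: "('k::field, 'u) module \<Rightarrow> ('z \<Rightarrow> 'u) \<Rightarrow> ('z \<Rightarrow>\<^sub>0 'k) \<Rightarrow> 'u" where
  "lin_ext U g p = (\<Oplus>\<^bsub>U\<^esub>z\<in>Poly_Mapping.keys p. Poly_Mapping.lookup p z \<odot>\<^bsub>U\<^esub> g z)"

lemma lin_ext_superset: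
  assumes "vspace U" "finite T" "Poly_Mapping.keys p \<subseteq> T" "g \<in> T \<rightarrow> carrier U"
  shows "lin_ext U g p = (\<Oplus>\<^bsub>U\<^esub>z\<in>T. Poly_Mapping.lookup p z \<odot>\<^bsub>U\<^esub> g z)"
proof -
  interpret U: vspace U by fact
  show ?thesis unfolding lin_ext_def
  proof (rule U.M.add.finprod_mono_neutral_cong_left[OF assms(2,3)])
    show "Poly_Mapping.lookup p z \<odot>\<^bsub>U\<^esub> g z = \<zero>\<^bsub>U\<^esub>" if "z \<in> T - Poly_Mapping.keys p" for z
      using that assms(4) by (auto simp: in_keys_iff Pi_iff)
  qed (use assms in auto)
qed

context free_vspace
begin

sublocale vspace F
proof (rule vspaceI)
  show "abelian_group F"
  proof (rule abelian_groupI)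
    show "\<exists>q\<in>carrier F. q \<oplus> p = \<zero>" if "p \<in> carrier F" for p
      using that by (intro bexI[of _ "- p"]) (auto simp: keys_uminus_eq)
    show "p \<oplus> q \<in> carrier F" if "p \<in> carrier F" "q \<in> carrier F" for p q
      using that Poly_Mapping.keys_add[of p q] by auto
  qed (simp_all add: algebra_simps)
  show "c \<odot> p \<in> carrier F" if "p \<in> carrier F" for c p
    using that keys_map_times[of c p] by auto
qed (auto intro!: poly_mapping_eqI simp: lookup_add algebra_simps)

lemma minus_F: "p \<in> carrier F \<Longrightarrow> q \<in> carrier F \<Longrightarrow> p \<ominus> q = p - q"
  using M.minus_equality[of "- q" q] by (simp add: a_minus_def keys_uminus_eq)

lemma minus_in_F: "p \<in> carrier F \<Longrightarrow> q \<in> carrier F \<Longrightarrow> p - q \<in> carrier F"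
  using M.minus_closed[of p q] minus_F[of p q] by simp

lemma single_in_F: "z \<in> S \<Longrightarrow> Poly_Mapping.single z c \<in> carrier F"
  by simp

lemma spanning_basis: "spanning F ((\<lambda>z. Poly_Mapping.single z 1) ` S)"
  unfolding spanning_def
proof (intro conjI allI impI ballI)
  fix P p
  assume P: "P \<zero>" "\<forall>x\<in>carrier F. \<forall>y\<in>carrier F. P x \<longrightarrow> P y \<longrightarrow> P (x \<oplus> y)"
    "\<forall>c. \<forall>x\<in>carrier F. P x \<longrightarrow> P (c \<odot> x)" "\<forall>x\<in>(\<lambda>z. Poly_Mapping.single z 1) ` S. P x"
    and "p \<in> carrier F"
  have single: "P (Poly_Mapping.single z c)" if "z \<in> S" for z c
  proof -
    have "P (c \<odot> Poly_Mapping.single z 1)"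
      using P(3)[rule_format, OF single_in_F[OF that] P(4)[rule_format, OF imageI[OF that]]] .
    then show ?thesis by (simp add: map_single)
  qed
  have "P p" if "finite T" "Poly_Mapping.keys p \<subseteq> T" "T \<subseteq> S" for p T
    using that
  proof (induction T arbitrary: p)
    case empty
    then have "p = 0" by (intro poly_mapping_eqI) (auto simp: in_keys_iff)
    then show ?case using P(1) by simp
  next
    case (insert z T)
    define q where "q = p - Poly_Mapping.single z (Poly_Mapping.lookup p z)"
    have "Poly_Mapping.keys q \<subseteq> T"
      using insert.prems(1)
      by (auto simp: q_def in_keys_iff lookup_minus lookup_single when_def split: if_splits)
    then have "P q" "q \<in> carrier F" using insert by auto
    moreover have "p = Poly_Mapping.single z (Poly_Mapping.lookup p z) \<oplus> q" by (simp add: q_def)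
    ultimately show ?case using P(2) single[of z] insert.prems single_in_F[of z] by (metis insert_subset)
  qed
  from this[of "Poly_Mapping.keys p" p] show "P p" using \<open>p \<in> carrier F\<close> by simp
qed auto

lemma lin_map_lin_ext:
  assumes "vspace U" "g \<in> S \<rightarrow> carrier U"
  shows "lin_map F U (lin_ext U g)"
proof -
  interpret U: vspace U by fact
  note ext = lin_ext_superset[OF assms(1), where g = g]
  show ?thesis
  proof (rule lin_mapI)
    fix p assume "p \<in> carrier F"
    then show "lin_ext U g p \<in> carrier U"
      using assms(2) by (auto simp: lin_ext_def intro!: U.M.finsum_closed)
  next
    fix p q assume pq: "p \<in> carrier F" "q \<in> carrier F"
    let ?T = "Poly_Mapping.keys p \<union> Poly_Mapping.keys q"
    have g: "g \<in> ?T \<rightarrow> carrier U" using pq assms(2) by auto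
    have "lin_ext U g (p \<oplus> q) = (\<Oplus>\<^bsub>U\<^esub>z\<in>?T. Poly_Mapping.lookup (p + q) z \<odot>\<^bsub>U\<^esub> g z)"
      using ext[of ?T "p + q"] Poly_Mapping.keys_add[of p q] g by simp
    also have "\<dots> = (\<Oplus>\<^bsub>U\<^esub>z\<in>?T. Poly_Mapping.lookup p z \<odot>\<^bsub>U\<^esub> g z \<oplus>\<^bsub>U\<^esub> Poly_Mapping.lookup q z \<odot>\<^bsub>U\<^esub> g z)"
      using g by (intro U.M.finsum_cong') (auto simp: lookup_add U.scale_add_left Pi_iff)
    also have "\<dots> = (\<Oplus>\<^bsub>U\<^esub>z\<in>?T. Poly_Mapping.lookup p z \<odot>\<^bsub>U\<^esub> g z) \<oplus>\<^bsub>U\<^esub>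
        (\<Oplus>\<^bsub>U\<^esub>z\<in>?T. Poly_Mapping.lookup q z \<odot>\<^bsub>U\<^esub> g z)"
      using g by (intro U.M.finsum_addf) auto
    finally show "lin_ext U g (p \<oplus> q) = lin_ext U g p \<oplus>\<^bsub>U\<^esub> lin_ext U g q"
      using ext[of ?T p] ext[of ?T q] g by simp
  next
    fix c p assume p: "p \<in> carrier F"
    let ?T = "Poly_Mapping.keys p"
    have g: "g \<in> ?T \<rightarrow> carrier U" using p assms(2) by auto
    have "lin_ext U g (c \<odot> p) = (\<Oplus>\<^bsub>U\<^esub>z\<in>?T. Poly_Mapping.lookup (c \<odot> p) z \<odot>\<^bsub>U\<^esub> g z)"
      using g keys_map_times[of c p] by (intro ext) auto
    also have "\<dots> = (\<Oplus>\<^bsub>U\<^esub>z\<in>?T. c \<odot>\<^bsub>U\<^esub> (Poly_Mapping.lookup p z \<odot>\<^bsub>U\<^esub> g z))"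
      using g by (intro U.M.finsum_cong') (auto simp: U.scale_scale Pi_iff)
    also have "\<dots> = c \<odot>\<^bsub>U\<^esub> lin_ext U g p"
      unfolding lin_ext_def using g by (intro U.finsum_scale[symmetric]) auto
    finally show "lin_ext U g (c \<odot> p) = c \<odot>\<^bsub>U\<^esub> lin_ext U g p" .
  qed
qed

end

lemma lin_ext_single:
  assumes "vspace U" "g z \<in> carrier U"
  shows "lin_ext U g (Poly_Mapping.single z c) = c \<odot>\<^bsub>U\<^esub> g z"
proof -
  interpret U: vspace U by fact
  have "lin_ext U g (Poly_Mapping.single z c) =
      (\<Oplus>\<^bsub>U\<^esub>z'\<in>{z}. Poly_Mapping.lookup (Poly_Mapping.single z c) z' \<odot>\<^bsub>U\<^esub> g z')"
    using assms by (intro lin_ext_superset) auto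
  then show ?thesis using assms by simp
qed


section \<open>Tensor products\<close>

lemma free_vspace_pairs: "free_vspace (free_pairs V W) (carrier V \<times> carrier W)"
  by unfold_locales (simp_all add: free_pairs_def)

text \<open>
  Two vector spaces and their tensor product, the quotient \<open>R.Q\<close> of the free vector space on
  \<open>V \<times> W\<close> by the bilinearity relations.
\<close>

locale tensor_spaces = V: vspace V + W: vspace W
  for V :: "('k::field, 'v) module" and W :: "('k, 'w) module"
begin

sublocale F: free_vspace "free_pairs V W" "carrier V \<times> carrier W"
  by (rule free_vspace_pairs)

lemma relations_subset: "bilinear_relations V W \<subseteq> carrier (free_pairs V W)"
proof
  note [simp del] = F.carrier_F
  note [intro] = F.minus_in_F F.single_in_F
  fix p assume "p \<in> bilinear_relations V W"
  then show "p \<in> carrier (free_pairs V W)"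
  proof induction
    case zero
    show ?case using F.M.zero_closed by simp
  next
    case (add p q)
    then show ?case using F.M.add.m_closed[of p q] by simp
  next
    case (smult p c)
    then show ?case using F.scale_closed[of p c] by simp
  qed auto
qed

sublocale R: linear_subspace "free_pairs V W" "bilinear_relations V W"
  by unfold_locales
    (use relations_subset bilinear_relations.intros(1-3) in \<open>simp_all del: F.carrier_F\<close>)

lemma tensor_eq: "tensor V W = R.Q"
  by (simp add: tensor_def)

lemma vspace_tensor: "vspace (tensor V W)"
  using R.vspace_quot by (simp add: tensor_eq)

lemma pure_tensor_closed:
  "v \<in> carrier V \<Longrightarrow> w \<in> carrier W \<Longrightarrow> pure_tensor V W v w \<in> carrier (tensor V W)"
  by (auto simp: tensor_eq R.carrier_quot pure_tensor_def simp del: F.carrier_F intro!: imageI F.single_in_F)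

lemma bilin_pure_tensor: "bilin V W (tensor V W) (pure_tensor V W)"
proof -
  let ?N = "bilinear_relations V W"
  let ?c = "\<lambda>p. ?N +>\<^bsub>free_pairs V W\<^esub> p"
  note [simp del] = F.carrier_F F.add_F F.scale_F
  note [intro] = F.single_in_F
  have add: "?c p = ?c q \<oplus>\<^bsub>tensor V W\<^esub> ?c r"
    if "p - q - r \<in> ?N" "p \<in> carrier (free_pairs V W)" "q \<in> carrier (free_pairs V W)"
      "r \<in> carrier (free_pairs V W)" for p q r
  proof -
    have "p \<ominus>\<^bsub>free_pairs V W\<^esub> (q \<oplus>\<^bsub>free_pairs V W\<^esub> r) = p - q - r"
      using F.minus_F[OF that(2) F.M.add.m_closed[OF that(3,4)]]
      by (simp only: F.add_F diff_diff_add)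
    then show ?thesis using that by (simp add: tensor_eq R.add_quot R.coset_eq_iff)
  qed
  have scale: "?c p = a \<odot>\<^bsub>tensor V W\<^esub> ?c (Poly_Mapping.single z 1)"
    if "p - Poly_Mapping.single z a \<in> ?N" "p \<in> carrier (free_pairs V W)"
      "z \<in> carrier V \<times> carrier W" for p z a
  proof -
    have "a \<odot>\<^bsub>free_pairs V W\<^esub> Poly_Mapping.single z 1 = Poly_Mapping.single z a"
      by (simp add: F.scale_F map_single)
    then show ?thesis
      using that F.minus_F[of p "Poly_Mapping.single z a"] F.single_in_F[OF that(3)]
      by (simp add: tensor_eq R.scale_quot R.coset_eq_iff)
  qed
  show ?thesis
  proof (intro bilinI lin_mapI)
    fix v w assume "v \<in> carrier V" "w \<in> carrier W"
    then show "pure_tensor V W v w \<in> carrier (tensor V W)" "pure_tensor V W v w \<in> carrier (tensor V W)"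
      by (auto intro: pure_tensor_closed)
    show "pure_tensor V W (c \<odot>\<^bsub>V\<^esub> v) w = c \<odot>\<^bsub>tensor V W\<^esub> pure_tensor V W v w"
      "pure_tensor V W v (c \<odot>\<^bsub>W\<^esub> w) = c \<odot>\<^bsub>tensor V W\<^esub> pure_tensor V W v w" for c
      unfolding pure_tensor_def using \<open>v \<in> carrier V\<close> \<open>w \<in> carrier W\<close>
      by (intro scale bilinear_relations.smult_left bilinear_relations.smult_right F.single_in_F; simp)+
  next
    fix v v' w assume "v \<in> carrier V" "v' \<in> carrier V" "w \<in> carrier W"
    then show "pure_tensor V W (v \<oplus>\<^bsub>V\<^esub> v') w =
        pure_tensor V W v w \<oplus>\<^bsub>tensor V W\<^esub> pure_tensor V W v' w"
      unfolding pure_tensor_def by (intro add bilinear_relations.add_left F.single_in_F) auto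
  next
    fix v w w' assume "v \<in> carrier V" "w \<in> carrier W" "w' \<in> carrier W"
    then show "pure_tensor V W v (w \<oplus>\<^bsub>W\<^esub> w') =
        pure_tensor V W v w \<oplus>\<^bsub>tensor V W\<^esub> pure_tensor V W v w'"
      unfolding pure_tensor_def by (intro add bilinear_relations.add_right F.single_in_F) auto
  qed
qed

lemma spanning_tensor:
  "spanning (tensor V W) ((\<lambda>z. pure_tensor V W (fst z) (snd z)) ` (carrier V \<times> carrier W))"
  using spanning_image[OF F.vspace_axioms R.vspace_quot R.lin_map_coset R.carrier_quot[symmetric]
      F.spanning_basis]
  by (simp add: tensor_eq image_image pure_tensor_def)

text \<open>
  The universal property: a bilinear map \<open>\<beta>\<close> induces a linear map on the tensor product. Its linear
  extension \<open>ext\<close> to the free vector space on \<open>V \<times> W\<close> vanishes on the bilinearity relations.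
\<close>

context
  fixes U :: "('k, 'u) module" and \<beta> :: "'v \<Rightarrow> 'w \<Rightarrow> 'u"
  assumes U: "vspace U" and \<beta>: "bilin V W U \<beta>"
begin

interpretation U: vspace U by (rule U)

abbreviation (input) ext where "ext \<equiv> lin_ext U (\<lambda>z. \<beta> (fst z) (snd z))"

lemma ext_lin: "lin_map (free_pairs V W) U ext"
  by (rule F.lin_map_lin_ext[OF U]) (auto intro: bilin_closed[OF \<beta>])

lemma ext_single: "v \<in> carrier V \<Longrightarrow> w \<in> carrier W \<Longrightarrow> ext (Poly_Mapping.single (v, w) c) = c \<odot>\<^bsub>U\<^esub> \<beta> v w"
  using lin_ext_single[OF U, where g = "\<lambda>z. \<beta> (fst z) (snd z)" and z = "(v, w)"] bilin_closed[OF \<beta>]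
  by simp

lemma ext_minus:
  "p \<in> carrier (free_pairs V W) \<Longrightarrow> q \<in> carrier (free_pairs V W) \<Longrightarrow> ext (p - q) = ext p \<ominus>\<^bsub>U\<^esub> ext q"
  using lin_map_minus[OF F.vspace_axioms U ext_lin, of p q] F.minus_F[of p q] by simp

lemma ext_relations:
  assumes "p \<in> bilinear_relations V W"
  shows "ext p = \<zero>\<^bsub>U\<^esub>"
  using assms
proof induction
  case zero
  show ?case using lin_map_zero[OF F.vspace_axioms U ext_lin] by simp
next
  case (add p q)
  then show ?case using lin_map_add[OF ext_lin, of p q] relations_subset by (simp add: subset_iff)
next
  case (smult p c)
  then show ?case using lin_map_scale[OF ext_lin, of p c] relations_subset by (simp add: subset_iff)
next
  note [simp del] = F.carrier_F
  note cl = bilin_closed[OF \<beta>]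
  {
    case (add_left v v' w)
    then show ?case
      by (simp add: ext_minus ext_single F.single_in_F F.minus_in_F cl
          lin_map_add[OF bilin_left[OF \<beta>]] a_minus_def U.M.a_ac U.M.r_neg1 U.M.r_neg)
  next
    case (add_right v w w')
    then show ?case
      by (simp add: ext_minus ext_single F.single_in_F F.minus_in_F cl
          lin_map_add[OF bilin_right[OF \<beta>]] a_minus_def U.M.a_ac U.M.r_neg1 U.M.r_neg)
  next
    case (smult_left v w c)
    then show ?case
      by (simp add: ext_minus ext_single F.single_in_F F.minus_in_F cl
          lin_map_scale[OF bilin_left[OF \<beta>]] a_minus_def U.M.r_neg)
  next
    case (smult_right v w c)
    then show ?case
      by (simp add: ext_minus ext_single F.single_in_F F.minus_in_F cl
          lin_map_scale[OF bilin_right[OF \<beta>]] a_minus_def U.M.r_neg)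
  }
qed

lemma lin_map_tensor_lift: "lin_map (tensor V W) U (tensor_lift U \<beta>)"
proof -
  have "tensor_lift U \<beta> = (\<lambda>X. ext (SOME p. p \<in> X))"
    by (simp add: fun_eq_iff tensor_lift_def lin_ext_def Let_def)
  then show ?thesis using R.lin_map_quot_ext(2)[OF U ext_lin ext_relations] by (simp add: tensor_eq)
qed

lemma tensor_lift_pure:
  assumes "v \<in> carrier V" "w \<in> carrier W"
  shows "tensor_lift U \<beta> (pure_tensor V W v w) = \<beta> v w"
proof -
  have "tensor_lift U \<beta> (pure_tensor V W v w) = ext (Poly_Mapping.single (v, w) 1)"
    using R.lin_map_quot_ext(1)[OF U ext_lin ext_relations, of "Poly_Mapping.single (v, w) 1"] assms
    by (simp add: pure_tensor_def tensor_lift_def lin_ext_def Let_def)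
  then show ?thesis using assms by (simp add: ext_single bilin_closed[OF \<beta>])
qed

end

end


section \<open>Tensor products of commutative algebras\<close>

text \<open>
  Two commutative algebras. The free vector space on \<open>V \<times> W\<close> is then a commutative algebra, and
  the bilinearity relations form an ideal in it.
\<close>

locale tensor_algebras = V: comm_alg V + W: comm_alg W
  for V :: "('k::field, 'v) module" and W :: "('k, 'w) module"
begin

sublocale tensor_spaces V W ..

text \<open>The product of two basis elements of the free vector space on \<open>V \<times> W\<close>.\<close>

definition pair_mult :: "'v \<times> 'w \<Rightarrow> 'v \<times> 'w \<Rightarrow> 'v \<times> 'w" where
  "pair_mult z z' = (fst z \<otimes>\<^bsub>V\<^esub> fst z', snd z \<otimes>\<^bsub>W\<^esub> snd z')"

lemma pair_mult_closed:
  "z \<in> carrier V \<times> carrier W \<Longrightarrow> z' \<in> carrier V \<times> carrier W \<Longrightarrow>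
    pair_mult z z' \<in> carrier V \<times> carrier W"
  by (auto simp: pair_mult_def)

text \<open>
  With index sets that do not depend on the factors, bilinearity of the multiplication becomes
  visible.
\<close>

lemma mult_superset:
  assumes "finite S" "finite T" "Poly_Mapping.keys p \<subseteq> S" "Poly_Mapping.keys q \<subseteq> T"
  shows "p \<otimes>\<^bsub>free_pairs V W\<^esub> q = (\<Sum>z\<in>S. \<Sum>z'\<in>T. Poly_Mapping.single (pair_mult z z')
           (Poly_Mapping.lookup p z * Poly_Mapping.lookup q z'))"
proof -
  have "p \<otimes>\<^bsub>free_pairs V W\<^esub> q = (\<Sum>z\<in>Poly_Mapping.keys p. \<Sum>z'\<in>Poly_Mapping.keys q.
      Poly_Mapping.single (pair_mult z z') (Poly_Mapping.lookup p z * Poly_Mapping.lookup q z'))"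
    by (simp add: free_pairs_def pair_mult_def case_prod_beta)
  also have "\<dots> = (\<Sum>z\<in>Poly_Mapping.keys p. \<Sum>z'\<in>T.
      Poly_Mapping.single (pair_mult z z') (Poly_Mapping.lookup p z * Poly_Mapping.lookup q z'))"
    using assms by (intro sum.cong sum.mono_neutral_left) (auto simp: in_keys_iff)
  also have "\<dots> = (\<Sum>z\<in>S. \<Sum>z'\<in>T.
      Poly_Mapping.single (pair_mult z z') (Poly_Mapping.lookup p z * Poly_Mapping.lookup q z'))"
    using assms by (intro sum.mono_neutral_left) (auto simp: in_keys_iff)
  finally show ?thesis .
qed

lemma mult_single:
  "Poly_Mapping.single z a \<otimes>\<^bsub>free_pairs V W\<^esub> Poly_Mapping.single z' b =
     Poly_Mapping.single (pair_mult z z') (a * b)"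
  by (subst mult_superset[of "{z}" "{z'}"]) auto

lemma one_free_pairs: "\<one>\<^bsub>free_pairs V W\<^esub> = Poly_Mapping.single (\<one>\<^bsub>V\<^esub>, \<one>\<^bsub>W\<^esub>) 1"
  by (simp add: free_pairs_def)

lemma sum_in_F:
  assumes "\<And>i. i \<in> I \<Longrightarrow> f i \<in> carrier (free_pairs V W)"
  shows "sum f I \<in> carrier (free_pairs V W)"
  using assms
proof (induction I rule: infinite_finite_induct)
  case (insert i I)
  then show ?case using F.M.add.m_closed[of "f i" "sum f I"] by simp
qed auto

lemma bilin_mult_free_pairs:
  "bilin (free_pairs V W) (free_pairs V W) (free_pairs V W) (\<otimes>\<^bsub>free_pairs V W\<^esub>)"
proof -
  let ?F = "free_pairs V W"
  have comm: "p \<otimes>\<^bsub>?F\<^esub> q = q \<otimes>\<^bsub>?F\<^esub> p" if "p \<in> carrier ?F" "q \<in> carrier ?F" for p q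
    using that unfolding mult_superset[OF finite_keys finite_keys order_refl order_refl]
    by (subst sum.swap) (auto intro!: sum.cong arg_cong2[where f = Poly_Mapping.single]
        simp: pair_mult_def V.comm W.comm subset_iff)
  have left: "lin_map ?F ?F (\<lambda>p. p \<otimes>\<^bsub>?F\<^esub> q)" if q: "q \<in> carrier ?F" for q
  proof (rule lin_mapI)
    fix p assume "p \<in> carrier ?F"
    then show "p \<otimes>\<^bsub>?F\<^esub> q \<in> carrier ?F"
      using q unfolding mult_superset[OF finite_keys finite_keys order_refl order_refl]
      by (intro sum_in_F F.single_in_F pair_mult_closed) auto
  next
    fix p p' :: "('v \<times> 'w) \<Rightarrow>\<^sub>0 'k"
    let ?S = "Poly_Mapping.keys p \<union> Poly_Mapping.keys p'"
    show "(p \<oplus>\<^bsub>?F\<^esub> p') \<otimes>\<^bsub>?F\<^esub> q = p \<otimes>\<^bsub>?F\<^esub> q \<oplus>\<^bsub>?F\<^esub> p' \<otimes>\<^bsub>?F\<^esub> q"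
      using mult_superset[of ?S "Poly_Mapping.keys q" _ q] Poly_Mapping.keys_add[of p p']
      by (simp add: lookup_add single_add distrib_right sum.distrib)
  next
    fix c and p :: "('v \<times> 'w) \<Rightarrow>\<^sub>0 'k"
    have "Poly_Mapping.map ((*) c) p \<otimes>\<^bsub>?F\<^esub> q = (\<Sum>z\<in>Poly_Mapping.keys p. \<Sum>z'\<in>Poly_Mapping.keys q.
      Poly_Mapping.single (pair_mult z z') (c * Poly_Mapping.lookup p z * Poly_Mapping.lookup q z'))"
      using mult_superset[of "Poly_Mapping.keys p" "Poly_Mapping.keys q" _ q] keys_map_times[of c p]
      by simp
    also have "\<dots> = Poly_Mapping.map ((*) c) (p \<otimes>\<^bsub>?F\<^esub> q)"
      unfolding mult_superset[OF finite_keys finite_keys order_refl order_refl]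
      by (rule poly_mapping_eqI)
        (simp add: lookup_sum lookup_single sum_distrib_left mult_when mult.assoc)
    finally show "(c \<odot>\<^bsub>?F\<^esub> p) \<otimes>\<^bsub>?F\<^esub> q = c \<odot>\<^bsub>?F\<^esub> (p \<otimes>\<^bsub>?F\<^esub> q)" by simp
  qed
  show ?thesis
    using left lin_map_cong[OF F.vspace_axioms comm left] by (intro bilinI) blast+
qed

lemma comm_alg_free_pairs: "comm_alg (free_pairs V W)"
proof (rule comm_algI[OF F.vspace_axioms bilin_mult_free_pairs _ F.spanning_basis])
  show "\<one>\<^bsub>free_pairs V W\<^esub> \<in> carrier (free_pairs V W)"
    unfolding one_free_pairs by (rule F.single_in_F) simp
qed (auto simp: mult_single one_free_pairs pair_mult_def V.m_ac W.m_ac)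

sublocale A: comm_alg "free_pairs V W"
  by (rule comm_alg_free_pairs)

lemma mult_diff:
  assumes "p \<in> carrier (free_pairs V W)" "q \<in> carrier (free_pairs V W)" "r \<in> carrier (free_pairs V W)"
  shows "(p - q) \<otimes>\<^bsub>free_pairs V W\<^esub> r = p \<otimes>\<^bsub>free_pairs V W\<^esub> r - q \<otimes>\<^bsub>free_pairs V W\<^esub> r"
  using lin_map_minus[OF F.vspace_axioms F.vspace_axioms bilin_left[OF A.bilin_mult assms(3)] assms(1,2)]
    F.minus_F[OF assms(1,2)] F.minus_F[OF A.m_closed[OF assms(1,3)] A.m_closed[OF assms(2,3)]]
  by simp

text \<open>
  The product of a generating relation with a pair \<open>(a, b)\<close> is again a generating relation, with
  entries multiplied by \<open>a\<close> and \<open>b\<close>.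
\<close>

lemma relation_mult_single:
  assumes "r \<in> bilinear_relations V W" "z \<in> carrier V \<times> carrier W"
  shows "r \<otimes>\<^bsub>free_pairs V W\<^esub> Poly_Mapping.single z 1 \<in> bilinear_relations V W"
proof -
  note [simp del] = F.carrier_F F.add_F F.scale_F
  note lin = bilin_left[OF A.bilin_mult F.single_in_F[OF assms(2), of 1]]
  obtain a b where z: "z = (a, b)" "a \<in> carrier V" "b \<in> carrier W" using assms(2) by auto
  note ms = mult_diff mult_single F.single_in_F F.minus_in_F z pair_mult_def
  from assms(1) show ?thesis
  proof induction
    case zero
    then show ?case
      using lin_map_zero[OF F.vspace_axioms F.vspace_axioms lin] bilinear_relations.zero by simp
  next
    case (add p q)
    then have "p \<in> carrier (free_pairs V W)" "q \<in> carrier (free_pairs V W)"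
      using relations_subset by auto
    then show ?case
      using lin_map_add[OF lin, of p q] bilinear_relations.add[OF add.IH] by (simp add: F.add_F)
  next
    case (smult p c)
    then have "p \<in> carrier (free_pairs V W)" using relations_subset by auto
    then show ?case
      using lin_map_scale[OF lin, of p c] bilinear_relations.smult[OF smult.IH] by (simp add: F.scale_F)
  next
    case (add_left v v' w)
    then show ?case
      using bilinear_relations.add_left[of "v \<otimes>\<^bsub>V\<^esub> a" V "v' \<otimes>\<^bsub>V\<^esub> a" "w \<otimes>\<^bsub>W\<^esub> b" W]
      by (simp add: ms V.l_distr)
  next
    case (add_right v w w')
    then show ?case
      using bilinear_relations.add_right[of "v \<otimes>\<^bsub>V\<^esub> a" V "w \<otimes>\<^bsub>W\<^esub> b" W "w' \<otimes>\<^bsub>W\<^esub> b"]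
      by (simp add: ms W.l_distr)
  next
    case (smult_left v w c)
    then show ?case
      using bilinear_relations.smult_left[of "v \<otimes>\<^bsub>V\<^esub> a" V "w \<otimes>\<^bsub>W\<^esub> b" W c]
      by (simp add: ms V.smult_mult_left)
  next
    case (smult_right v w c)
    then show ?case
      using bilinear_relations.smult_right[of "v \<otimes>\<^bsub>V\<^esub> a" V "w \<otimes>\<^bsub>W\<^esub> b" W c]
      by (simp add: ms W.smult_mult_left)
  qed
qed

sublocale I: algebra_ideal "free_pairs V W" "bilinear_relations V W"
proof unfold_locales
  fix r q assume r: "r \<in> bilinear_relations V W" and q: "q \<in> carrier (free_pairs V W)"
  note lin = bilin_right[OF A.bilin_mult R.carr[OF r]]
  from F.spanning_basis q show "r \<otimes>\<^bsub>free_pairs V W\<^esub> q \<in> bilinear_relations V W"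
  proof (induction rule: spanning_induct)
    case zero
    show ?case
      using lin_map_zero[OF F.vspace_axioms F.vspace_axioms lin] R.zero_mem by simp
  next
    case (add x y)
    then show ?case using lin_map_add[OF lin add.hyps] R.add_mem[OF add.IH] by simp
  next
    case (scale c x)
    then show ?case using lin_map_scale[OF lin scale.hyps] R.scale_mem[OF scale.IH] by simp
  next
    case (base x)
    then show ?case using relation_mult_single[OF r] by auto
  qed
qed

lemma comm_alg_tensor: "comm_alg (tensor V W)"
  using I.comm_alg_quot by (simp add: tensor_eq)

lemma pure_tensor_mult:
  assumes "v \<in> carrier V" "v' \<in> carrier V" "w \<in> carrier W" "w' \<in> carrier W"
  shows "pure_tensor V W v w \<otimes>\<^bsub>tensor V W\<^esub> pure_tensor V W v' w' =
    pure_tensor V W (v \<otimes>\<^bsub>V\<^esub> v') (w \<otimes>\<^bsub>W\<^esub> w')"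
  using I.mult_quot[OF F.single_in_F[of "(v, w)" 1] F.single_in_F[of "(v', w')" 1]] assms
  by (simp add: tensor_eq pure_tensor_def mult_single pair_mult_def)

lemma pure_tensor_one: "\<one>\<^bsub>tensor V W\<^esub> = pure_tensor V W \<one>\<^bsub>V\<^esub> \<one>\<^bsub>W\<^esub>"
  by (simp add: tensor_eq R.one_quot pure_tensor_def one_free_pairs)

lemma algebra_hom_tensor_lift:
  assumes "comm_alg U" "bilin V W U \<beta>"
    and mult: "\<And>v v' w w'. v \<in> carrier V \<Longrightarrow> v' \<in> carrier V \<Longrightarrow> w \<in> carrier W \<Longrightarrow> w' \<in> carrier W \<Longrightarrow>
      \<beta> (v \<otimes>\<^bsub>V\<^esub> v') (w \<otimes>\<^bsub>W\<^esub> w') = \<beta> v w \<otimes>\<^bsub>U\<^esub> \<beta> v' w'"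
    and one: "\<beta> \<one>\<^bsub>V\<^esub> \<one>\<^bsub>W\<^esub> = \<one>\<^bsub>U\<^esub>"
  shows "algebra_hom (tensor V W) U (tensor_lift U \<beta>)"
proof -
  interpret U: comm_alg U by fact
  interpret T: comm_alg "tensor V W" by (rule comm_alg_tensor)
  note lift = tensor_lift_pure[OF U.vspace_axioms assms(2)]
  show ?thesis
    by (rule algebra_hom_on_spanning[OF T.assoc_algebra_axioms U.assoc_algebra_axioms spanning_tensor
          lin_map_tensor_lift[OF U.vspace_axioms assms(2)]])
      (auto simp: pure_tensor_mult pure_tensor_one lift mult one)
qed

end


section \<open>Canonical maps between tensor products\<close>

lemma tensor_map_facts:
  assumes "vspace V'" "vspace W'" "vspace V" "vspace W" "lin_map V' V f" "lin_map W' W g"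
  shows lin_map_tensor_map: "lin_map (tensor V' W') (tensor V W) (tensor_map V W f g)"
    and tensor_map_pure: "v \<in> carrier V' \<Longrightarrow> w \<in> carrier W' \<Longrightarrow>
      tensor_map V W f g (pure_tensor V' W' v w) = pure_tensor V W (f v) (g w)"
proof -
  interpret S: tensor_spaces V' W' using assms by (simp add: tensor_spaces_def)
  interpret T: tensor_spaces V W using assms by (simp add: tensor_spaces_def)
  note \<beta> = bilin_comp[OF T.bilin_pure_tensor assms(5,6)]
  show "lin_map (tensor V' W') (tensor V W) (tensor_map V W f g)"
    unfolding tensor_map_def by (rule S.lin_map_tensor_lift[OF T.vspace_tensor \<beta>])
  show "tensor_map V W f g (pure_tensor V' W' v w) = pure_tensor V W (f v) (g w)"
    if "v \<in> carrier V'" "w \<in> carrier W'"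
    unfolding tensor_map_def by (rule S.tensor_lift_pure[OF T.vspace_tensor \<beta> that])
qed

lemma algebra_hom_tensor_map:
  assumes "comm_alg V'" "comm_alg W'" "comm_alg V" "comm_alg W" "algebra_hom V' V f" "algebra_hom W' W g"
  shows "algebra_hom (tensor V' W') (tensor V W) (tensor_map V W f g)"
proof -
  interpret S: tensor_algebras V' W' using assms by (simp add: tensor_algebras_def)
  interpret T: tensor_algebras V W using assms by (simp add: tensor_algebras_def)
  note f = algebra_hom_lin[OF assms(5)] and g = algebra_hom_lin[OF assms(6)]
  show ?thesis
    unfolding tensor_map_def
    by (rule S.algebra_hom_tensor_lift[OF T.comm_alg_tensor bilin_comp[OF T.bilin_pure_tensor f g]])
      (simp_all add: algebra_hom_mult[OF assms(5)] algebra_hom_mult[OF assms(6)]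
        algebra_hom_one[OF assms(5)] algebra_hom_one[OF assms(6)]
        T.pure_tensor_mult T.pure_tensor_one lin_map_closed[OF f] lin_map_closed[OF g])
qed

text \<open>Three vector spaces and their iterated tensor products.\<close>

locale tensor_triple = U: vspace U + V: vspace V + W: vspace W
  for U :: "('k::field, 'u) module" and V :: "('k, 'v) module" and W :: "('k, 'w) module"
begin

sublocale UV: tensor_spaces U V ..
sublocale VW: tensor_spaces V W ..
sublocale UV_W: tensor_spaces "tensor U V" W
  by (intro tensor_spaces.intro UV.vspace_tensor W.vspace_axioms)
sublocale U_VW: tensor_spaces U "tensor V W"
  by (intro tensor_spaces.intro VW.vspace_tensor U.vspace_axioms)

text \<open>
  The map \<open>(u \<otimes> v, w) \<mapsto> u \<otimes> (v \<otimes> w)\<close>, from which the associativity isomorphism is lifted.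
\<close>

abbreviation assoc_aux :: "('k, 'u, 'v) tens \<Rightarrow> 'w \<Rightarrow> ('k, 'u, ('k, 'v, 'w) tens) tens" where
  "assoc_aux t w \<equiv> tensor_lift (tensor U (tensor V W))
     (\<lambda>u v. pure_tensor U (tensor V W) u (pure_tensor V W v w)) t"

lemma bilin_pure_pure:
  assumes "w \<in> carrier W"
  shows "bilin U V (tensor U (tensor V W)) (\<lambda>u v. pure_tensor U (tensor V W) u (pure_tensor V W v w))"
  by (rule bilin_comp[OF U_VW.bilin_pure_tensor lin_map_id(2) bilin_left[OF VW.bilin_pure_tensor assms]])

lemmas assoc_aux_pure = UV.tensor_lift_pure[OF U_VW.vspace_tensor bilin_pure_pure]
lemmas lin_map_assoc_aux = UV.lin_map_tensor_lift[OF U_VW.vspace_tensor bilin_pure_pure]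

lemma bilin_assoc_aux: "bilin (tensor U V) W (tensor U (tensor V W)) assoc_aux"
proof (rule bilinI)
  fix t assume t: "t \<in> carrier (tensor U V)"
  interpret X: vspace "tensor U (tensor V W)" by (rule U_VW.vspace_tensor)
  note sp = UV.vspace_tensor U_VW.vspace_tensor UV.spanning_tensor
  have lin: "lin_map W (tensor U (tensor V W)) (\<lambda>w. pure_tensor U (tensor V W) u (pure_tensor V W v w))"
    if "u \<in> carrier U" "v \<in> carrier V" for u v
    by (rule lin_map_comp[OF bilin_right[OF VW.bilin_pure_tensor that(2)]
          bilin_right[OF U_VW.bilin_pure_tensor that(1)]])
  show "lin_map W (tensor U (tensor V W)) (\<lambda>w. assoc_aux t w)"
  proof (rule lin_mapI)
    fix w w' assume w: "w \<in> carrier W" "w' \<in> carrier W"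
    \<comment> \<open>Linearity in \<open>w\<close> is clear for a pure tensor \<open>t\<close>, and both sides are linear in \<open>t\<close>.\<close>
    have "lin_map (tensor U V) (tensor U (tensor V W))
        (\<lambda>t. assoc_aux t w \<oplus>\<^bsub>tensor U (tensor V W)\<^esub> assoc_aux t w')"
      using w lin_map_assoc_aux[THEN lin_map_closed] lin_map_assoc_aux[THEN lin_map_add]
        lin_map_assoc_aux[THEN lin_map_scale]
      by (intro lin_mapI) (simp_all add: X.scale_add_right X.M.a_ac)
    then show "assoc_aux t (w \<oplus>\<^bsub>W\<^esub> w') = assoc_aux t w \<oplus>\<^bsub>tensor U (tensor V W)\<^esub> assoc_aux t w'"
      using w by (intro lin_map_eq_on_spanning[OF sp lin_map_assoc_aux _ _ t])
        (auto simp: assoc_aux_pure lin_map_add[OF lin])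
  next
    fix w c assume w: "w \<in> carrier W"
    have "lin_map (tensor U V) (tensor U (tensor V W)) (\<lambda>t. c \<odot>\<^bsub>tensor U (tensor V W)\<^esub> assoc_aux t w)"
      by (rule lin_map_comp[OF lin_map_assoc_aux[OF w] bilin_right[OF bilin_scale[OF X.vspace_axioms]]]) simp
    then show "assoc_aux t (c \<odot>\<^bsub>W\<^esub> w) = c \<odot>\<^bsub>tensor U (tensor V W)\<^esub> assoc_aux t w"
      using w by (intro lin_map_eq_on_spanning[OF sp lin_map_assoc_aux _ _ t])
        (auto simp: assoc_aux_pure lin_map_scale[OF lin])
  qed (use lin_map_closed[OF lin_map_assoc_aux t] in blast)
qed (rule lin_map_assoc_aux)

lemma lin_map_tensor_assoc:
  "lin_map (tensor (tensor U V) W) (tensor U (tensor V W)) (tensor_assoc U V W)"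
  unfolding tensor_assoc_def
  by (rule UV_W.lin_map_tensor_lift[OF U_VW.vspace_tensor bilin_assoc_aux])

lemma tensor_assoc_pure:
  assumes "u \<in> carrier U" "v \<in> carrier V" "w \<in> carrier W"
  shows "tensor_assoc U V W (pure_tensor (tensor U V) W (pure_tensor U V u v) w) =
    pure_tensor U (tensor V W) u (pure_tensor V W v w)"
  unfolding tensor_assoc_def
  using UV_W.tensor_lift_pure[OF U_VW.vspace_tensor bilin_assoc_aux UV.pure_tensor_closed assms(3)]
    assoc_aux_pure[OF assms(3,1,2)] assms by simp

end

lemma algebra_hom_tensor_assoc:
  assumes "comm_alg U" "comm_alg V" "comm_alg W"
  shows "algebra_hom (tensor (tensor U V) W) (tensor U (tensor V W)) (tensor_assoc U V W)"
proof -
  interpret U: comm_alg U by fact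
  interpret V: comm_alg V by fact
  interpret W: comm_alg W by fact
  interpret tensor_triple U V W ..
  interpret AUV: tensor_algebras U V ..
  interpret AVW: tensor_algebras V W ..
  interpret TUV: comm_alg "tensor U V" by (rule AUV.comm_alg_tensor)
  interpret TVW: comm_alg "tensor V W" by (rule AVW.comm_alg_tensor)
  interpret AUV_W: tensor_algebras "tensor U V" W ..
  interpret AU_VW: tensor_algebras U "tensor V W" ..
  interpret X: comm_alg "tensor U (tensor V W)" by (rule AU_VW.comm_alg_tensor)
  have mult: "assoc_aux (t \<otimes>\<^bsub>tensor U V\<^esub> t') (w \<otimes>\<^bsub>W\<^esub> w') =
      assoc_aux t w \<otimes>\<^bsub>tensor U (tensor V W)\<^esub> assoc_aux t' w'"
    if t: "t \<in> carrier (tensor U V)" "t' \<in> carrier (tensor U V)"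
        and w: "w \<in> carrier W" "w' \<in> carrier W" for t t' w w'
  proof (rule bilin_eq_on_spanning[OF UV.vspace_tensor UV.vspace_tensor U_VW.vspace_tensor
        UV.spanning_tensor UV.spanning_tensor _ _ _ t])
    show "bilin (tensor U V) (tensor U V) (tensor U (tensor V W))
        (\<lambda>t t'. assoc_aux (t \<otimes>\<^bsub>tensor U V\<^esub> t') (w \<otimes>\<^bsub>W\<^esub> w'))"
      by (rule bilin_lin_comp[OF TUV.bilin_mult lin_map_assoc_aux[OF W.m_closed[OF w]]])
    show "bilin (tensor U V) (tensor U V) (tensor U (tensor V W))
        (\<lambda>t t'. assoc_aux t w \<otimes>\<^bsub>tensor U (tensor V W)\<^esub> assoc_aux t' w')"
      by (rule bilin_comp[OF X.bilin_mult lin_map_assoc_aux[OF w(1)] lin_map_assoc_aux[OF w(2)]])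
  qed (use w in \<open>auto simp: AUV.pure_tensor_mult AVW.pure_tensor_mult AU_VW.pure_tensor_mult
        assoc_aux_pure VW.pure_tensor_closed UV.pure_tensor_closed\<close>)
  have one: "assoc_aux \<one>\<^bsub>tensor U V\<^esub> \<one>\<^bsub>W\<^esub> = \<one>\<^bsub>tensor U (tensor V W)\<^esub>"
    by (simp add: AUV.pure_tensor_one AVW.pure_tensor_one AU_VW.pure_tensor_one assoc_aux_pure)
  show ?thesis
    unfolding tensor_assoc_def
    by (rule AUV_W.algebra_hom_tensor_lift[OF X.comm_alg_axioms bilin_assoc_aux mult one])
qed

lemma tensor_unit_left_facts:
  assumes "vspace V"
  shows lin_map_tensor_unit_left: "lin_map (tensor ground V) V (tensor_unit_left V)"
    and tensor_unit_left_pure: "v \<in> carrier V \<Longrightarrow> tensor_unit_left V (pure_tensor ground V c v) = c \<odot>\<^bsub>V\<^esub> v"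
proof -
  interpret T: tensor_spaces ground V using assms vspace_ground by (simp add: tensor_spaces_def)
  show "lin_map (tensor ground V) V (tensor_unit_left V)"
    unfolding tensor_unit_left_def by (rule T.lin_map_tensor_lift[OF assms bilin_scale[OF assms]])
  show "tensor_unit_left V (pure_tensor ground V c v) = c \<odot>\<^bsub>V\<^esub> v" if "v \<in> carrier V"
    unfolding tensor_unit_left_def
    by (rule T.tensor_lift_pure[OF assms bilin_scale[OF assms] _ that]) simp
qed

lemma tensor_unit_right_facts:
  assumes "vspace V"
  shows lin_map_tensor_unit_right: "lin_map (tensor V ground) V (tensor_unit_right V)"
    and tensor_unit_right_pure: "v \<in> carrier V \<Longrightarrow> tensor_unit_right V (pure_tensor V ground v c) = c \<odot>\<^bsub>V\<^esub> v"
proof -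
  interpret T: tensor_spaces V ground using assms vspace_ground by (simp add: tensor_spaces_def)
  note \<beta> = bilin_flip[OF bilin_scale[OF assms]]
  show "lin_map (tensor V ground) V (tensor_unit_right V)"
    unfolding tensor_unit_right_def by (rule T.lin_map_tensor_lift[OF assms \<beta>])
  show "tensor_unit_right V (pure_tensor V ground v c) = c \<odot>\<^bsub>V\<^esub> v" if "v \<in> carrier V"
    unfolding tensor_unit_right_def
    by (rule T.tensor_lift_pure[OF assms \<beta> that]) simp
qed

lemma algebra_hom_tensor_units:
  assumes "comm_alg V"
  shows algebra_hom_tensor_unit_left: "algebra_hom (tensor ground V) V (tensor_unit_left V)"
    and algebra_hom_tensor_unit_right: "algebra_hom (tensor V ground) V (tensor_unit_right V)"
proof -
  interpret V: comm_alg V by fact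
  interpret L: tensor_algebras ground V using assms comm_alg_ground by (simp add: tensor_algebras_def)
  interpret R: tensor_algebras V ground using assms comm_alg_ground by (simp add: tensor_algebras_def)
  have mult: "(c * c') \<odot>\<^bsub>V\<^esub> (v \<otimes>\<^bsub>V\<^esub> v') = (c \<odot>\<^bsub>V\<^esub> v) \<otimes>\<^bsub>V\<^esub> (c' \<odot>\<^bsub>V\<^esub> v')"
    if "v \<in> carrier V" "v' \<in> carrier V" for c c' v v'
    using that by (simp add: V.smult_mult_left V.smult_mult_right V.scale_scale mult.commute)
  show "algebra_hom (tensor ground V) V (tensor_unit_left V)"
    unfolding tensor_unit_left_def
    by (rule L.algebra_hom_tensor_lift[OF assms bilin_scale[OF V.vspace_axioms]]) (simp_all add: mult)
  show "algebra_hom (tensor V ground) V (tensor_unit_right V)"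
    unfolding tensor_unit_right_def
    by (rule R.algebra_hom_tensor_lift[OF assms bilin_flip[OF bilin_scale[OF V.vspace_axioms]]])
      (simp_all add: mult)
qed


section \<open>Polynomial algebras\<close>

text \<open>The polynomial algebra in the variables \<open>poly_var s i\<close> with \<open>s\<close> and \<open>i\<close> in \<open>{1..n}\<close>.\<close>

locale matrix_polys = fixes n :: nat and P :: "('k::field, 'k matrix_poly) module"
  defines "P \<equiv> matrix_poly_algebra n"
begin

text \<open>Monomials in these variables, as exponent functions; they form a basis.\<close>

abbreviation monomials :: "((nat \<times> nat) \<Rightarrow>\<^sub>0 nat) set" where
  "monomials \<equiv> {m. Poly_Mapping.keys m \<subseteq> {1..n} \<times> {1..n}}"

sublocale F: free_vspace P monomials
  by unfold_locales
    (auto simp: P_def matrix_poly_algebra_def poly_const_def mult_map_scale_conv_mult)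

lemma mult_P: "p \<otimes>\<^bsub>P\<^esub> q = p * q" and one_P: "\<one>\<^bsub>P\<^esub> = 1"
  by (simp_all add: P_def matrix_poly_algebra_def)

lemma scale_eq: "poly_const c * p = c \<odot>\<^bsub>P\<^esub> p"
  by (simp add: P_def matrix_poly_algebra_def)

lemma comm_alg_matrix_polys: "comm_alg P"
proof (rule comm_algI[OF F.vspace_axioms _ _ spanning_carrier])
  have closed: "p * q \<in> carrier P" if "p \<in> carrier P" "q \<in> carrier P" for p q
  proof -
    have "a + b \<in> monomials" if ab: "a \<in> Poly_Mapping.keys p" "b \<in> Poly_Mapping.keys q" for a b
    proof -
      have "a \<in> monomials" "b \<in> monomials"
        using ab \<open>p \<in> carrier P\<close> \<open>q \<in> carrier P\<close> unfolding F.carrier_F by blast+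
      then show ?thesis using Poly_Mapping.keys_add[of a b] by blast
    qed
    then have "{a + b |a b. a \<in> Poly_Mapping.keys p \<and> b \<in> Poly_Mapping.keys q} \<subseteq> monomials"
      by blast
    then show ?thesis using keys_mult[of p q] unfolding F.carrier_F by blast
  qed
  show "bilin P P P (\<otimes>\<^bsub>P\<^esub>)"
    unfolding bilin_iff mult_P F.add_F scale_eq[symmetric]
    using closed by (simp add: algebra_simps del: F.carrier_F)
qed (simp_all add: mult_P one_P mult_ac)

sublocale comm_alg P
  by (rule comm_alg_matrix_polys)

lemma var_closed: "s \<in> {1..n} \<Longrightarrow> i \<in> {1..n} \<Longrightarrow> poly_var s i \<in> carrier P"
  by (simp add: poly_var_def)

lemma algebra_hom_eq_on_vars:
  assumes "assoc_algebra B" "algebra_hom P B f" "algebra_hom P B g"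
    and var: "\<And>s i. s \<in> {1..n} \<Longrightarrow> i \<in> {1..n} \<Longrightarrow> f (poly_var s i) = g (poly_var s i)"
    and "p \<in> carrier P"
  shows "f p = g p"
proof -
  interpret B: assoc_algebra B by fact
  define X :: "((nat \<times> nat) \<Rightarrow>\<^sub>0 nat) \<Rightarrow> 'k matrix_poly" where "X m = Poly_Mapping.single m 1" for m
  have mult: "f (X (m + m')) = f (X m) \<otimes>\<^bsub>B\<^esub> f (X m')" "g (X (m + m')) = g (X m) \<otimes>\<^bsub>B\<^esub> g (X m')"
    if "m \<in> monomials" "m' \<in> monomials" for m m'
  proof -
    have "X (m + m') = X m \<otimes>\<^bsub>P\<^esub> X m'" "X m \<in> carrier P" "X m' \<in> carrier P"
      using that by (simp_all add: X_def mult_P Poly_Mapping.mult_single)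
    then show "f (X (m + m')) = f (X m) \<otimes>\<^bsub>B\<^esub> f (X m')" "g (X (m + m')) = g (X m) \<otimes>\<^bsub>B\<^esub> g (X m')"
      using algebra_hom_mult[OF assms(2)] algebra_hom_mult[OF assms(3)] by auto
  qed
  have X0: "f (X 0) = g (X 0)"
    using algebra_hom_one[OF assms(2)] algebra_hom_one[OF assms(3)] by (simp add: X_def one_P)
  have pow: "f (X (Poly_Mapping.single z k)) = g (X (Poly_Mapping.single z k))"
    if "z \<in> {1..n} \<times> {1..n}" for z k
  proof (induction k)
    case (Suc k)
    have "Poly_Mapping.single z (Suc k) = Poly_Mapping.single z 1 + Poly_Mapping.single z k"
      by (simp flip: single_add)
    moreover have "f (X (Poly_Mapping.single z 1)) = g (X (Poly_Mapping.single z 1))"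
      using var[of "fst z" "snd z"] that by (auto simp: X_def poly_var_def)
    ultimately show ?case using that Suc by (simp add: mult del: One_nat_def)
  qed (simp add: X0)
  have X: "f (X m) = g (X m)" if "finite T" "Poly_Mapping.keys m \<subseteq> T" "T \<subseteq> {1..n} \<times> {1..n}" for m T
    using that
  proof (induction T arbitrary: m)
    case empty
    then have "m = 0" by (intro poly_mapping_eqI) (auto simp: in_keys_iff)
    then show ?case using X0 by simp
  next
    case (insert z T)
    define m' where "m' = Poly_Mapping.update z 0 m"
    have m: "m = Poly_Mapping.single z (Poly_Mapping.lookup m z) + m'"
      by (rule poly_mapping_eqI)
        (auto simp: m'_def lookup_add lookup_update lookup_single when_def)
    have "Poly_Mapping.keys m' \<subseteq> T"
      using insert.prems(1) by (auto simp: m'_def keys_update)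
    then have "f (X m') = g (X m')" "m' \<in> monomials" using insert by auto
    then show ?case using insert.prems pow by (subst (1 2) m) (simp add: mult)
  qed
  show ?thesis
    by (rule lin_map_eq_on_spanning[OF F.vspace_axioms B.vspace_axioms F.spanning_basis
          algebra_hom_lin[OF assms(2)] algebra_hom_lin[OF assms(3)] _ assms(5)])
      (use X[OF finite_keys order_refl] in \<open>auto simp: X_def\<close>)
qed

text \<open>The universal property of the polynomial algebra among commutative algebras.\<close>

lemma ex_eval_hom:
  assumes "comm_alg B" and g: "\<And>s i. s \<in> {1..n} \<Longrightarrow> i \<in> {1..n} \<Longrightarrow> g s i \<in> carrier B"
  shows "\<exists>f. algebra_hom P B f \<and> (\<forall>s\<in>{1..n}. \<forall>i\<in>{1..n}. f (poly_var s i) = g s i)"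
proof -
  interpret B: comm_alg B by fact
  let ?I = "{1..n} \<times> {1..n}"
  \<comment> \<open>The value of a monomial. All variables occur in the product, with exponent zero if need be.\<close>
  define mon where "mon m = (\<Otimes>\<^bsub>B\<^esub>z\<in>?I. g (fst z) (snd z) [^]\<^bsub>B\<^esub> Poly_Mapping.lookup m z)"
    for m :: "(nat \<times> nat) \<Rightarrow>\<^sub>0 nat"
  have gI: "g (fst z) (snd z) \<in> carrier B" if "z \<in> ?I" for z using that g by auto
  have mon_closed: "mon m \<in> carrier B" for m
    unfolding mon_def using gI by (intro B.finprod_closed) auto
  have mon_add: "mon (m + m') = mon m \<otimes>\<^bsub>B\<^esub> mon m'" for m m'
  proof -
    have "mon (m + m') = (\<Otimes>\<^bsub>B\<^esub>z\<in>?I. g (fst z) (snd z) [^]\<^bsub>B\<^esub> Poly_Mapping.lookup m z \<otimes>\<^bsub>B\<^esub>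
        g (fst z) (snd z) [^]\<^bsub>B\<^esub> Poly_Mapping.lookup m' z)"
      unfolding mon_def using gI by (intro B.finprod_cong') (auto simp: lookup_add B.nat_pow_mult)
    also have "\<dots> = mon m \<otimes>\<^bsub>B\<^esub> mon m'"
      unfolding mon_def using gI by (intro B.finprod_multf) auto
    finally show ?thesis .
  qed
  have mon_0: "mon 0 = \<one>\<^bsub>B\<^esub>" unfolding mon_def by (simp add: B.finprod_one_eqI)
  have mon_var: "mon (Poly_Mapping.single (s, i) 1) = g s i" if "s \<in> {1..n}" "i \<in> {1..n}" for s i
  proof -
    have "mon (Poly_Mapping.single (s, i) 1) = (\<Otimes>\<^bsub>B\<^esub>z\<in>?I. if (s, i) = z then g (fst z) (snd z) else \<one>\<^bsub>B\<^esub>)"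
      unfolding mon_def using gI by (intro B.finprod_cong') (auto simp: lookup_single)
    then show ?thesis using B.finprod_singleton[of "(s, i)" ?I "\<lambda>z. g (fst z) (snd z)"] gI that by simp
  qed
  have single: "lin_ext B mon (Poly_Mapping.single m 1) = mon m" for m
    using lin_ext_single[OF B.vspace_axioms, where g = mon] mon_closed by simp
  have "algebra_hom P B (lin_ext B mon)"
  proof (rule algebra_hom_on_spanning[OF assoc_algebra_axioms B.assoc_algebra_axioms F.spanning_basis])
    show "lin_map P B (lin_ext B mon)"
      using mon_closed by (intro F.lin_map_lin_ext B.vspace_axioms) auto
  qed (use single[of 0] in \<open>auto simp: mult_P one_P Poly_Mapping.mult_single single mon_add mon_0\<close>)
  then show ?thesis using mon_var by (intro exI[of _ "lin_ext B mon"]) (auto simp: poly_var_def single)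
qed

end


section \<open>Matrices over a commutative algebra\<close>

text \<open>
  Matrices are functions on index sets of arbitrary type. The product of an \<open>I \<times> J\<close> matrix and a
  \<open>J \<times> L\<close> matrix needs the index set \<open>J\<close> only.
\<close>

definition mat_mult ::
  "('k, 'b) module \<Rightarrow> 'j set \<Rightarrow> ('i \<Rightarrow> 'j \<Rightarrow> 'b) \<Rightarrow> ('j \<Rightarrow> 'l \<Rightarrow> 'b) \<Rightarrow> 'i \<Rightarrow> 'l \<Rightarrow> 'b" where
  "mat_mult B J g h i l = (\<Oplus>\<^bsub>B\<^esub>j\<in>J. g i j \<otimes>\<^bsub>B\<^esub> h j l)"

text \<open>The identity matrix.\<close>

definition id_mat :: "('k, 'b) module \<Rightarrow> 'i \<Rightarrow> 'i \<Rightarrow> 'b" where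
  "id_mat B i j = (if i = j then \<one>\<^bsub>B\<^esub> else \<zero>\<^bsub>B\<^esub>)"

text \<open>The Kronecker product, whose rows and columns are indexed by pairs.\<close>

definition kron ::
  "('k, 'b) module \<Rightarrow> ('i \<Rightarrow> 'j \<Rightarrow> 'b) \<Rightarrow> ('m \<Rightarrow> 'l \<Rightarrow> 'b) \<Rightarrow> 'i \<times> 'm \<Rightarrow> 'j \<times> 'l \<Rightarrow> 'b" where
  "kron B g h p q = g (fst p) (fst q) \<otimes>\<^bsub>B\<^esub> h (snd p) (snd q)"

text \<open>The matrix \<open>g\<close> has its entries at \<open>I \<times> J\<close> in \<open>B\<close>.\<close>

definition mat_over :: "('k, 'b) module \<Rightarrow> 'i set \<Rightarrow> 'j set \<Rightarrow> ('i \<Rightarrow> 'j \<Rightarrow> 'b) \<Rightarrow> bool" where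
  "mat_over B I J g \<longleftrightarrow> (\<forall>i\<in>I. \<forall>j\<in>J. g i j \<in> carrier B)"

lemma mat_overD: "mat_over B I J g \<Longrightarrow> i \<in> I \<Longrightarrow> j \<in> J \<Longrightarrow> g i j \<in> carrier B"
  by (simp add: mat_over_def)

context vspace
begin

lemma finsum_cartesian:
  assumes "finite I" "finite J" "\<And>i j. i \<in> I \<Longrightarrow> j \<in> J \<Longrightarrow> f i j \<in> carrier V"
  shows "(\<Oplus>i\<in>I. \<Oplus>j\<in>J. f i j) = (\<Oplus>z\<in>I \<times> J. f (fst z) (snd z))"
proof -
  have "(\<Oplus>z\<in>I \<times> J. f (fst z) (snd z)) = (\<Oplus>z\<in>(\<Union>i\<in>I. Pair i ` J). f (fst z) (snd z))"
    by (rule arg_cong[where f = "finsum V _"]) auto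
  also have "\<dots> = (\<Oplus>i\<in>I. \<Oplus>z\<in>Pair i ` J. f (fst z) (snd z))"
    using assms by (intro M.add.finprod_UN_disjoint) (auto simp: pairwise_def disjnt_def)
  also have "\<dots> = (\<Oplus>i\<in>I. \<Oplus>j\<in>J. f i j)"
  proof (rule M.finsum_cong')
    fix i assume "i \<in> I"
    then show "(\<Oplus>z\<in>Pair i ` J. f (fst z) (snd z)) = (\<Oplus>j\<in>J. f i j)"
      using assms by (subst M.finsum_reindex) (auto simp: inj_on_def)
  qed (use assms in \<open>auto intro!: M.finsum_closed\<close>)
  finally show ?thesis by simp
qed

end

context comm_alg
begin

lemma mat_over_mult:
  "mat_over A I J g \<Longrightarrow> mat_over A J L h \<Longrightarrow> mat_over A I L (mat_mult A J g h)"
  by (auto simp: mat_over_def mat_mult_def intro!: finsum_closed)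

lemma mat_over_kron:
  "mat_over A I J g \<Longrightarrow> mat_over A M L h \<Longrightarrow> mat_over A (I \<times> M) (J \<times> L) (kron A g h)"
  by (auto simp: mat_over_def kron_def)

lemma mat_over_id: "mat_over A I J (id_mat A)"
  by (auto simp: mat_over_def id_mat_def)

lemma mat_mult_assoc:
  assumes "finite J" "finite L" "mat_over A I J g" "mat_over A J L h" "mat_over A L M f" "i \<in> I" "m \<in> M"
  shows "mat_mult A L (mat_mult A J g h) f i m = mat_mult A J g (mat_mult A L h f) i m"
proof -
  have cl: "g i j \<in> carrier A" if "j \<in> J" for j using assms that by (auto intro: mat_overD)
  have cl': "f l m \<in> carrier A" if "l \<in> L" for l using assms that by (auto intro: mat_overD)
  have cl'': "h j l \<in> carrier A" if "j \<in> J" "l \<in> L" for j l using assms that by (auto intro: mat_overD)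
  note cl = cl cl' cl''
  have "mat_mult A L (mat_mult A J g h) f i m = (\<Oplus>l\<in>L. \<Oplus>j\<in>J. g i j \<otimes> h j l \<otimes> f l m)"
    unfolding mat_mult_def using cl assms(1)
    by (intro finsum_cong') (auto intro!: finsum_ldistr finsum_closed)
  also have "\<dots> = (\<Oplus>j\<in>J. \<Oplus>l\<in>L. g i j \<otimes> h j l \<otimes> f l m)"
    using cl assms(1,2) by (intro finsum_swap) auto
  also have "\<dots> = (\<Oplus>j\<in>J. \<Oplus>l\<in>L. g i j \<otimes> (h j l \<otimes> f l m))"
    using cl by (intro finsum_cong') (auto intro!: finsum_closed finsum_cong' simp: m_assoc)
  also have "\<dots> = mat_mult A J g (mat_mult A L h f) i m"
    unfolding mat_mult_def using cl assms(2)
    by (intro finsum_cong') (auto intro!: finsum_rdistr[symmetric] finsum_closed)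
  finally show ?thesis .
qed

lemma kron_mult:
  assumes "finite J" "finite L" "mat_over A I J g" "mat_over A J I' h" "mat_over A M L G" "mat_over A L M' H"
    and "p \<in> I \<times> M" "q \<in> I' \<times> M'"
  shows "kron A (mat_mult A J g h) (mat_mult A L G H) p q = mat_mult A (J \<times> L) (kron A g G) (kron A h H) p q"
proof -
  obtain i m where p: "p = (i, m)" by (cases p)
  obtain i' m' where q: "q = (i', m')" by (cases q)
  have cl: "g i j \<in> carrier A" "h j i' \<in> carrier A" if "j \<in> J" for j
    using assms that p q by (auto intro: mat_overD)
  have cl': "G m l \<in> carrier A" "H l m' \<in> carrier A" if "l \<in> L" for l
    using assms that p q by (auto intro: mat_overD)
  have "kron A (mat_mult A J g h) (mat_mult A L G H) p q =
      (\<Oplus>j\<in>J. g i j \<otimes> h j i') \<otimes> (\<Oplus>l\<in>L. G m l \<otimes> H l m')"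
    by (simp add: kron_def mat_mult_def p q)
  also have "\<dots> = (\<Oplus>j\<in>J. (g i j \<otimes> h j i') \<otimes> (\<Oplus>l\<in>L. G m l \<otimes> H l m'))"
    using cl cl' assms(1) by (intro finsum_ldistr) (auto intro!: finsum_closed)
  also have "\<dots> = (\<Oplus>j\<in>J. \<Oplus>l\<in>L. (g i j \<otimes> h j i') \<otimes> (G m l \<otimes> H l m'))"
    using cl cl' assms(2) by (intro finsum_cong' finsum_rdistr) (auto intro!: finsum_closed)
  also have "\<dots> = (\<Oplus>z\<in>J \<times> L. (g i (fst z) \<otimes> h (fst z) i') \<otimes> (G m (snd z) \<otimes> H (snd z) m'))"
    using cl cl' assms(1,2) by (intro finsum_cartesian) auto
  also have "\<dots> = mat_mult A (J \<times> L) (kron A g G) (kron A h H) p q"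
    unfolding mat_mult_def kron_def p q fst_conv snd_conv using cl cl'
    by (intro finsum_cong') (auto simp: m_ac)
  finally show ?thesis .
qed

lemma kron_id: "kron A (id_mat A) (id_mat A) p q = id_mat A p q"
  by (auto simp: kron_def id_mat_def prod_eq_iff)

lemma mat_mult_cong:
  assumes "mat_over A I J g" "mat_over A J L h" "i \<in> I" "l \<in> L"
    and "\<And>j. j \<in> J \<Longrightarrow> g i j = g' i j" "\<And>j. j \<in> J \<Longrightarrow> h j l = h' j l"
  shows "mat_mult A J g h i l = mat_mult A J g' h' i l"
  unfolding mat_mult_def
proof (rule finsum_cong'[OF refl])
  show "(\<lambda>j. g' i j \<otimes> h' j l) \<in> J \<rightarrow> carrier A"
    using assms mat_overD[OF assms(1)] mat_overD[OF assms(2)] by (auto simp flip: assms(5,6))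
qed (use assms in auto)

lemma mat_mult_id_left:
  assumes "finite I" "mat_over A I J g" "i \<in> I" "j \<in> J"
  shows "mat_mult A I (id_mat A) g i j = g i j"
proof -
  have "mat_mult A I (id_mat A) g i j = (\<Oplus>s\<in>I. if i = s then g s j else \<zero>)"
    unfolding mat_mult_def using assms by (intro finsum_cong') (auto simp: id_mat_def mat_overD)
  then show ?thesis using assms finsum_singleton[of i I "\<lambda>s. g s j"] by (auto simp: mat_overD)
qed

lemma mat_mult_id_right:
  assumes "finite J" "mat_over A I J g" "i \<in> I" "j \<in> J"
  shows "mat_mult A J g (id_mat A) i j = g i j"
proof -
  have "mat_mult A J g (id_mat A) i j = (\<Oplus>s\<in>J. if j = s then g i s else \<zero>)"
    unfolding mat_mult_def using assms by (intro finsum_cong') (auto simp: id_mat_def mat_overD)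
  then show ?thesis using assms finsum_singleton[of j J "\<lambda>s. g i s"] by (auto simp: mat_overD)
qed

text \<open>The matrix equation \<open>g \<sigma> = \<sigma> G\<close>, where \<open>\<sigma>\<close> has rows \<open>I\<close> and columns \<open>M\<close>.\<close>

definition intertwines :: "'i set \<Rightarrow> 'm set \<Rightarrow> ('i \<Rightarrow> 'm \<Rightarrow> 'a) \<Rightarrow> ('i \<Rightarrow> 'i \<Rightarrow> 'a) \<Rightarrow> ('m \<Rightarrow> 'm \<Rightarrow> 'a) \<Rightarrow> bool" where
  "intertwines I M \<sigma> g G \<longleftrightarrow> (\<forall>a\<in>I. \<forall>m\<in>M. mat_mult A I g \<sigma> a m = mat_mult A M \<sigma> G a m)"

text \<open>The reason is \<open>(g h) \<sigma> = g (\<sigma> H) = (g \<sigma>) H = \<sigma> (G H)\<close>.\<close>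

lemma intertwines_mult:
  assumes fin: "finite I" "finite M"
    and \<sigma>: "mat_over A I M \<sigma>" and g: "mat_over A I I g" and h: "mat_over A I I h"
    and G: "mat_over A M M G" and H: "mat_over A M M H"
    and gG: "intertwines I M \<sigma> g G" and hH: "intertwines I M \<sigma> h H"
  shows "intertwines I M \<sigma> (mat_mult A I g h) (mat_mult A M G H)"
  unfolding intertwines_def
proof (intro ballI)
  fix a m assume am: "a \<in> I" "m \<in> M"
  have "mat_mult A I (mat_mult A I g h) \<sigma> a m = mat_mult A I g (mat_mult A I h \<sigma>) a m"
    by (rule mat_mult_assoc[OF fin(1,1) g h \<sigma> am])
  also have "\<dots> = mat_mult A I g (mat_mult A M \<sigma> H) a m"
    by (rule mat_mult_cong[OF g mat_over_mult[OF h \<sigma>] am])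
      (use hH am in \<open>auto simp: intertwines_def\<close>)
  also have "\<dots> = mat_mult A M (mat_mult A I g \<sigma>) H a m"
    by (rule mat_mult_assoc[OF fin g \<sigma> H am, symmetric])
  also have "\<dots> = mat_mult A M (mat_mult A M \<sigma> G) H a m"
    by (rule mat_mult_cong[OF mat_over_mult[OF g \<sigma>] H am])
      (use gG am in \<open>auto simp: intertwines_def\<close>)
  also have "\<dots> = mat_mult A M \<sigma> (mat_mult A M G H) a m"
    by (rule mat_mult_assoc[OF fin(2,2) \<sigma> G H am])
  finally show "mat_mult A I (mat_mult A I g h) \<sigma> a m = mat_mult A M \<sigma> (mat_mult A M G H) a m" .
qed

lemma intertwines_id:
  assumes "finite I" "finite M" "mat_over A I M \<sigma>"
  shows "intertwines I M \<sigma> (id_mat A) (id_mat A)"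
  using assms by (simp add: intertwines_def mat_mult_id_left mat_mult_id_right)

lemma intertwines_cong:
  assumes "mat_over A I M \<sigma>" "mat_over A M M G" "\<And>p q. p \<in> M \<Longrightarrow> q \<in> M \<Longrightarrow> G p q = G' p q"
  shows "intertwines I M \<sigma> g G \<longleftrightarrow> intertwines I M \<sigma> g G'"
proof -
  have "mat_mult A M \<sigma> G a m = mat_mult A M \<sigma> G' a m" if "a \<in> I" "m \<in> M" for a m
    by (rule mat_mult_cong[OF assms(1,2) that]) (use assms(3) that in auto)
  then show ?thesis by (simp add: intertwines_def)
qed

end


section \<open>Matrices of Lie-Yamaguti endomorphisms\<close>

text \<open>
  The matrices \<open>g\<close> over \<open>B\<close> that satisfy the defining relations of the universal algebra. For
  structure constants \<open>\<tau>\<close> and \<open>\<omega>\<close> of a Lie-Yamaguti algebra \<open>L\<close>, these relations state that the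
  \<open>B\<close>-linear map \<open>e\<^sub>i \<otimes> 1 \<mapsto> \<Sum>\<^sub>a e\<^sub>a \<otimes> g a i\<close> is an endomorphism of the Lie-Yamaguti algebra \<open>L \<otimes> B\<close>.
\<close>

definition ly_matrix ::
  "('k, 'b) module \<Rightarrow> nat \<Rightarrow> (nat \<Rightarrow> nat \<Rightarrow> nat \<Rightarrow> 'k) \<Rightarrow> (nat \<Rightarrow> nat \<Rightarrow> nat \<Rightarrow> nat \<Rightarrow> 'k) \<Rightarrow>
     (nat \<Rightarrow> nat \<Rightarrow> 'b) \<Rightarrow> bool" where
  "ly_matrix B n \<tau> \<omega> g \<longleftrightarrow> mat_over B {1..n} {1..n} g \<and>
     (\<forall>a\<in>{1..n}. \<forall>i\<in>{1..n}. \<forall>j\<in>{1..n}.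
        (\<Oplus>\<^bsub>B\<^esub>u\<in>{1..n}. \<tau> u i j \<odot>\<^bsub>B\<^esub> g a u) =
        (\<Oplus>\<^bsub>B\<^esub>s\<in>{1..n}. \<Oplus>\<^bsub>B\<^esub>t\<in>{1..n}. \<tau> a s t \<odot>\<^bsub>B\<^esub> (g s i \<otimes>\<^bsub>B\<^esub> g t j))) \<and>
     (\<forall>a\<in>{1..n}. \<forall>i\<in>{1..n}. \<forall>j\<in>{1..n}. \<forall>k\<in>{1..n}.
        (\<Oplus>\<^bsub>B\<^esub>u\<in>{1..n}. \<omega> u i j k \<odot>\<^bsub>B\<^esub> g a u) =
        (\<Oplus>\<^bsub>B\<^esub>r\<in>{1..n}. \<Oplus>\<^bsub>B\<^esub>s\<in>{1..n}. \<Oplus>\<^bsub>B\<^esub>t\<in>{1..n}.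
           \<omega> a r s t \<odot>\<^bsub>B\<^esub> (g r i \<otimes>\<^bsub>B\<^esub> (g s j \<otimes>\<^bsub>B\<^esub> g t k))))"

context comm_alg
begin

text \<open>
  The relations in matrix form: the structure constants form matrices with columns indexed by
  pairs and triples, and \<open>g\<close> acts on these indices by its Kronecker square and cube.
\<close>

lemma ly_matrix_iff:
  fixes n :: nat
  defines "I \<equiv> {1..n}"
  shows "ly_matrix A n \<tau> \<omega> g \<longleftrightarrow> mat_over A I I g \<and>
     intertwines I (I \<times> I) (\<lambda>u (i, j). \<tau> u i j \<odot> \<one>) g (kron A g g) \<and>
     intertwines I (I \<times> I \<times> I) (\<lambda>u (i, j, k). \<omega> u i j k \<odot> \<one>) g (kron A g (kron A g g))"
proof (cases "mat_over A I I g")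
  case True
  note cl [simp] = mat_overD[OF True]
  have fin: "finite I" by (simp add: I_def)
  have left: "(\<Oplus>u\<in>I. g a u \<otimes> (c u \<odot> \<one>)) = (\<Oplus>u\<in>I. c u \<odot> g a u)" if "a \<in> I" for a c
    using that by (intro finsum_cong') (auto simp: smult_mult_right)
  have 2: "(\<Oplus>m\<in>I \<times> I. (\<lambda>(i, j). \<tau> a i j \<odot> \<one>) m \<otimes> kron A g g m (i, j)) =
      (\<Oplus>s\<in>I. \<Oplus>t\<in>I. \<tau> a s t \<odot> (g s i \<otimes> g t j))" if "i \<in> I" "j \<in> I" for a i j
    using that fin by (subst finsum_cartesian)
      (auto simp: kron_def smult_mult_left intro!: finsum_cong')
  have 3: "(\<Oplus>m\<in>I \<times> I \<times> I. (\<lambda>(i, j, k). \<omega> a i j k \<odot> \<one>) m \<otimes> kron A g (kron A g g) m (i, j, k)) =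
      (\<Oplus>r\<in>I. \<Oplus>s\<in>I. \<Oplus>t\<in>I. \<omega> a r s t \<odot> (g r i \<otimes> (g s j \<otimes> g t k)))"
    if "i \<in> I" "j \<in> I" "k \<in> I" for a i j k
  proof -
    have "(\<Oplus>r\<in>I. \<Oplus>s\<in>I. \<Oplus>t\<in>I. \<omega> a r s t \<odot> (g r i \<otimes> (g s j \<otimes> g t k))) =
        (\<Oplus>r\<in>I. \<Oplus>z\<in>I \<times> I. \<omega> a r (fst z) (snd z) \<odot> (g r i \<otimes> (g (fst z) j \<otimes> g (snd z) k)))"
      using that fin by (intro finsum_cong' finsum_cartesian) (auto intro!: finsum_closed)
    also have "\<dots> = (\<Oplus>m\<in>I \<times> I \<times> I. (\<lambda>(i, j, k). \<omega> a i j k \<odot> \<one>) m \<otimes> kron A g (kron A g g) m (i, j, k))"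
      using that fin by (subst finsum_cartesian)
        (auto simp: kron_def smult_mult_left intro!: finsum_cong')
    finally show ?thesis by simp
  qed
  show ?thesis
    using True unfolding ly_matrix_def I_def[symmetric]
    by (simp add: intertwines_def mat_mult_def left 2[unfolded split_beta] 3[unfolded split_beta] split_beta)
qed (simp add: ly_matrix_def I_def)

lemma ly_matrix_mult:
  assumes "ly_matrix A n \<tau> \<omega> g" "ly_matrix A n \<tau> \<omega> h"
  shows "ly_matrix A n \<tau> \<omega> (mat_mult A {1..n} g h)"
proof -
  let ?I = "{1..n}"
  let ?gh = "mat_mult A ?I g h"
  let ?\<sigma> = "\<lambda>u (i, j). \<tau> u i j \<odot> \<one>" and ?\<rho> = "\<lambda>u (i, j, k). \<omega> u i j k \<odot> \<one>"
  have g: "mat_over A ?I ?I g" and h: "mat_over A ?I ?I h"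
    using assms by (auto simp: ly_matrix_def)
  note gh = mat_over_mult[OF g h]
  have \<sigma>: "mat_over A ?I (?I \<times> ?I) ?\<sigma>" and \<rho>: "mat_over A ?I (?I \<times> ?I \<times> ?I) ?\<rho>"
    by (auto simp: mat_over_def)
  note g2 = mat_over_kron[OF g g] and h2 = mat_over_kron[OF h h] and gh2 = mat_over_kron[OF gh gh]
  note g3 = mat_over_kron[OF g g2] and h3 = mat_over_kron[OF h h2] and gh3 = mat_over_kron[OF gh gh2]
  have k2: "kron A ?gh ?gh p q = mat_mult A (?I \<times> ?I) (kron A g g) (kron A h h) p q"
    if "p \<in> ?I \<times> ?I" "q \<in> ?I \<times> ?I" for p q
    by (rule kron_mult[OF _ _ g h g h that]) auto
  have k3: "kron A ?gh (kron A ?gh ?gh) p q =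
      mat_mult A (?I \<times> ?I \<times> ?I) (kron A g (kron A g g)) (kron A h (kron A h h)) p q"
    if "p \<in> ?I \<times> ?I \<times> ?I" "q \<in> ?I \<times> ?I \<times> ?I" for p q
  proof -
    have "kron A ?gh (kron A ?gh ?gh) p q =
        kron A ?gh (mat_mult A (?I \<times> ?I) (kron A g g) (kron A h h)) p q"
      using k2[of "snd p" "snd q"] that unfolding kron_def[of _ ?gh] by (auto simp: mem_Times_iff)
    also have "\<dots> = mat_mult A (?I \<times> ?I \<times> ?I) (kron A g (kron A g g)) (kron A h (kron A h h)) p q"
      by (rule kron_mult[OF _ _ g h g2 h2 that]) auto
    finally show ?thesis .
  qed
  have "intertwines ?I (?I \<times> ?I) ?\<sigma> ?gh (kron A ?gh ?gh)"
    by (rule intertwines_cong[THEN iffD2, OF \<sigma> gh2 k2], assumption, assumption,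
        rule intertwines_mult[OF _ _ \<sigma> g h g2 h2]) (use assms in \<open>auto simp: ly_matrix_iff\<close>)
  moreover have "intertwines ?I (?I \<times> ?I \<times> ?I) ?\<rho> ?gh (kron A ?gh (kron A ?gh ?gh))"
    by (rule intertwines_cong[THEN iffD2, OF \<rho> gh3 k3], assumption, assumption,
        rule intertwines_mult[OF _ _ \<rho> g h g3 h3]) (use assms in \<open>auto simp: ly_matrix_iff\<close>)
  ultimately show ?thesis using gh by (simp add: ly_matrix_iff)
qed

lemma ly_matrix_id: "ly_matrix A n \<tau> \<omega> (id_mat A)"
proof -
  have "kron A (id_mat A) (id_mat A) = (id_mat A :: nat \<times> nat \<Rightarrow> _)"
    "kron A (id_mat A) (id_mat A) = (id_mat A :: nat \<times> nat \<times> nat \<Rightarrow> _)"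
    by (simp_all add: fun_eq_iff kron_id)
  then show ?thesis
    unfolding ly_matrix_iff
    by (auto intro!: mat_over_id intertwines_id simp: mat_over_def[of _ _ "_ \<times> _"])
qed

end


section \<open>The universal algebra\<close>

context matrix_polys
begin

text \<open>
  The values of the relations under a homomorphism that maps the variables to the entries of a
  matrix \<open>g\<close>.
\<close>

context
  fixes B :: "('k, 'b) module" and f and g
  assumes B: "comm_alg B" and f: "algebra_hom P B f"
    and var: "\<And>s i. s \<in> {1..n} \<Longrightarrow> i \<in> {1..n} \<Longrightarrow> f (poly_var s i) = g s i"
begin

interpretation B: comm_alg B by (rule B)

text \<open>
  Stating membership and value together lets both be derived along the structure of a polynomial
  expression.
\<close>

abbreviation (input) evals_to where "evals_to p b \<equiv> p \<in> carrier P \<and> f p = b"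

lemma evals_to_var: "s \<in> {1..n} \<Longrightarrow> i \<in> {1..n} \<Longrightarrow> evals_to (poly_var s i) (g s i)"
  using var_closed var by blast

lemma evals_to_scale: "evals_to p b \<Longrightarrow> evals_to (poly_const c * p) (c \<odot>\<^bsub>B\<^esub> b)"
  unfolding scale_eq using F.scale_closed lin_map_scale[OF algebra_hom_lin[OF f]] by blast

lemma evals_to_mult: "evals_to p b \<Longrightarrow> evals_to q c \<Longrightarrow> evals_to (p * q) (b \<otimes>\<^bsub>B\<^esub> c)"
  unfolding mult_P[symmetric] using m_closed algebra_hom_mult[OF f] by blast

lemma evals_to_minus:
  assumes "evals_to p b" "evals_to q c"
  shows "evals_to (p - q) (b \<ominus>\<^bsub>B\<^esub> c)"
proof -
  have p: "p \<in> carrier P" and q: "q \<in> carrier P" and val: "f p = b" "f q = c" using assms by blast+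
  have "f (p - q) = f p \<ominus>\<^bsub>B\<^esub> f q"
    unfolding F.minus_F[OF p q, symmetric]
    by (rule lin_map_minus[OF F.vspace_axioms B.vspace_axioms algebra_hom_lin[OF f] p q])
  then show ?thesis using F.minus_in_F[OF p q] unfolding val by (rule conjI[rotated])
qed

lemma evals_to_sum:
  assumes "\<And>i. i \<in> I \<Longrightarrow> evals_to (p i) (b i)"
  shows "evals_to (sum p I) (\<Oplus>\<^bsub>B\<^esub>i\<in>I. b i)"
  using assms
proof (induction I rule: infinite_finite_induct)
  case (insert i I)
  note lin = algebra_hom_lin[OF f]
  have b: "b j \<in> carrier B" if "j \<in> insert i I" for j
    using insert.prems[OF that] lin_map_closed[OF lin, of "p j"] by metis
  have IH: "evals_to (sum p I) (\<Oplus>\<^bsub>B\<^esub>i\<in>I. b i)" "evals_to (p i) (b i)"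
    by (rule insert.IH, rule insert.prems, erule insertI2) (rule insert.prems, rule insertI1)
  have "p i + sum p I \<in> carrier P \<and> f (p i + sum p I) = b i \<oplus>\<^bsub>B\<^esub> (\<Oplus>\<^bsub>B\<^esub>i\<in>I. b i)"
    using F.M.add.m_closed[of "p i" "sum p I"] lin_map_add[OF lin, of "p i" "sum p I"] IH
    unfolding F.add_F by metis
  moreover have "(\<Oplus>\<^bsub>B\<^esub>i\<in>insert i I. b i) = b i \<oplus>\<^bsub>B\<^esub> (\<Oplus>\<^bsub>B\<^esub>i\<in>I. b i)"
    using insert.hyps b by (intro B.finsum_insert) auto
  ultimately show ?case unfolding sum.insert[OF insert.hyps] by metis
qed (use lin_map_zero[OF F.vspace_axioms B.vspace_axioms algebra_hom_lin[OF f]] in auto)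

lemmas evals_to_intros = evals_to_minus evals_to_sum evals_to_scale evals_to_mult evals_to_var

lemma mat_over_hom: "mat_over B {1..n} {1..n} g"
  unfolding mat_over_def using var_closed lin_map_closed[OF algebra_hom_lin[OF f]] var by metis

lemma evals_br_relation:
  assumes "a \<in> {1..n}" "i \<in> {1..n}" "j \<in> {1..n}"
  shows "evals_to (br_relation n \<tau> a i j)
    ((\<Oplus>\<^bsub>B\<^esub>u\<in>{1..n}. \<tau> u i j \<odot>\<^bsub>B\<^esub> g a u) \<ominus>\<^bsub>B\<^esub>
     (\<Oplus>\<^bsub>B\<^esub>s\<in>{1..n}. \<Oplus>\<^bsub>B\<^esub>t\<in>{1..n}. \<tau> a s t \<odot>\<^bsub>B\<^esub> (g s i \<otimes>\<^bsub>B\<^esub> g t j)))"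
  unfolding br_relation_def mult.assoc by (intro evals_to_intros assms)

lemma evals_tri_relation:
  assumes "a \<in> {1..n}" "i \<in> {1..n}" "j \<in> {1..n}" "k \<in> {1..n}"
  shows "evals_to (tri_relation n \<omega> a i j k)
    ((\<Oplus>\<^bsub>B\<^esub>u\<in>{1..n}. \<omega> u i j k \<odot>\<^bsub>B\<^esub> g a u) \<ominus>\<^bsub>B\<^esub>
     (\<Oplus>\<^bsub>B\<^esub>r\<in>{1..n}. \<Oplus>\<^bsub>B\<^esub>s\<in>{1..n}. \<Oplus>\<^bsub>B\<^esub>t\<in>{1..n}. \<omega> a r s t \<odot>\<^bsub>B\<^esub>
        (g r i \<otimes>\<^bsub>B\<^esub> (g s j \<otimes>\<^bsub>B\<^esub> g t k))))"
  unfolding tri_relation_def mult.assoc by (intro evals_to_intros assms)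

lemma ly_matrix_hom_iff:
  "ly_matrix B n \<tau> \<omega> g \<longleftrightarrow>
     (\<forall>a\<in>{1..n}. \<forall>i\<in>{1..n}. \<forall>j\<in>{1..n}. f (br_relation n \<tau> a i j) = \<zero>\<^bsub>B\<^esub>) \<and>
     (\<forall>a\<in>{1..n}. \<forall>i\<in>{1..n}. \<forall>j\<in>{1..n}. \<forall>k\<in>{1..n}. f (tri_relation n \<omega> a i j k) = \<zero>\<^bsub>B\<^esub>)"
proof -
  note g = mat_overD[OF mat_over_hom]
  have "f (br_relation n \<tau> a i j) = \<zero>\<^bsub>B\<^esub> \<longleftrightarrow>
      (\<Oplus>\<^bsub>B\<^esub>u\<in>{1..n}. \<tau> u i j \<odot>\<^bsub>B\<^esub> g a u) =
      (\<Oplus>\<^bsub>B\<^esub>s\<in>{1..n}. \<Oplus>\<^bsub>B\<^esub>t\<in>{1..n}. \<tau> a s t \<odot>\<^bsub>B\<^esub> (g s i \<otimes>\<^bsub>B\<^esub> g t j))"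
    if "a \<in> {1..n}" "i \<in> {1..n}" "j \<in> {1..n}" for a i j
    unfolding evals_br_relation[OF that, THEN conjunct2]
    using that g by (intro B.minus_eq_zero_iff) (auto intro!: B.finsum_closed)
  moreover have "f (tri_relation n \<omega> a i j k) = \<zero>\<^bsub>B\<^esub> \<longleftrightarrow>
      (\<Oplus>\<^bsub>B\<^esub>u\<in>{1..n}. \<omega> u i j k \<odot>\<^bsub>B\<^esub> g a u) =
      (\<Oplus>\<^bsub>B\<^esub>r\<in>{1..n}. \<Oplus>\<^bsub>B\<^esub>s\<in>{1..n}. \<Oplus>\<^bsub>B\<^esub>t\<in>{1..n}. \<omega> a r s t \<odot>\<^bsub>B\<^esub>
        (g r i \<otimes>\<^bsub>B\<^esub> (g s j \<otimes>\<^bsub>B\<^esub> g t k)))"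
    if "a \<in> {1..n}" "i \<in> {1..n}" "j \<in> {1..n}" "k \<in> {1..n}" for a i j k
    unfolding evals_tri_relation[OF that, THEN conjunct2]
    using that g by (intro B.minus_eq_zero_iff) (auto intro!: B.finsum_closed)
  ultimately show ?thesis
    unfolding ly_matrix_def using mat_over_hom by simp
qed

end

end

text \<open>
  The universal algebra for arbitrary coefficients \<open>\<tau>\<close> and \<open>\<omega>\<close>, as the quotient \<open>I.Q\<close> of the
  polynomial algebra.
\<close>

locale universal_alg = matrix_polys n P for n :: nat and P :: "('k::field, 'k matrix_poly) module" +
  fixes \<tau> :: "nat \<Rightarrow> nat \<Rightarrow> nat \<Rightarrow> 'k" and \<omega> :: "nat \<Rightarrow> nat \<Rightarrow> nat \<Rightarrow> nat \<Rightarrow> 'k"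
begin

abbreviation (input) J where "J \<equiv> universal_ideal n \<tau> \<omega>"
abbreviation (input) A where "A \<equiv> universal_algebra n \<tau> \<omega>"
abbreviation (input) x where "x \<equiv> universal_gen n \<tau> \<omega>"

text \<open>The polynomials that generate the ideal.\<close>

definition relations :: "'k matrix_poly set" where
  "relations = {br_relation n \<tau> a i j | a i j. a \<in> {1..n} \<and> i \<in> {1..n} \<and> j \<in> {1..n}} \<union>
      {tri_relation n \<omega> a i j k | a i j k.
         a \<in> {1..n} \<and> i \<in> {1..n} \<and> j \<in> {1..n} \<and> k \<in> {1..n}}"

lemma J_eq: "J = Idl\<^bsub>P\<^esub> relations"
  by (simp add: universal_ideal_def relations_def P_def)

lemma relations_subset: "relations \<subseteq> carrier P"
  using evals_br_relation[OF comm_alg_axioms algebra_hom_id(2) refl, THEN conjunct1]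
    evals_tri_relation[OF comm_alg_axioms algebra_hom_id(2) refl, THEN conjunct1]
  unfolding relations_def by blast

lemma ideal_J: "ideal J P"
  unfolding J_eq by (rule genideal_ideal[OF relations_subset])

sublocale I: algebra_ideal P J
proof -
  interpret ideal J P by (rule ideal_J)
  show "algebra_ideal P J"
  proof unfold_locales
    show "J \<subseteq> carrier P" by (rule a_subset)
    show "c \<odot>\<^bsub>P\<^esub> p \<in> J" if "p \<in> J" for p c
    proof -
      have "poly_const c \<in> carrier P" by (simp add: poly_const_def)
      then have "poly_const c \<otimes>\<^bsub>P\<^esub> p \<in> J" using that by (rule I_l_closed[rotated])
      then show ?thesis by (simp only: mult_P scale_eq)
    qed
  qed (simp_all only: additive_subgroup.zero_closed is_additive_subgroup a_closed I_r_closed)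
qed

lemma A_eq: "A = I.Q"
  by (simp add: universal_algebra_def P_def)

lemma x_eq: "x s i = J +>\<^bsub>P\<^esub> poly_var s i"
  by (simp add: universal_gen_def P_def)

lemma comm_alg_A: "comm_alg A"
  unfolding A_eq by (rule I.comm_alg_quot)

lemma hom_coset: "algebra_hom P A (\<lambda>p. J +>\<^bsub>P\<^esub> p)"
  unfolding A_eq by (rule I.algebra_hom_coset)

lemma x_closed: "s \<in> {1..n} \<Longrightarrow> i \<in> {1..n} \<Longrightarrow> x s i \<in> carrier A"
  unfolding x_eq by (rule lin_map_closed[OF algebra_hom_lin[OF hom_coset] var_closed])

lemma hom_eq_on_gens:
  assumes "assoc_algebra B" "algebra_hom A B f" "algebra_hom A B g"
    and "\<And>s i. s \<in> {1..n} \<Longrightarrow> i \<in> {1..n} \<Longrightarrow> f (x s i) = g (x s i)" and c: "c \<in> carrier A"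
  shows "f c = g c"
proof -
  obtain p where p: "p \<in> carrier P" "c = J +>\<^bsub>P\<^esub> p" using c unfolding A_eq I.carrier_quot by blast
  show ?thesis
    unfolding p(2)
    by (rule algebra_hom_eq_on_vars[OF assms(1) algebra_hom_comp[OF hom_coset assms(2)]
          algebra_hom_comp[OF hom_coset assms(3)] _ p(1)])
      (use assms(4) in \<open>simp add: x_eq\<close>)
qed

lemma ly_matrix_gens:
  assumes "comm_alg B" "algebra_hom A B f"
  shows "ly_matrix B n \<tau> \<omega> (\<lambda>s i. f (x s i))"
proof -
  interpret B: comm_alg B by fact
  interpret A: comm_alg A by (rule comm_alg_A)
  have zero: "f (J +>\<^bsub>P\<^esub> r) = \<zero>\<^bsub>B\<^esub>" if "r \<in> relations" for r
  proof -
    have r: "r \<in> J" "r \<in> carrier P" using that genideal_self[OF relations_subset] relations_subset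
      unfolding J_eq by auto
    have "r \<ominus>\<^bsub>P\<^esub> \<zero>\<^bsub>P\<^esub> = r" using F.minus_F[OF r(2) F.M.zero_closed] by simp
    then have "J +>\<^bsub>P\<^esub> r = \<zero>\<^bsub>A\<^esub>"
      unfolding A_eq I.zero_quot I.coset_eq_iff[OF r(2) F.M.zero_closed] using r(1) by (simp only:)
    then show ?thesis
      using lin_map_zero[OF A.vspace_axioms B.vspace_axioms algebra_hom_lin[OF assms(2)]] by simp
  qed
  note hom = algebra_hom_comp[OF hom_coset assms(2)]
  have br: "br_relation n \<tau> a i j \<in> relations"
    if "a \<in> {1..n}" "i \<in> {1..n}" "j \<in> {1..n}" for a i j
    using that unfolding relations_def by blast
  have tri: "tri_relation n \<omega> a i j k \<in> relations"
    if "a \<in> {1..n}" "i \<in> {1..n}" "j \<in> {1..n}" "k \<in> {1..n}" for a i j k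
    using that unfolding relations_def by blast
  show ?thesis
  proof (rule ly_matrix_hom_iff[OF assms(1) hom, THEN iffD2])
    show "f (J +>\<^bsub>P\<^esub> poly_var s i) = f (x s i)" for s i by (simp only: x_eq)
  qed (intro conjI ballI zero br tri; assumption)
qed

text \<open>
  Together with the preceding two lemmas, this states that \<open>A\<close> represents the functor that maps a
  commutative algebra \<open>B\<close> to the set of matrices \<open>g\<close> with \<open>ly_matrix B n \<tau> \<omega> g\<close>.
\<close>

lemma ex_hom:
  assumes "comm_alg B" "ly_matrix B n \<tau> \<omega> g"
  shows "\<exists>f. algebra_hom A B f \<and> (\<forall>s\<in>{1..n}. \<forall>i\<in>{1..n}. f (x s i) = g s i)"
proof -
  interpret B: comm_alg B by fact
  have g: "mat_over B {1..n} {1..n} g" using assms(2) by (simp add: ly_matrix_def)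
  obtain F where F: "algebra_hom P B F" "\<And>s i. s \<in> {1..n} \<Longrightarrow> i \<in> {1..n} \<Longrightarrow> F (poly_var s i) = g s i"
    using ex_eval_hom[OF assms(1), of g] mat_overD[OF g] by blast
  have "F r = \<zero>\<^bsub>B\<^esub>" if "r \<in> relations" for r
    using that ly_matrix_hom_iff[OF assms(1) F, THEN iffD1, OF _ _ assms(2)] unfolding relations_def by blast
  moreover have "ring_hom_ring P B F"
    using F(1) by (intro ring_hom_ringI2 ring_axioms B.ring_axioms) (simp add: algebra_hom_def)
  then have "ideal (a_kernel P B F) P" by (rule ring_hom_ring.kernel_is_ideal)
  ultimately have "J \<subseteq> a_kernel P B F"
    unfolding J_eq using relations_subset by (intro genideal_minimal) (auto simp: a_kernel_def')
  then have ker: "F p = \<zero>\<^bsub>B\<^esub>" if "p \<in> J" for p using that by (auto simp: a_kernel_def')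
  let ?f = "\<lambda>X. F (SOME p. p \<in> X)"
  have "algebra_hom A B ?f"
    unfolding A_eq by (rule I.algebra_hom_quot_ext[OF B.assoc_algebra_axioms F(1) ker])
  moreover have "?f (x s i) = g s i" if "s \<in> {1..n}" "i \<in> {1..n}" for s i
    unfolding x_eq F(2)[OF that, symmetric]
    by (rule I.lin_map_quot_ext(1)[OF B.vspace_axioms algebra_hom_lin[OF F(1)] ker var_closed[OF that]])
  ultimately show ?thesis by blast
qed

end


section \<open>Bases\<close>

context
  fixes V :: "('k::field, 'v) module" and I :: "'i set" and e :: "'i \<Rightarrow> 'v"
  assumes V: "vspace V" and basis: "is_basis V I e"
begin

interpretation V: vspace V by (rule V)

lemma basis_finite: "finite I" and basis_closed: "i \<in> I \<Longrightarrow> e i \<in> carrier V"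
  using basis by (auto simp: is_basis_def)

lemma basis_unique:
  assumes "(\<Oplus>\<^bsub>V\<^esub>i\<in>I. c i \<odot>\<^bsub>V\<^esub> e i) = (\<Oplus>\<^bsub>V\<^esub>i\<in>I. d i \<odot>\<^bsub>V\<^esub> e i)" "i \<in> I"
  shows "c i = d i"
proof -
  let ?S = "\<lambda>c. \<Oplus>\<^bsub>V\<^esub>i\<in>I. c i \<odot>\<^bsub>V\<^esub> e i"
  have closed: "?S c \<in> carrier V" for c by (auto intro!: V.M.finsum_closed basis_closed)
  have "(\<Oplus>\<^bsub>V\<^esub>i\<in>I. (c i - d i) \<odot>\<^bsub>V\<^esub> e i \<oplus>\<^bsub>V\<^esub> d i \<odot>\<^bsub>V\<^esub> e i) = ?S (\<lambda>i. c i - d i) \<oplus>\<^bsub>V\<^esub> ?S d"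
    by (rule V.M.finsum_addf) (auto intro: basis_closed)
  moreover have "(\<Oplus>\<^bsub>V\<^esub>i\<in>I. (c i - d i) \<odot>\<^bsub>V\<^esub> e i \<oplus>\<^bsub>V\<^esub> d i \<odot>\<^bsub>V\<^esub> e i) = ?S c"
    by (rule V.M.finsum_cong') (auto intro: basis_closed simp: basis_closed simp flip: V.scale_add_left)
  ultimately have "?S (\<lambda>i. c i - d i) \<oplus>\<^bsub>V\<^esub> ?S d = \<zero>\<^bsub>V\<^esub> \<oplus>\<^bsub>V\<^esub> ?S d"
    using assms(1) closed[of d] by simp
  then have "?S (\<lambda>i. c i - d i) = \<zero>\<^bsub>V\<^esub>"
    unfolding V.M.add.right_cancel[OF closed closed V.M.zero_closed] .
  then have "\<forall>i\<in>I. c i - d i = 0"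
    using basis[unfolded is_basis_def, THEN conjunct2, THEN conjunct2, THEN conjunct1,
        THEN spec[of _ "\<lambda>i. c i - d i"]] by (rule rev_mp)
  then have "c i - d i = 0" using assms(2) by blast
  then show ?thesis by simp
qed

lemma lin_map_eq_on_basis:
  assumes "vspace W" "lin_map V W f" "lin_map V W g" "\<And>i. i \<in> I \<Longrightarrow> f (e i) = g (e i)" "v \<in> carrier V"
  shows "f v = g v"
proof -
  interpret W: vspace W by fact
  obtain c where v: "v = (\<Oplus>\<^bsub>V\<^esub>i\<in>I. c i \<odot>\<^bsub>V\<^esub> e i)"
    using basis assms(5) unfolding is_basis_def by blast
  have "f v = (\<Oplus>\<^bsub>W\<^esub>i\<in>I. f (c i \<odot>\<^bsub>V\<^esub> e i))" unfolding v
    by (rule lin_map_finsum[OF V assms(1,2)]) (auto intro: basis_closed)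
  also have "\<dots> = (\<Oplus>\<^bsub>W\<^esub>i\<in>I. g (c i \<odot>\<^bsub>V\<^esub> e i))"
    by (rule W.M.finsum_cong')
      (auto simp: basis_closed lin_map_scale[OF assms(2)] lin_map_scale[OF assms(3)] assms(4)
        intro!: lin_map_closed[OF assms(3)])
  also have "\<dots> = g v" unfolding v
    by (rule lin_map_finsum[OF V assms(1,3), symmetric]) (auto intro: basis_closed)
  finally show ?thesis .
qed

text \<open>The coordinate functionals of the basis.\<close>

lemma ex_coordinates:
  "\<exists>\<chi>. \<forall>s\<in>I. lin_map V ground (\<chi> s) \<and> (\<forall>t\<in>I. \<chi> s (e t) = (if t = s then 1 else 0))"
proof -
  let ?S = "\<lambda>c. \<Oplus>\<^bsub>V\<^esub>i\<in>I. c i \<odot>\<^bsub>V\<^esub> e i"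
  define rep where "rep v = (SOME c. v = ?S c)" for v
  have rep: "v = ?S (rep v)" if "v \<in> carrier V" for v
    using someI_ex[of "\<lambda>c. v = ?S c"] basis that unfolding rep_def is_basis_def by blast
  have rep_eq: "rep v s = c s" if "v \<in> carrier V" "v = ?S c" "s \<in> I" for v c s
    by (rule basis_unique[OF _ that(3)]) (use rep[OF that(1)] that(2) in simp)
  have "lin_map V ground (\<lambda>v. rep v s)" if s: "s \<in> I" for s
  proof (rule lin_mapI)
    fix v w assume v: "v \<in> carrier V" and w: "w \<in> carrier V"
    have "?S (\<lambda>i. rep v i + rep w i) = (\<Oplus>\<^bsub>V\<^esub>i\<in>I. rep v i \<odot>\<^bsub>V\<^esub> e i \<oplus>\<^bsub>V\<^esub> rep w i \<odot>\<^bsub>V\<^esub> e i)"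
      by (rule V.M.finsum_cong') (auto simp: V.scale_add_left basis_closed)
    also have "\<dots> = ?S (rep v) \<oplus>\<^bsub>V\<^esub> ?S (rep w)"
      by (rule V.M.finsum_addf) (auto intro: basis_closed)
    finally have eq: "v \<oplus>\<^bsub>V\<^esub> w = ?S (\<lambda>i. rep v i + rep w i)"
      by (simp only: rep[OF v, symmetric] rep[OF w, symmetric])
    show "rep (v \<oplus>\<^bsub>V\<^esub> w) s = rep v s \<oplus>\<^bsub>ground\<^esub> rep w s"
      unfolding rep_eq[OF V.M.add.m_closed[OF v w] eq s] by simp
  next
    fix c v assume v: "v \<in> carrier V"
    have "c \<odot>\<^bsub>V\<^esub> ?S (rep v) = (\<Oplus>\<^bsub>V\<^esub>i\<in>I. c \<odot>\<^bsub>V\<^esub> (rep v i \<odot>\<^bsub>V\<^esub> e i))"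
      by (rule V.finsum_scale) (auto intro: basis_closed)
    also have "\<dots> = ?S (\<lambda>i. c * rep v i)"
      by (rule V.M.finsum_cong') (auto simp: V.scale_scale basis_closed)
    finally have eq: "c \<odot>\<^bsub>V\<^esub> v = ?S (\<lambda>i. c * rep v i)" by (simp only: rep[OF v, symmetric])
    show "rep (c \<odot>\<^bsub>V\<^esub> v) s = c \<odot>\<^bsub>ground\<^esub> rep v s"
      unfolding rep_eq[OF V.scale_closed[OF v] eq s] by simp
  qed simp
  moreover have "rep (e t) s = (if t = s then 1 else 0)" if "s \<in> I" "t \<in> I" for s t
  proof -
    have "e t = ?S (\<lambda>i. if i = t then 1 else 0)"
      by (rule V.finsum_delta[symmetric]) (use that basis_finite in \<open>auto intro: basis_closed\<close>)
    then have "rep (e t) s = (if s = t then 1 else 0)"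
      by (rule rep_eq[OF basis_closed[OF that(2)] _ that(1)])
    then show ?thesis by auto
  qed
  ultimately show ?thesis by (intro exI[of _ "\<lambda>s v. rep v s"]) blast
qed

text \<open>
  The coefficient of \<open>e s\<close> is recovered by the map \<open>V \<otimes> W \<rightarrow> W\<close> that is induced by the coordinate
  functional at \<open>s\<close>.
\<close>

lemma tensor_basis_unique:
  assumes W: "vspace W" and a: "a \<in> I \<rightarrow> carrier W" and b: "b \<in> I \<rightarrow> carrier W"
    and eq: "(\<Oplus>\<^bsub>tensor V W\<^esub>s\<in>I. pure_tensor V W (e s) (a s)) =
      (\<Oplus>\<^bsub>tensor V W\<^esub>s\<in>I. pure_tensor V W (e s) (b s))"
    and s: "s \<in> I"
  shows "a s = b s"
proof -
  interpret W: vspace W by (rule W)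
  interpret T: tensor_spaces V W ..
  obtain \<chi> where \<chi>: "lin_map V ground \<chi>" "\<And>t. t \<in> I \<Longrightarrow> \<chi> (e t) = (if t = s then 1 else 0)"
    using ex_coordinates s by blast
  define F where "F = tensor_lift W (\<lambda>v w. \<chi> v \<odot>\<^bsub>W\<^esub> w)"
  note \<beta> = bilin_comp[OF bilin_scale[OF W] \<chi>(1) lin_map_id(2)]
  note lin = T.lin_map_tensor_lift[OF W \<beta>] and lift = T.tensor_lift_pure[OF W \<beta>]
  have "F (\<Oplus>\<^bsub>tensor V W\<^esub>s\<in>I. pure_tensor V W (e s) (a s)) = a s" if "a \<in> I \<rightarrow> carrier W" for a
  proof -
    have "F (\<Oplus>\<^bsub>tensor V W\<^esub>s\<in>I. pure_tensor V W (e s) (a s)) = (\<Oplus>\<^bsub>W\<^esub>t\<in>I. F (pure_tensor V W (e t) (a t)))"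
      unfolding F_def using that basis_closed
      by (intro lin_map_finsum[OF T.vspace_tensor W lin]) (auto intro!: T.pure_tensor_closed)
    also have "\<dots> = (\<Oplus>\<^bsub>W\<^esub>t\<in>I. (if t = s then 1 else 0) \<odot>\<^bsub>W\<^esub> a t)"
      unfolding F_def using that basis_closed
      by (intro W.M.finsum_cong') (auto simp: lift \<chi>(2) Pi_iff)
    also have "\<dots> = a s" by (rule W.finsum_delta[OF basis_finite s that])
    finally show ?thesis .
  qed
  from this[OF a] this[OF b] eq show ?thesis by simp
qed

end


section \<open>Coactions given by a matrix\<close>

text \<open>
  A linear map \<open>f : M \<rightarrow> M \<otimes> C\<close> with \<open>f (m\<^sub>j) = \<Sum>\<^sub>s m\<^sub>s \<otimes> x\<^sub>s\<^sub>j\<close>. The elements \<open>m\<^sub>j\<close> need be neither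
  independent nor spanning: they are the basis of \<open>L\<close> in one application, and a row of the matrix
  of generators of \<open>A\<close> in the other.
\<close>

context
  fixes M :: "('k::field, 'm) module" and C :: "('k, 'c) module"
    and I :: "'i set" and m :: "'i \<Rightarrow> 'm" and x :: "'i \<Rightarrow> 'i \<Rightarrow> 'c" and f
  assumes M: "vspace M" and C: "vspace C" and fin: "finite I"
    and m: "\<And>i. i \<in> I \<Longrightarrow> m i \<in> carrier M"
    and x: "\<And>i j. i \<in> I \<Longrightarrow> j \<in> I \<Longrightarrow> x i j \<in> carrier C"
    and f: "lin_map M (tensor M C) f"
    and f_m: "\<And>j. j \<in> I \<Longrightarrow> f (m j) = (\<Oplus>\<^bsub>tensor M C\<^esub>s\<in>I. pure_tensor M C (m s) (x s j))"
begin

interpretation M: vspace M by (rule M)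
interpretation C: vspace C by (rule C)
interpretation T: tensor_triple M C C ..

lemma map_right_coaction:
  assumes D: "vspace D" and g: "lin_map C D g" and j: "j \<in> I"
  shows "tensor_map M D id g (f (m j)) = (\<Oplus>\<^bsub>tensor M D\<^esub>s\<in>I. pure_tensor M D (m s) (g (x s j)))"
proof -
  interpret D: vspace D by (rule D)
  interpret TD: tensor_spaces M D ..
  interpret X: vspace "tensor M D" by (rule TD.vspace_tensor)
  note map = tensor_map_facts[OF M C M D lin_map_id(1) g]
  have "tensor_map M D id g (f (m j)) = (\<Oplus>\<^bsub>tensor M D\<^esub>s\<in>I. tensor_map M D id g (pure_tensor M C (m s) (x s j)))"
    unfolding f_m[OF j]
    by (rule lin_map_finsum[OF T.UV.vspace_tensor TD.vspace_tensor map(1)])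
      (auto intro!: T.UV.pure_tensor_closed m x j)
  also have "\<dots> = (\<Oplus>\<^bsub>tensor M D\<^esub>s\<in>I. pure_tensor M D (m s) (g (x s j)))"
    by (rule X.M.finsum_cong')
      (auto simp: map(2) m x j intro!: TD.pure_tensor_closed lin_map_closed[OF g])
  finally show ?thesis .
qed

text \<open>
  This side of coassociativity involves \<open>f\<close> only, so that the other side determines the
  comultiplication.
\<close>

lemma map_left_coaction:
  assumes j: "j \<in> I"
  shows "tensor_assoc M C C (tensor_map (tensor M C) C f id (f (m j))) =
    (\<Oplus>\<^bsub>tensor M (tensor C C)\<^esub>s\<in>I. pure_tensor M (tensor C C) (m s)
       (\<Oplus>\<^bsub>tensor C C\<^esub>t\<in>I. pure_tensor C C (x s t) (x t j)))"
proof -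
  let ?X = "tensor M (tensor C C)"
  interpret X: vspace ?X by (rule T.U_VW.vspace_tensor)
  note map = tensor_map_facts[OF M C T.UV.vspace_tensor C f lin_map_id(1)]
  let ?F = "\<lambda>z. tensor_assoc M C C (tensor_map (tensor M C) C f id z)"
  have F: "lin_map (tensor M C) ?X ?F"
    by (rule lin_map_comp[OF map(1) T.lin_map_tensor_assoc])
  have FP: "?F (pure_tensor M C (m t) (x t j)) =
      (\<Oplus>\<^bsub>?X\<^esub>s\<in>I. pure_tensor M (tensor C C) (m s) (pure_tensor C C (x s t) (x t j)))"
    if t: "t \<in> I" for t
  proof -
    have lin: "lin_map (tensor M C) ?X (\<lambda>z. tensor_assoc M C C (pure_tensor (tensor M C) C z (x t j)))"
      by (rule lin_map_comp[OF bilin_left[OF T.UV_W.bilin_pure_tensor x[OF t j]] T.lin_map_tensor_assoc])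
    have "?F (pure_tensor M C (m t) (x t j)) =
        tensor_assoc M C C (pure_tensor (tensor M C) C
            (\<Oplus>\<^bsub>tensor M C\<^esub>s\<in>I. pure_tensor M C (m s) (x s t)) (x t j))"
      using map(2)[OF m[OF t] x[OF t j]] f_m[OF t] by simp
    also have "\<dots> = (\<Oplus>\<^bsub>?X\<^esub>s\<in>I.
        tensor_assoc M C C (pure_tensor (tensor M C) C (pure_tensor M C (m s) (x s t)) (x t j)))"
      by (rule lin_map_finsum[OF T.UV.vspace_tensor X.vspace_axioms lin])
        (auto intro!: T.UV.pure_tensor_closed m x t)
    also have "\<dots> = (\<Oplus>\<^bsub>?X\<^esub>s\<in>I. pure_tensor M (tensor C C) (m s) (pure_tensor C C (x s t) (x t j)))"
      by (rule X.M.finsum_cong')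
        (auto simp: T.tensor_assoc_pure m x t j intro!: T.U_VW.pure_tensor_closed T.VW.pure_tensor_closed)
    finally show ?thesis .
  qed
  have closed: "pure_tensor M (tensor C C) (m s) (pure_tensor C C (x s t) (x t j)) \<in> carrier ?X"
    if "s \<in> I" "t \<in> I" for s t
    using that j by (intro T.U_VW.pure_tensor_closed T.VW.pure_tensor_closed m x)
  have "?F (f (m j)) = (\<Oplus>\<^bsub>?X\<^esub>t\<in>I. ?F (pure_tensor M C (m t) (x t j)))"
    unfolding f_m[OF j]
    by (rule lin_map_finsum[OF T.UV.vspace_tensor X.vspace_axioms F])
      (auto intro!: T.UV.pure_tensor_closed m x j)
  also have "\<dots> = (\<Oplus>\<^bsub>?X\<^esub>t\<in>I. \<Oplus>\<^bsub>?X\<^esub>s\<in>I. pure_tensor M (tensor C C) (m s) (pure_tensor C C (x s t) (x t j)))"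
    by (rule X.M.finsum_cong') (auto simp: FP intro!: X.M.finsum_closed closed)
  also have "\<dots> = (\<Oplus>\<^bsub>?X\<^esub>s\<in>I. \<Oplus>\<^bsub>?X\<^esub>t\<in>I. pure_tensor M (tensor C C) (m s) (pure_tensor C C (x s t) (x t j)))"
    by (rule X.finsum_swap[OF fin fin closed])
  also have "\<dots> = (\<Oplus>\<^bsub>?X\<^esub>s\<in>I. pure_tensor M (tensor C C) (m s)
       (\<Oplus>\<^bsub>tensor C C\<^esub>t\<in>I. pure_tensor C C (x s t) (x t j)))"
  proof (rule X.M.finsum_cong'[OF refl])
    have cc: "(\<lambda>t. pure_tensor C C (x s t) (x t j)) \<in> I \<rightarrow> carrier (tensor C C)" if "s \<in> I" for s
      using that j by (auto intro!: T.VW.pure_tensor_closed x)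
    then show "(\<lambda>s. pure_tensor M (tensor C C) (m s)
        (\<Oplus>\<^bsub>tensor C C\<^esub>t\<in>I. pure_tensor C C (x s t) (x t j))) \<in> I \<rightarrow> carrier ?X"
      by (auto intro!: T.U_VW.pure_tensor_closed T.U_VW.W.M.finsum_closed m simp: Pi_iff)
    show "(\<Oplus>\<^bsub>?X\<^esub>t\<in>I. pure_tensor M (tensor C C) (m s) (pure_tensor C C (x s t) (x t j))) =
        pure_tensor M (tensor C C) (m s) (\<Oplus>\<^bsub>tensor C C\<^esub>t\<in>I. pure_tensor C C (x s t) (x t j))"
      if "s \<in> I" for s
      by (rule lin_map_finsum[OF T.VW.vspace_tensor X.vspace_axioms
            bilin_right[OF T.U_VW.bilin_pure_tensor m[OF that]] cc[OF that], symmetric])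
  qed
  finally show ?thesis .
qed

lemma counit_coaction:
  assumes \<epsilon>: "lin_map C ground \<epsilon>" and j: "j \<in> I"
  shows "tensor_unit_right M (tensor_map M ground id \<epsilon> (f (m j))) = (\<Oplus>\<^bsub>M\<^esub>s\<in>I. \<epsilon> (x s j) \<odot>\<^bsub>M\<^esub> m s)"
proof -
  interpret TG: tensor_spaces M ground using M vspace_ground by (simp add: tensor_spaces_def)
  note unit = tensor_unit_right_facts[OF M]
  have "tensor_unit_right M (tensor_map M ground id \<epsilon> (f (m j))) =
      (\<Oplus>\<^bsub>M\<^esub>s\<in>I. tensor_unit_right M (pure_tensor M ground (m s) (\<epsilon> (x s j))))"
    unfolding map_right_coaction[OF vspace_ground \<epsilon> j]
    by (rule lin_map_finsum[OF TG.vspace_tensor M unit(1)]) (auto intro!: TG.pure_tensor_closed m)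
  also have "\<dots> = (\<Oplus>\<^bsub>M\<^esub>s\<in>I. \<epsilon> (x s j) \<odot>\<^bsub>M\<^esub> m s)"
    by (rule M.M.finsum_cong') (auto simp: unit(2) m)
  finally show ?thesis .
qed

lemma coassoc_coaction:
  assumes "lin_map C (tensor C C) \<Delta>"
    and "\<And>s j. s \<in> I \<Longrightarrow> j \<in> I \<Longrightarrow> \<Delta> (x s j) = (\<Oplus>\<^bsub>tensor C C\<^esub>t\<in>I. pure_tensor C C (x s t) (x t j))"
    and j: "j \<in> I"
  shows "tensor_map M (tensor C C) id \<Delta> (f (m j)) =
    tensor_assoc M C C (tensor_map (tensor M C) C f id (f (m j)))"
proof -
  interpret X: vspace "tensor M (tensor C C)" by (rule T.U_VW.vspace_tensor)
  show ?thesis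
    unfolding map_left_coaction[OF j] map_right_coaction[OF T.VW.vspace_tensor assms(1) j]
    by (rule X.M.finsum_cong')
      (auto simp: assms(2) j intro!: T.U_VW.pure_tensor_closed T.VW.pure_tensor_closed
          T.U_VW.W.M.finsum_closed m x)
qed

lemma counit_coaction_delta:
  assumes "lin_map C ground \<epsilon>"
    and "\<And>s j. s \<in> I \<Longrightarrow> j \<in> I \<Longrightarrow> \<epsilon> (x s j) = (if s = j then 1 else 0)" and j: "j \<in> I"
  shows "tensor_unit_right M (tensor_map M ground id \<epsilon> (f (m j))) = m j"
proof -
  have "(\<Oplus>\<^bsub>M\<^esub>s\<in>I. \<epsilon> (x s j) \<odot>\<^bsub>M\<^esub> m s) = (\<Oplus>\<^bsub>M\<^esub>s\<in>I. (if s = j then 1 else 0) \<odot>\<^bsub>M\<^esub> m s)"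
    by (rule M.M.finsum_cong') (auto simp: assms(2) j m)
  then show ?thesis
    unfolding counit_coaction[OF assms(1) j] using M.finsum_delta[OF fin j, of m] m by simp
qed

end


section \<open>The bialgebra structure\<close>

context universal_alg
begin

interpretation A: comm_alg A by (rule comm_alg_A)
interpretation AA: tensor_algebras A A ..
interpretation T: comm_alg "tensor A A" by (rule AA.comm_alg_tensor)
interpretation A_AA: tensor_algebras A "tensor A A" ..

lemma ex_comult:
  "\<exists>\<Delta>. algebra_hom A (tensor A A) \<Delta> \<and> (\<forall>i\<in>{1..n}. \<forall>j\<in>{1..n}.
     \<Delta> (x i j) = (\<Oplus>\<^bsub>tensor A A\<^esub>s\<in>{1..n}. pure_tensor A A (x i s) (x s j)))"
proof -
  have left: "algebra_hom A (tensor A A) (\<lambda>a. pure_tensor A A a \<one>\<^bsub>A\<^esub>)"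
    by (rule algebra_homI[OF bilin_left[OF AA.bilin_pure_tensor A.one_closed]])
      (simp_all add: AA.pure_tensor_mult AA.pure_tensor_one)
  have right: "algebra_hom A (tensor A A) (\<lambda>a. pure_tensor A A \<one>\<^bsub>A\<^esub> a)"
    by (rule algebra_homI[OF bilin_right[OF AA.bilin_pure_tensor A.one_closed]])
      (simp_all add: AA.pure_tensor_mult AA.pure_tensor_one)
  \<comment> \<open>The two images of the generic matrix in \<open>A \<otimes> A\<close>; their product has the required entries.\<close>
  define g h where "g s i = pure_tensor A A (x s i) \<one>\<^bsub>A\<^esub>" and "h s i = pure_tensor A A \<one>\<^bsub>A\<^esub> (x s i)" for s i
  have gh: "ly_matrix (tensor A A) n \<tau> \<omega> (mat_mult (tensor A A) {1..n} g h)"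
    using ly_matrix_gens[OF T.comm_alg_axioms left] ly_matrix_gens[OF T.comm_alg_axioms right]
    unfolding g_def h_def by (rule T.ly_matrix_mult)
  have eq: "mat_mult (tensor A A) {1..n} g h i j =
      (\<Oplus>\<^bsub>tensor A A\<^esub>s\<in>{1..n}. pure_tensor A A (x i s) (x s j))"
    if "i \<in> {1..n}" "j \<in> {1..n}" for i j
    unfolding mat_mult_def g_def h_def
    by (rule T.finsum_cong'[OF refl])
      (use that x_closed in \<open>auto simp: AA.pure_tensor_mult intro!: AA.pure_tensor_closed\<close>)
  from ex_hom[OF T.comm_alg_axioms gh] obtain f where "algebra_hom A (tensor A A) f"
    "\<forall>i\<in>{1..n}. \<forall>j\<in>{1..n}. f (x i j) = mat_mult (tensor A A) {1..n} g h i j" by blast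
  then show ?thesis by (intro exI[of _ f] conjI ballI) (simp_all only: eq)
qed

lemma ex_counit:
  "\<exists>\<epsilon>. algebra_hom A ground \<epsilon> \<and> (\<forall>i\<in>{1..n}. \<forall>j\<in>{1..n}. \<epsilon> (x i j) = (if i = j then 1 else 0))"
  using ex_hom[OF comm_alg_ground comm_alg.ly_matrix_id[OF comm_alg_ground]]
      by (simp only: id_mat_def ground_simps)

context
  fixes \<Delta> \<epsilon>
  assumes \<Delta>: "algebra_hom A (tensor A A) \<Delta>" and \<epsilon>: "algebra_hom A ground \<epsilon>"
    and \<Delta>_x: "\<And>i j. i \<in> {1..n} \<Longrightarrow> j \<in> {1..n} \<Longrightarrow>
      \<Delta> (x i j) = (\<Oplus>\<^bsub>tensor A A\<^esub>s\<in>{1..n}. pure_tensor A A (x i s) (x s j))"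
    and \<epsilon>_x: "\<And>i j. i \<in> {1..n} \<Longrightarrow> j \<in> {1..n} \<Longrightarrow> \<epsilon> (x i j) = (if i = j then 1 else 0)"
begin

lemma bialgebra_A: "bialgebra A \<Delta> \<epsilon>"
proof -
  note \<Delta>' = algebra_hom_lin[OF \<Delta>] and \<epsilon>' = algebra_hom_lin[OF \<epsilon>]
  have coassoc: "tensor_map A (tensor A A) id \<Delta> (\<Delta> c) =
      tensor_assoc A A A (tensor_map (tensor A A) A \<Delta> id (\<Delta> c))" if c: "c \<in> carrier A" for c
  proof (rule hom_eq_on_gens[OF _ _ _ _ c])
    show "assoc_algebra (tensor A (tensor A A))"
      using A_AA.comm_alg_tensor by (rule comm_alg.axioms)
    show "algebra_hom A (tensor A (tensor A A)) (\<lambda>c. tensor_map A (tensor A A) id \<Delta> (\<Delta> c))"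
      by (rule algebra_hom_comp[OF \<Delta> algebra_hom_tensor_map[OF comm_alg_A comm_alg_A comm_alg_A
              AA.comm_alg_tensor algebra_hom_id(1) \<Delta>]])
    show "algebra_hom A (tensor A (tensor A A))
        (\<lambda>c. tensor_assoc A A A (tensor_map (tensor A A) A \<Delta> id (\<Delta> c)))"
      by (rule algebra_hom_comp[OF algebra_hom_comp[OF \<Delta> algebra_hom_tensor_map[OF comm_alg_A comm_alg_A
                AA.comm_alg_tensor comm_alg_A \<Delta> algebra_hom_id(1)]]
            algebra_hom_tensor_assoc[OF comm_alg_A comm_alg_A comm_alg_A]])
    \<comment> \<open>For fixed \<open>i\<close>, the elements \<open>x i j\<close> play the role of the \<open>m\<^sub>j\<close>.\<close>
    show "tensor_map A (tensor A A) id \<Delta> (\<Delta> (x i j)) =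
        tensor_assoc A A A (tensor_map (tensor A A) A \<Delta> id (\<Delta> (x i j)))"
      if i: "i \<in> {1..n}" and j: "j \<in> {1..n}" for i j
      by (rule coassoc_coaction[OF A.vspace_axioms A.vspace_axioms finite_atLeastAtMost
            x_closed[OF i] x_closed \<Delta>' \<Delta>_x[OF i] \<Delta>' \<Delta>_x j])
  qed
  have counit_right: "tensor_unit_right A (tensor_map A ground id \<epsilon> (\<Delta> c)) = c" if c: "c \<in> carrier A" for c
  proof (rule hom_eq_on_gens[OF A.assoc_algebra_axioms _ algebra_hom_id(2) _ c])
    show "algebra_hom A A (\<lambda>c. tensor_unit_right A (tensor_map A ground id \<epsilon> (\<Delta> c)))"
      by (rule algebra_hom_comp[OF algebra_hom_comp[OF \<Delta> algebra_hom_tensor_map[OF comm_alg_A comm_alg_A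
                comm_alg_A comm_alg_ground algebra_hom_id(1) \<epsilon>]] algebra_hom_tensor_unit_right[OF comm_alg_A]])
    show "tensor_unit_right A (tensor_map A ground id \<epsilon> (\<Delta> (x i j))) = x i j"
      if i: "i \<in> {1..n}" and j: "j \<in> {1..n}" for i j
      by (rule counit_coaction_delta[OF A.vspace_axioms A.vspace_axioms finite_atLeastAtMost
            x_closed[OF i] x_closed \<Delta>' \<Delta>_x[OF i] \<epsilon>' \<epsilon>_x j])
  qed
  have counit_left: "tensor_unit_left A (tensor_map ground A \<epsilon> id (\<Delta> c)) = c" if c: "c \<in> carrier A" for c
  proof (rule hom_eq_on_gens[OF A.assoc_algebra_axioms _ algebra_hom_id(2) _ c])
    let ?F = "\<lambda>z. tensor_unit_left A (tensor_map ground A \<epsilon> id z)"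
    have F: "algebra_hom (tensor A A) A ?F"
      by (rule algebra_hom_comp[OF algebra_hom_tensor_map[OF comm_alg_A comm_alg_A
                comm_alg_ground comm_alg_A \<epsilon> algebra_hom_id(1)] algebra_hom_tensor_unit_left[OF comm_alg_A]])
    then show "algebra_hom A A (\<lambda>c. ?F (\<Delta> c))" by (rule algebra_hom_comp[OF \<Delta>])
    show "?F (\<Delta> (x i j)) = x i j" if i: "i \<in> {1..n}" and j: "j \<in> {1..n}" for i j
    proof -
      have "?F (\<Delta> (x i j)) = (\<Oplus>\<^bsub>A\<^esub>s\<in>{1..n}. ?F (pure_tensor A A (x i s) (x s j)))"
        unfolding \<Delta>_x[OF i j]
        by (rule lin_map_finsum[OF T.vspace_axioms A.vspace_axioms algebra_hom_lin[OF F]])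
          (auto intro!: AA.pure_tensor_closed x_closed simp: i[simplified] j[simplified])
      also have "\<dots> = (\<Oplus>\<^bsub>A\<^esub>s\<in>{1..n}. (if s = i then 1 else 0) \<odot>\<^bsub>A\<^esub> x s j)"
      proof (rule A.finsum_cong'[OF refl])
        fix s assume s: "s \<in> {1..n}"
        have "?F (pure_tensor A A (x i s) (x s j)) = \<epsilon> (x i s) \<odot>\<^bsub>A\<^esub> x s j"
          using tensor_map_pure[OF A.vspace_axioms A.vspace_axioms vspace_ground A.vspace_axioms \<epsilon>' lin_map_id(1)
              x_closed[OF i s] x_closed[OF s j]] tensor_unit_left_pure[OF A.vspace_axioms x_closed[OF s j]]
          by simp
        then show "?F (pure_tensor A A (x i s) (x s j)) = (if s = i then 1 else 0) \<odot>\<^bsub>A\<^esub> x s j"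
          by (simp only: \<epsilon>_x[OF i s] eq_commute[of i s])
      qed (use x_closed j in blast)
      also have "\<dots> = x i j"
        by (rule A.finsum_delta[OF _ i]) (use x_closed j in auto)
      finally show ?thesis .
    qed
  qed
  show ?thesis
    by (intro bialgebra.intro coalgebra.intro coalgebra_axioms.intro bialgebra_axioms.intro
        A.assoc_algebra_axioms A.module_axioms \<Delta> \<epsilon> \<Delta>' \<epsilon>' coassoc counit_left counit_right)
qed

lemma right_comodule_A:
  assumes L: "vspace L" and basis: "is_basis L {1..n} e" and \<Phi>: "lin_map L (tensor L A) \<Phi>"
    and \<Phi>_e: "\<And>i. i \<in> {1..n} \<Longrightarrow> \<Phi> (e i) = (\<Oplus>\<^bsub>tensor L A\<^esub>s\<in>{1..n}. pure_tensor L A (e s) (x s i))"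
  shows "right_comodule L A \<Delta> \<epsilon> \<Phi>"
proof -
  note \<Delta>' = algebra_hom_lin[OF \<Delta>] and \<epsilon>' = algebra_hom_lin[OF \<epsilon>]
  interpret L: vspace L by (rule L)
  interpret LAA: tensor_triple L A A ..
  interpret LG: tensor_spaces L ground using L vspace_ground by (simp add: tensor_spaces_def)
  note e = basis_closed[OF L basis]
  have coassoc: "tensor_map L (tensor A A) id \<Delta> (\<Phi> m) =
      tensor_assoc L A A (tensor_map (tensor L A) A \<Phi> id (\<Phi> m))" if m: "m \<in> carrier L" for m
  proof (rule lin_map_eq_on_basis[OF L basis LAA.U_VW.vspace_tensor _ _ _ m])
    show "lin_map L (tensor L (tensor A A)) (\<lambda>m. tensor_map L (tensor A A) id \<Delta> (\<Phi> m))"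
      by (rule lin_map_comp[OF \<Phi> lin_map_tensor_map[OF L A.vspace_axioms L T.vspace_axioms lin_map_id(1) \<Delta>']])
    show "lin_map L (tensor L (tensor A A)) (\<lambda>m. tensor_assoc L A A (tensor_map (tensor L A) A \<Phi> id (\<Phi> m)))"
      by (rule lin_map_comp[OF lin_map_comp[OF \<Phi> lin_map_tensor_map[OF L A.vspace_axioms
                LAA.UV.vspace_tensor A.vspace_axioms \<Phi> lin_map_id(1)]] LAA.lin_map_tensor_assoc])
    show "tensor_map L (tensor A A) id \<Delta> (\<Phi> (e j)) =
        tensor_assoc L A A (tensor_map (tensor L A) A \<Phi> id (\<Phi> (e j)))" if j: "j \<in> {1..n}" for j
      by (rule coassoc_coaction[OF L A.vspace_axioms finite_atLeastAtMost e x_closed \<Phi> \<Phi>_e \<Delta>' \<Delta>_x j])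
  qed
  have counit: "tensor_unit_right L (tensor_map L ground id \<epsilon> (\<Phi> m)) = m" if m: "m \<in> carrier L" for m
  proof (rule lin_map_eq_on_basis[OF L basis L _ lin_map_id(2) _ m])
    show "lin_map L L (\<lambda>m. tensor_unit_right L (tensor_map L ground id \<epsilon> (\<Phi> m)))"
      by (rule lin_map_comp[OF lin_map_comp[OF \<Phi> lin_map_tensor_map[OF L A.vspace_axioms L vspace_ground
                lin_map_id(1) \<epsilon>']] lin_map_tensor_unit_right[OF L]])
    show "tensor_unit_right L (tensor_map L ground id \<epsilon> (\<Phi> (e j))) = e j" if j: "j \<in> {1..n}" for j
      by (rule counit_coaction_delta[OF L A.vspace_axioms finite_atLeastAtMost e x_closed \<Phi> \<Phi>_e \<epsilon>' \<epsilon>_x j])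
  qed
  show ?thesis
    by (intro right_comodule.intro right_comodule_axioms.intro L.module_axioms \<Phi> coassoc counit
        bialgebra.axioms(2)[OF bialgebra_A])
qed

end

text \<open>
  The comodule axioms alone force the values on the generators: compare the coefficients of \<open>e i\<close>
  in the axioms at \<open>e j\<close>.
\<close>

lemma comodule_formulas:
  assumes L: "vspace L" and basis: "is_basis L {1..n} e" and \<Phi>: "lin_map L (tensor L A) \<Phi>"
    and \<Phi>_e: "\<And>i. i \<in> {1..n} \<Longrightarrow> \<Phi> (e i) = (\<Oplus>\<^bsub>tensor L A\<^esub>s\<in>{1..n}. pure_tensor L A (e s) (x s i))"
    and comodule: "right_comodule L A \<Delta> \<epsilon> \<Phi>" and i: "i \<in> {1..n}" and j: "j \<in> {1..n}"
  shows "\<Delta> (x i j) = (\<Oplus>\<^bsub>tensor A A\<^esub>s\<in>{1..n}. pure_tensor A A (x i s) (x s j))"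
    and "\<epsilon> (x i j) = (if i = j then 1 else 0)"
proof -
  interpret L: vspace L by (rule L)
  interpret M: right_comodule L A \<Delta> \<epsilon> \<Phi> by (rule comodule)
  note e = basis_closed[OF L basis]
  note coaction = L A.vspace_axioms finite_atLeastAtMost e x_closed \<Phi> \<Phi>_e
  have "(\<Oplus>\<^bsub>tensor L (tensor A A)\<^esub>s\<in>{1..n}. pure_tensor L (tensor A A) (e s) (\<Delta> (x s j))) =
      tensor_map L (tensor A A) id \<Delta> (\<Phi> (e j))"
    by (rule map_right_coaction[OF coaction T.vspace_axioms M.comult_linear j, symmetric])
  also have "\<dots> = tensor_assoc L A A (tensor_map (tensor L A) A \<Phi> id (\<Phi> (e j)))"
    by (rule M.coaction_coassoc[OF e[OF j]])
  also have "\<dots> = (\<Oplus>\<^bsub>tensor L (tensor A A)\<^esub>s\<in>{1..n}. pure_tensor L (tensor A A) (e s)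
        (\<Oplus>\<^bsub>tensor A A\<^esub>t\<in>{1..n}. pure_tensor A A (x s t) (x t j)))"
    by (rule map_left_coaction[OF coaction j])
  finally show "\<Delta> (x i j) = (\<Oplus>\<^bsub>tensor A A\<^esub>s\<in>{1..n}. pure_tensor A A (x i s) (x s j))"
    by (rule tensor_basis_unique[OF L basis T.vspace_axioms _ _ _ i, rotated 2])
      (auto intro!: T.finsum_closed AA.pure_tensor_closed x_closed lin_map_closed[OF M.comult_linear]
        simp: j[simplified])
  have "(\<Oplus>\<^bsub>L\<^esub>s\<in>{1..n}. \<epsilon> (x s j) \<odot>\<^bsub>L\<^esub> e s) =
      tensor_unit_right L (tensor_map L ground id \<epsilon> (\<Phi> (e j)))"
    by (rule counit_coaction[OF coaction M.counit_linear j, symmetric])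
  also have "\<dots> = e j" by (rule M.coaction_counit[OF e[OF j]])
  also have "e j = (\<Oplus>\<^bsub>L\<^esub>s\<in>{1..n}. (if s = j then 1 else 0) \<odot>\<^bsub>L\<^esub> e s)"
    by (rule L.finsum_delta[OF finite_atLeastAtMost j, symmetric]) (use e in blast)
  finally show "\<epsilon> (x i j) = (if i = j then 1 else 0)"
    by (rule basis_unique[OF L basis _ i])
qed

end

theorem theorem3p12:
  fixes L :: "('k::field_char_0, 'l) module"
    and br :: "'l \<Rightarrow> 'l \<Rightarrow> 'l"
    and tri :: "'l \<Rightarrow> 'l \<Rightarrow> 'l \<Rightarrow> 'l"
    and n :: nat
    and e :: "nat \<Rightarrow> 'l"
    and \<tau> :: "nat \<Rightarrow> nat \<Rightarrow> nat \<Rightarrow> 'k"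
    and \<omega> :: "nat \<Rightarrow> nat \<Rightarrow> nat \<Rightarrow> nat \<Rightarrow> 'k"
    and A :: "('k, 'k matrix_poly set) module"
    and x :: "nat \<Rightarrow> nat \<Rightarrow> 'k matrix_poly set"
    and \<Phi> :: "'l \<Rightarrow> ('k, 'l, 'k matrix_poly set) tens"
  assumes "lie_yamaguti L br tri"
    and "is_basis L {1..n} e"
    and "\<forall>i\<in>{1..n}. \<forall>j\<in>{1..n}. br (e i) (e j) = (\<Oplus>\<^bsub>L\<^esub>s\<in>{1..n}. \<tau> s i j \<odot>\<^bsub>L\<^esub> e s)"
    and "\<forall>i\<in>{1..n}. \<forall>j\<in>{1..n}. \<forall>k\<in>{1..n}.
           tri (e i) (e j) (e k) = (\<Oplus>\<^bsub>L\<^esub>s\<in>{1..n}. \<omega> s i j k \<odot>\<^bsub>L\<^esub> e s)"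
    and "A = universal_algebra n \<tau> \<omega>"
    and "x = universal_gen n \<tau> \<omega>"
    and "lin_map L (tensor L A) \<Phi>"
    and "\<forall>i\<in>{1..n}. \<Phi> (e i) = (\<Oplus>\<^bsub>tensor L A\<^esub>s\<in>{1..n}. pure_tensor L A (e s) (x s i))"
  shows "(\<exists>!(\<Delta>, \<epsilon>). \<Delta> \<in> extensional (carrier A) \<and> \<epsilon> \<in> extensional (carrier A) \<and>
            bialgebra A \<Delta> \<epsilon> \<and> right_comodule L A \<Delta> \<epsilon> \<Phi>) \<and>
         (\<forall>\<Delta> \<epsilon>. bialgebra A \<Delta> \<epsilon> \<and> right_comodule L A \<Delta> \<epsilon> \<Phi> \<longrightarrow>
            (\<forall>i\<in>{1..n}. \<forall>j\<in>{1..n}.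
               \<Delta> (x i j) = (\<Oplus>\<^bsub>tensor A A\<^esub>s\<in>{1..n}. pure_tensor A A (x i s) (x s j)) \<and>
               \<epsilon> (x i j) = (if i = j then 1 else 0)))"
proof -
  interpret L: lie_yamaguti L br tri by fact
  have L: "vspace L" by (simp add: vspace_def L.module_axioms)
  interpret U: universal_alg n "matrix_poly_algebra n" \<tau> \<omega> by unfold_locales simp
  have A: "comm_alg A" using U.comm_alg_A assms(5) by simp
  interpret A: comm_alg A by (rule A)
  interpret AA: tensor_algebras A A ..
  interpret T: comm_alg "tensor A A" by (rule AA.comm_alg_tensor)
  have x_closed: "x i j \<in> carrier A" if "i \<in> {1..n}" "j \<in> {1..n}" for i j
    using U.x_closed[OF that] assms(5,6) by simp
  have formulas: "\<Delta> (x i j) = (\<Oplus>\<^bsub>tensor A A\<^esub>s\<in>{1..n}. pure_tensor A A (x i s) (x s j))"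
    "\<epsilon> (x i j) = (if i = j then 1 else 0)"
    if "right_comodule L A \<Delta> \<epsilon> \<Phi>" "i \<in> {1..n}" "j \<in> {1..n}" for \<Delta> \<epsilon> i j
    using U.comodule_formulas[folded assms(5,6), OF L assms(2,7) _ that] assms(8) by blast+
  obtain \<Delta> where \<Delta>: "algebra_hom A (tensor A A) \<Delta>"
    "\<And>i j. i \<in> {1..n} \<Longrightarrow> j \<in> {1..n} \<Longrightarrow> \<Delta> (x i j) = (\<Oplus>\<^bsub>tensor A A\<^esub>s\<in>{1..n}. pure_tensor A A (x i s) (x s j))"
    using U.ex_comult assms(5,6) by blast
  obtain \<epsilon> where \<epsilon>: "algebra_hom A ground \<epsilon>"
    "\<And>i j. i \<in> {1..n} \<Longrightarrow> j \<in> {1..n} \<Longrightarrow> \<epsilon> (x i j) = (if i = j then 1 else 0)"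
    using U.ex_counit assms(5,6) by blast
  \<comment> \<open>Outside the carrier, extensional functions take a default value.\<close>
  let ?\<Delta> = "restrict \<Delta> (carrier A)" and ?\<epsilon> = "restrict \<epsilon> (carrier A)"
  have hom: "algebra_hom A (tensor A A) ?\<Delta>" "algebra_hom A ground ?\<epsilon>"
    using algebra_hom_cong[OF A.assoc_algebra_axioms _ \<Delta>(1)] algebra_hom_cong[OF A.assoc_algebra_axioms _ \<epsilon>(1)]
    by simp_all
  have gens: "?\<Delta> (x i j) = (\<Oplus>\<^bsub>tensor A A\<^esub>s\<in>{1..n}. pure_tensor A A (x i s) (x s j))"
    "?\<epsilon> (x i j) = (if i = j then 1 else 0)" if "i \<in> {1..n}" "j \<in> {1..n}" for i j
    using x_closed[OF that] \<Delta>(2)[OF that] \<epsilon>(2)[OF that] by simp_all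
  have bialg: "bialgebra A ?\<Delta> ?\<epsilon>"
    using U.bialgebra_A[folded assms(5,6), OF hom gens] .
  have comod: "right_comodule L A ?\<Delta> ?\<epsilon> \<Phi>"
    using U.right_comodule_A[folded assms(5,6), OF hom gens L assms(2,7)] assms(8) by blast
  have unique: "\<Delta>' = ?\<Delta> \<and> \<epsilon>' = ?\<epsilon>"
    if "\<Delta>' \<in> extensional (carrier A)" "\<epsilon>' \<in> extensional (carrier A)"
      "bialgebra A \<Delta>' \<epsilon>'" "right_comodule L A \<Delta>' \<epsilon>' \<Phi>" for \<Delta>' \<epsilon>'
  proof
    interpret B: bialgebra A \<Delta>' \<epsilon>' by (rule that(3))
    note eq = U.hom_eq_on_gens[folded assms(5,6)]
    have "\<Delta>' c = ?\<Delta> c" if "c \<in> carrier A" for c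
      by (rule eq[OF T.assoc_algebra_axioms B.comult_hom hom(1) _ that])
        (simp only: formulas(1)[OF \<open>right_comodule L A \<Delta>' \<epsilon>' \<Phi>\<close>] gens(1))
    then show "\<Delta>' = ?\<Delta>" using that(1) by (intro extensionalityI[of _ "carrier A"]) auto
    have "\<epsilon>' c = ?\<epsilon> c" if "c \<in> carrier A" for c
      by (rule eq[OF comm_alg.axioms(1)[OF comm_alg_ground] B.counit_hom hom(2) _ that])
        (simp only: formulas(2)[OF \<open>right_comodule L A \<Delta>' \<epsilon>' \<Phi>\<close>] gens(2))
    then show "\<epsilon>' = ?\<epsilon>" using that(2) by (intro extensionalityI[of _ "carrier A"]) auto
  qed
  show ?thesis
  proof (intro conjI allI impI ballI)
    show "\<exists>!(\<Delta>, \<epsilon>). \<Delta> \<in> extensional (carrier A) \<and> \<epsilon> \<in> extensional (carrier A) \<and>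
            bialgebra A \<Delta> \<epsilon> \<and> right_comodule L A \<Delta> \<epsilon> \<Phi>"
      by (rule ex1I[of _ "(?\<Delta>, ?\<epsilon>)"]) (use bialg comod unique in auto)
  next
    fix \<Delta> \<epsilon> i j
    assume "bialgebra A \<Delta> \<epsilon> \<and> right_comodule L A \<Delta> \<epsilon> \<Phi>" "i \<in> {1..n}" "j \<in> {1..n}"
    then show "\<Delta> (x i j) = (\<Oplus>\<^bsub>tensor A A\<^esub>s\<in>{1..n}. pure_tensor A A (x i s) (x s j))"
      "\<epsilon> (x i j) = (if i = j then 1 else 0)"
      using formulas[of \<Delta> \<epsilon> i j] by blast+
  qed
qed

end
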